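(* Let $a\in\hat{\mathbb R}$, let $(n_j)_{j\ge1}$ be an increasing sequence of positive integers, and let $(p_j)_{j\ge 1}$ be a sequence of real rooted polynomials, $p_j$ being of formal degree $n_j$ (i.e. $p_j\in\mathcal P_{n_j}(\hat{\mathbb R})$), such that $\mu\llbracket p_j\rrbracket$ converges weakly to a probability measure $\mu\in\mathcal M(\mathbb R)$. Let $t\ge 1$ and let $(m_j)_{j\ge1}$ be a sequence of positive integers with $m_j\le n_j$ and $\lim_{j\to\infty}\frac{n_j}{m_j}=t$. Assume that for all $j$ the polynomial $p_j$ has less than $m_j$ roots equal to $a$. Then, weakly, $$\lim_{j\to\infty}\mu\llbracket D_a^{m_j|n_j}p_j\rrbracket = F_a^t\mu .$$
   Context: Measures. $\hat{\mathbb R}=\mathbb R\cup\{\infty\}$ and $\hat{\mathbb C}=\mathbb C\cup\{\infty\}$ (Riemann sphere; $\hat{\mathbb R}$ has the subspace topology). For Borel $K\subset\hat{\mathbb R}$, $\mathcal M(K)$ is the set of Borel probability measures $\mu$ on $\hat{\mathbb C}$ vanishing outside $K$. Weak convergence in $\mathcal M(\hat{\mathbb R})$ means convergence of integrals of bounded continuous functions on $\hat{\mathbb R}$. For a Möbius transformation $T$, $T_*\mu(E)=\mu(T^{-1}(E))$. For $\mu\in\mathcal M(\mathbb R)$ and $t\ge1$, $\mu^{\boxplus t}$ is the fractional free additive convolution power, determined by $R_{\mu^{\boxplus t}}=tR_\mu$, where $R_\mu(z)=G_\mu^{\langle-1\rangle}(z)-\frac1z$ and $G_\mu(z)=\int\frac{1}{z-x}\,d\mu(x)$.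 Then $F^t\mu\in\mathcal M(\mathbb R)$ is the pushforward of $\mu^{\boxplus t}$ under $x\mapsto x/t$. For $\mu=s\delta_\infty+(1-s)\nu\in\mathcal M(\hat{\mathbb R})$ with $\nu\in\mathcal M(\mathbb R)$, $0\le s\le1$, set $F^t\mu=ts\,\delta_\infty+(1-ts)F^{\frac{t-ts}{1-ts}}\nu$ if $ts<1$ and $F^t\mu=\delta_\infty$ if $ts\ge1$. For $a\in\hat{\mathbb R}$, $F_a^t\mu:=T^{-1}_*F^tT_*\mu$, where $T(z)=\frac1{z-a}$ if $a\in\mathbb R$ and $T(z)=z$ if $a=\infty$. Polynomials. $\mathcal P_n(\hat{\mathbb C})$ is the set of polynomials $a_0+a_1z+\dots+a_nz^n$ with complex coefficients ($a_n$ may be $0$); $n$ is the formal degree. A nonzero $p\in\mathcal P_n(\hat{\mathbb C})$ of precise degree $k$ is regarded as having $n-k$ roots at $\infty$, so it has exactly $n$ roots in $\hat{\mathbb C}$, counted with multiplicity; $\mu\llbracket p\rrbracket=\frac1n\sum_{i=1}^n\delta_{\lambda_i}$, where $\lambda_1,\dots,\lambda_n$ are these roots. $\mathcal P_n(K)$ is the set of nonzero $p\in\mathcal P_n(\hat{\mathbb C})$ with all $n$ roots in $K$. The polar derivative $D_a:\mathcal P_n(\hat{\mathbb C})\to\mathcal P_{n-1}(\hat{\mathbb C})$ is $D_ap(x)=np(x)-(x-a)p'(x)$ for $a\ne\infty$ ($n$ the formal degree) and $D_\infty p=p'$. $D_a^{m|n}:\mathcal P_n(\hat{\mathbb C})\to\mathcal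 P_m(\hat{\mathbb C})$ denotes applying the $a$-polar derivative $n-m$ times, the formal degree decreasing by one each time. *)

theory Defs
  imports "HOL-Probability.Probability" "HOL-Computational_Algebra.Fundamental_Theorem_Algebra"
begin

section \<open>Measures on the Riemann sphere\<close>

text \<open>The point at infinity is \<open>None\<close>, a finite point \<open>z\<close> is \<open>Some z\<close>.\<close>

definition riemann_sphere :: "complex option topology" where
  "riemann_sphere = Alexandroff_compactification euclidean"

definition sphere_borel :: "complex option measure" where
  "sphere_borel = sigma (topspace riemann_sphere) {U. openin riemann_sphere U}"

definition real_line :: "complex option set" where
  "real_line = Some ` \<real>"

definition extended_real_line :: "complex option set" where
  "extended_real_line = insert None (Some ` \<real>)"

text \<open>To be used for Borel sets \<open>K\<close> only: \<^const>\<open>emeasure\<close> is zero on non-measurable sets.\<close>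

definition prob_measures_on :: "complex option set \<Rightarrow> complex option measure set" where
  "prob_measures_on K =
     {\<mu>. sets \<mu> = sets sphere_borel \<and> prob_space \<mu> \<and> emeasure \<mu> (- K) = 0}"

text \<open>Weak convergence is a notion for measures carried by the extended real line, so membership is part
  of it; test functions live on the extended real line only.\<close>

definition weakly_converges :: "(nat \<Rightarrow> complex option measure) \<Rightarrow> complex option measure \<Rightarrow> bool" where
  "weakly_converges M N \<longleftrightarrow>
     (\<forall>j. M j \<in> prob_measures_on extended_real_line) \<and>
     N \<in> prob_measures_on extended_real_line \<and>
     (\<forall>f :: complex option \<Rightarrow> real.
        continuous_map (subtopology riemann_sphere extended_real_line) euclideanreal f \<and>
        bounded (f ` extended_real_line) \<longrightarrow>
        (\<lambda>j. LINT x:extended_real_line|M j. f x) \<longlonglongrightarrow> (LINT x:extended_real_line|N. f x))"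

text \<open>The convex combination \<open>s \<mu> + (1 - s) \<nu>\<close>, for \<open>0 \<le> s \<le> 1\<close> and measures on the same
  \<open>\<sigma>\<close>-algebra.\<close>

definition mix :: "real \<Rightarrow> 'a measure \<Rightarrow> 'a measure \<Rightarrow> 'a measure" where
  "mix s \<mu> \<nu> = measure_of (space \<mu>) (sets \<mu>)
     (\<lambda>A. ennreal s * emeasure \<mu> A + ennreal (1 - s) * emeasure \<nu> A)"

text \<open>The Moebius transformation \<open>z \<mapsto> 1 / (z - a)\<close>, respectively the identity for \<open>a = \<infinity>\<close>.\<close>

fun to_infinity :: "complex option \<Rightarrow> complex option \<Rightarrow> complex option" where
  "to_infinity None z = z"
| "to_infinity (Some a) None = Some 0"
| "to_infinity (Some a) (Some z) = (if z = a then None else Some (1 / (z - a)))"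


section \<open>Fractional free convolution powers\<close>

text \<open>The Cauchy transform is used only for measures without mass at infinity.\<close>

definition cauchy_transform :: "complex option measure \<Rightarrow> complex \<Rightarrow> complex" where
  "cauchy_transform \<mu> z = (LINT x|\<mu>. (case x of None \<Rightarrow> 0 | Some y \<Rightarrow> 1 / (z - y)))"

definition stolz_cone :: "real \<Rightarrow> real \<Rightarrow> complex set" where
  "stolz_cone \<alpha> \<beta> = {w. Im w > \<beta> \<and> \<bar>Re w\<bar> < \<alpha> * Im w}"

text \<open>For measures of unbounded support, the compositional inverse of the Cauchy transform exists only
  in the sense of Bercovici and Voiculescu: \<open>G\<close> is injective on \<open>\<Gamma> = stolz_cone \<alpha> \<beta>\<close> for \<open>\<beta>\<close> large
  enough (depending on \<open>\<alpha>\<close>), and \<open>G ` \<Gamma>\<close> contains \<open>1 / \<zeta>\<close> for all \<open>\<zeta>\<close> in a smaller cone.\<close>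

definition R_transform :: "complex set \<Rightarrow> complex option measure \<Rightarrow> complex \<Rightarrow> complex" where
  "R_transform \<Gamma> \<mu> z = the_inv_into \<Gamma> (cauchy_transform \<mu>) z - 1 / z"

text \<open>The identity \<open>R\<^sub>\<nu> = t R\<^sub>\<mu>\<close>, as an identity between analytic functions on a common domain of
  the above kind. By analytic continuation the choice of the cones does not matter.\<close>

definition R_transforms_scaled ::
    "real \<Rightarrow> complex option measure \<Rightarrow> complex option measure \<Rightarrow> bool" where
  "R_transforms_scaled t \<mu> \<nu> \<longleftrightarrow>
     (\<exists>\<alpha> \<beta> \<alpha>' \<beta>'. \<alpha> > 0 \<and> \<beta> > 0 \<and> \<alpha>' > 0 \<and> \<beta>' > 0 \<and>
        (let \<Gamma> = stolz_cone \<alpha> \<beta> in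
           inj_on (cauchy_transform \<mu>) \<Gamma> \<and> inj_on (cauchy_transform \<nu>) \<Gamma> \<and>
           (\<forall>\<zeta> \<in> stolz_cone \<alpha>' \<beta>'.
              1 / \<zeta> \<in> cauchy_transform \<mu> ` \<Gamma> \<inter> cauchy_transform \<nu> ` \<Gamma> \<and>
              R_transform \<Gamma> \<nu> (1 / \<zeta>) = of_real t * R_transform \<Gamma> \<mu> (1 / \<zeta>))))"

definition free_power :: "complex option measure \<Rightarrow> real \<Rightarrow> complex option measure" where
  "free_power \<mu> t = (THE \<nu>. \<nu> \<in> prob_measures_on real_line \<and> R_transforms_scaled t \<mu> \<nu>)"

definition free_flow_finite :: "real \<Rightarrow> complex option measure \<Rightarrow> complex option measure" where
  "free_flow_finite t \<mu> = distr (free_power \<mu> t) sphere_borel (map_option (\<lambda>x. x / of_real t))"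

text \<open>In the decomposition \<open>\<mu> = s \<delta>\<^sub>\<infinity> + (1 - s) \<nu>\<close> one has \<open>s = \<mu>({\<infinity>})\<close>, and \<open>\<nu>\<close> is \<open>\<mu>\<close> conditioned on
  the finite points, which is what \<^const>\<open>uniform_measure\<close> expresses; see \<open>mix_decomposition\<close>
  below.\<close>

definition free_flow :: "real \<Rightarrow> complex option measure \<Rightarrow> complex option measure" where
  "free_flow t \<mu> =
     (let s = measure \<mu> {None}; \<nu> = uniform_measure \<mu> (range Some) in
      if t * s < 1
      then mix (t * s) (return sphere_borel None) (free_flow_finite ((t - t * s) / (1 - t * s)) \<nu>)
      else return sphere_borel None)"

definition free_flow_at ::
    "complex option \<Rightarrow> real \<Rightarrow> complex option measure \<Rightarrow> complex option measure" where
  "free_flow_at a t \<mu> =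
     distr (free_flow t (distr \<mu> sphere_borel (to_infinity a))) sphere_borel (inv (to_infinity a))"


section \<open>Polynomials of a given formal degree\<close>

definition sphere_roots :: "nat \<Rightarrow> complex poly \<Rightarrow> complex option multiset" where
  "sphere_roots n p = image_mset Some (proots p) + replicate_mset (n - degree p) None"

definition polys_with_roots_in :: "nat \<Rightarrow> complex option set \<Rightarrow> complex poly set" where
  "polys_with_roots_in n K = {p. p \<noteq> 0 \<and> degree p \<le> n \<and> set_mset (sphere_roots n p) \<subseteq> K}"

text \<open>Only meaningful for \<open>n > 0\<close>, \<open>p \<noteq> 0\<close> and \<open>degree p \<le> n\<close>; see \<open>emeasure_root_measure\<close> below.\<close>

definition root_measure :: "nat \<Rightarrow> complex poly \<Rightarrow> complex option measure" where
  "root_measure n p = distr (measure_pmf (pmf_of_multiset (sphere_roots n p))) sphere_borel id"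

definition polar_deriv :: "complex option \<Rightarrow> nat \<Rightarrow> complex poly \<Rightarrow> complex poly" where
  "polar_deriv a n p =
     (case a of None \<Rightarrow> pderiv p
      | Some c \<Rightarrow> smult (of_nat n) p - [:- c, 1:] * pderiv p)"

fun polar_deriv_iter :: "complex option \<Rightarrow> nat \<Rightarrow> nat \<Rightarrow> complex poly \<Rightarrow> complex poly" where
  "polar_deriv_iter a 0 n p = p"
| "polar_deriv_iter a (Suc k) n p = polar_deriv_iter a k (n - 1) (polar_deriv a n p)"

text \<open>The iterated polar derivative from formal degree \<open>n\<close> down to formal degree \<open>m \<le> n\<close>.\<close>

definition polar_deriv_down :: "complex option \<Rightarrow> nat \<Rightarrow> nat \<Rightarrow> complex poly \<Rightarrow> complex poly" where
  "polar_deriv_down a m n p = polar_deriv_iter a (n - m) n p"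


section \<open>Basic facts\<close>

lemma topspace_riemann_sphere [simp]: "topspace riemann_sphere = UNIV"
  by (auto simp: riemann_sphere_def intro: option.exhaust)

lemma space_sphere_borel [simp]: "space sphere_borel = UNIV"
  by (simp add: sphere_borel_def)

lemma sphere_borel_openI: "openin riemann_sphere U \<Longrightarrow> U \<in> sets sphere_borel"
  by (simp add: sphere_borel_def sets_measure_of)

lemma finite_points_sphere_borel: "range Some \<in> sets sphere_borel"
  by (rule sphere_borel_openI)
     (simp add: riemann_sphere_def)

lemma infinity_sphere_borel: "{None} \<in> sets sphere_borel"
proof -
  have "{None} = space sphere_borel - range (Some :: complex \<Rightarrow> _)"
    by (auto simp: notin_range_Some)
  then show ?thesis
    using finite_points_sphere_borel sets.compl_sets by metis
qed

lemma extended_real_line_sphere_borel: "extended_real_line \<in> sets sphere_borel"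
proof -
  have "openin riemann_sphere (Some ` (- \<real>))"
    by (simp add: riemann_sphere_def open_Compl closed_complex_Reals)
  moreover have "extended_real_line = space sphere_borel - Some ` (- \<real>)"
  proof (rule set_eqI)
    fix x show "x \<in> extended_real_line \<longleftrightarrow> x \<in> space sphere_borel - Some ` (- \<real>)"
      by (cases x) (auto simp: extended_real_line_def)
  qed
  ultimately show ?thesis
    using sphere_borel_openI sets.compl_sets by metis
qed

lemma real_line_sphere_borel: "real_line \<in> sets sphere_borel"
proof -
  have "extended_real_line - {None} \<in> sets sphere_borel"
    using extended_real_line_sphere_borel infinity_sphere_borel by (rule sets.Diff)
  also have "extended_real_line - {None} = real_line"
    unfolding real_line_def extended_real_line_def by blast
  finally show ?thesis .
qed

lemma sets_mix [simp]: "sets (mix s \<mu> \<nu>) = sets \<mu>"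
  by (simp add: mix_def sets.sets_measure_of_eq)

lemma emeasure_mix:
  assumes "sets \<nu> = sets \<mu>" "A \<in> sets \<mu>"
  shows "emeasure (mix s \<mu> \<nu>) A = ennreal s * emeasure \<mu> A + ennreal (1 - s) * emeasure \<nu> A"
proof (rule emeasure_measure_of[OF mix_def])
  show "countably_additive (sets (mix s \<mu> \<nu>))
      (\<lambda>A. ennreal s * emeasure \<mu> A + ennreal (1 - s) * emeasure \<nu> A)"
  proof (rule countably_additiveI)
    fix B :: "nat \<Rightarrow> 'a set"
    assume B: "range B \<subseteq> sets (mix s \<mu> \<nu>)" "disjoint_family B"
    have "(\<Sum>i. emeasure \<mu> (B i)) = emeasure \<mu> (\<Union>i. B i)"
      using B by (intro suminf_emeasure) auto
    moreover have "(\<Sum>i. emeasure \<nu> (B i)) = emeasure \<nu> (\<Union>i. B i)"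
      using B assms(1) by (intro suminf_emeasure) auto
    ultimately show "(\<Sum>i. ennreal s * emeasure \<mu> (B i) + ennreal (1 - s) * emeasure \<nu> (B i)) =
        ennreal s * emeasure \<mu> (\<Union>i. B i) + ennreal (1 - s) * emeasure \<nu> (\<Union>i. B i)"
      by (subst suminf_add[symmetric]) (simp_all only: ennreal_suminf_cmult summableI)
  qed
  show "A \<in> sets (mix s \<mu> \<nu>)"
    using assms(2) by simp
  show "sets \<mu> \<subseteq> Pow (space \<mu>)"
    by (rule sets.space_closed)
qed (simp add: positive_def)

lemma mix_decomposition:
  assumes "prob_space \<mu>" "sets \<mu> = sets sphere_borel" "measure \<mu> {None} < 1"
  shows "\<mu> = mix (measure \<mu> {None}) (return sphere_borel None) (uniform_measure \<mu> (range Some))"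
proof (rule measure_eqI)
  interpret prob_space \<mu> by fact
  let ?s = "measure \<mu> {None}" and ?F = "range (Some :: complex \<Rightarrow> _)"
  have sp: "space \<mu> = UNIV"
    using sets_eq_imp_space_eq[OF assms(2)] by simp
  have F: "?F \<in> sets \<mu>" and I: "{None} \<in> sets \<mu>"
    using finite_points_sphere_borel infinity_sphere_borel assms(2) by auto
  have "?F = space \<mu> - {None}"
    using sp by (auto simp: notin_range_Some)
  then have prob_F: "measure \<mu> ?F = 1 - ?s"
    using prob_compl[OF I] by simp
  fix A assume A: "A \<in> sets \<mu>"
  have "measure \<mu> A = measure \<mu> (A \<inter> {None}) + measure \<mu> (?F \<inter> A)"
  proof -
    have "A = (A \<inter> {None}) \<union> (?F \<inter> A)" by (auto simp: notin_range_Some)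
    moreover have "measure \<mu> \<dots> = measure \<mu> (A \<inter> {None}) + measure \<mu> (?F \<inter> A)"
      using A F I by (intro finite_measure_Union) auto
    ultimately show ?thesis by simp
  qed
  moreover have "measure \<mu> (A \<inter> {None}) = ?s * indicator A None"
    by (cases "None \<in> A") auto
  ultimately have *: "measure \<mu> A = ?s * indicator A None + (1 - ?s) * (measure \<mu> (?F \<inter> A) / (1 - ?s))"
    using assms(3) by simp
  have "emeasure (mix ?s (return sphere_borel None) (uniform_measure \<mu> ?F)) A =
      ennreal ?s * indicator A None + ennreal (1 - ?s) * (emeasure \<mu> (?F \<inter> A) / emeasure \<mu> ?F)"
    using A F assms(2) by (subst emeasure_mix) auto
  also have "\<dots> = ennreal (?s * indicator A None + (1 - ?s) * (measure \<mu> (?F \<inter> A) / (1 - ?s)))"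
    using assms(3)
    by (simp add: emeasure_eq_measure prob_F divide_ennreal ennreal_mult' ennreal_plus[symmetric]
        ennreal_indicator[symmetric] del: ennreal_plus)
       (simp add: ennreal_mult'[symmetric] ennreal_plus[symmetric] del: ennreal_plus)
  also have "\<dots> = emeasure \<mu> A"
    using * by (simp add: emeasure_eq_measure)
  finally show "emeasure \<mu> A =
      emeasure (mix ?s (return sphere_borel None) (uniform_measure \<mu> ?F)) A" ..
qed (use assms in simp)

lemma bij_to_infinity: "bij (to_infinity a)"
proof (cases a)
  case None
  then have "to_infinity a = id" by auto
  then show ?thesis by simp
next
  case (Some c)
  define g where "g w = (case w of None \<Rightarrow> Some c | Some v \<Rightarrow> if v = 0 then None else Some (c + 1 / v))" for w
  show ?thesis
  proof (rule o_bij)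
    show "g \<circ> to_infinity a = id"
    proof
      fix x show "(g \<circ> to_infinity a) x = id x" by (cases x) (auto simp: g_def Some)
    qed
    show "to_infinity a \<circ> g = id"
    proof
      fix x show "(to_infinity a \<circ> g) x = id x" by (cases x) (auto simp: g_def Some)
    qed
  qed
qed

lemma size_sphere_roots: "degree p \<le> n \<Longrightarrow> size (sphere_roots n p) = n"
  by (simp add: sphere_roots_def size_proots_complex)

lemma sum_mset_eq_sum:
  fixes f :: "'a \<Rightarrow> real"
  assumes "finite S" "set_mset R \<subseteq> S"
  shows "(\<Sum>z\<in>#R. f z) = (\<Sum>z\<in>S. real (count R z) * f z)"
  using assms(2)
proof (induction R)
  case (add x R)
  have "(\<Sum>z\<in>S. real (count (add_mset x R) z) * f z) =
      (\<Sum>z\<in>S. real (count R z) * f z + (if z = x then f z else 0))"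
    by (intro sum.cong) (auto simp: algebra_simps)
  then show ?case
    using add assms(1) by (simp add: sum.distrib)
qed simp

lemma emeasure_root_measure:
  assumes "n > 0" "degree p \<le> n" "A \<in> sets sphere_borel"
  shows "emeasure (root_measure n p) A =
     ennreal (1 / n * (\<Sum>z\<in>#sphere_roots n p. indicator A z))"
proof -
  let ?R = "sphere_roots n p"
  have ne: "?R \<noteq> {#}" using size_sphere_roots[OF assms(2)] assms(1) by auto
  have "emeasure (root_measure n p) A = emeasure (measure_pmf (pmf_of_multiset ?R)) A"
    using assms(3) by (simp add: root_measure_def emeasure_distr)
  also have "\<dots> = emeasure (measure_pmf (pmf_of_multiset ?R)) (A \<inter> set_mset ?R)"
    using ne by (metis emeasure_Int_set_pmf set_pmf_of_multiset)
  also have "\<dots> = ennreal (\<Sum>z\<in>A \<inter> set_mset ?R. count ?R z / size ?R)"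
    using ne by (simp add: emeasure_measure_pmf_finite sum_ennreal)
  also have "(\<Sum>z\<in>A \<inter> set_mset ?R. count ?R z / size ?R) =
      1 / n * (\<Sum>z\<in>set_mset ?R. real (count ?R z) * indicator A z)"
    by (simp add: size_sphere_roots[OF assms(2)] sum_divide_distrib[symmetric] indicator_def
        sum.inter_restrict Int_commute[of A] if_distrib cong: if_cong)
  also have "(\<Sum>z\<in>set_mset ?R. real (count ?R z) * indicator A z) =
      (\<Sum>z\<in>#?R. indicator A z)"
    by (rule sum_mset_eq_sum[symmetric]) auto
  finally show ?thesis .
qed

end

theory Submission
  imports Defs
begin

text \<open>The map \<open>z \<mapsto> 1 / (z - a)\<close> turns the polar derivative with respect to \<open>a\<close> into ordinary
differentiation, if polynomials are transformed as polynomials of their formal degree. So everything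
reduces to derivatives of real-rooted polynomials, at the price of a limit measure \<open>M\<close> that may
have an atom at infinity.

Let \<open>u\<^sub>k = p\<^sub>k' / p\<^sub>k\<close> be the logarithmic derivative of the \<open>k\<close>-th derivative
\<open>p\<^sub>k\<close> of a polynomial of degree about \<open>n\<close>. From \<open>p\<^sub>k' = u\<^sub>k p\<^sub>k\<close> one gets
\<open>u\<^sub>k\<^sub>+\<^sub>1 = u\<^sub>k + u\<^sub>k' / u\<^sub>k\<close>, which to first order says
\<open>u\<^sub>k\<^sub>+\<^sub>1(z) = u\<^sub>k(z + 1 / u\<^sub>k(z))\<close>: differentiation transports the
logarithmic derivative along characteristics on which it is constant, as in an Euler scheme for a
Burgers equation. For real roots the error is controlled by \<open>u\<^sub>k(z)\<close> itself, since
\<open>\<Sum> 1 / \<bar>z - x\<bar>\<^sup>2 = - Im u\<^sub>k(z) / Im z\<close> (lemma \<open>log_deriv_pderiv_near\<close>).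
Following the characteristic that ends in \<open>z\<close> backwards through all \<open>K\<close> differentiations gives
\<open>u\<^sub>K(z) = u\<^sub>0(z + K / u\<^sub>K(z))\<close> up to an error that is negligible as soon as
\<open>u\<^sub>K(z)\<close> has order \<open>n\<close> (lemma \<open>backward_characteristic\<close>).

After division by \<open>n\<close>, every weak limit \<open>\<sigma>\<close> of the root measures of the derivatives
satisfies \<open>G\<^sub>\<sigma>(z) / t = G\<^sub>M(z + (t - 1) / G\<^sub>\<sigma>(z))\<close> on the upper half plane,
unless it is the point mass at infinity (lemma \<open>limit_functional_equation\<close>). Comparing both sides as
\<open>z \<rightarrow> \<i>\<infinity>\<close> then yields \<open>\<sigma>{\<infinity>} = t M{\<infinity>}\<close>, and a version of
Rolle's theorem for the Poisson kernel shows that the mass cannot escape completely if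
\<open>t M{\<infinity>} < 1\<close>.

For the finite parts, this functional equation is the relation between R-transforms that defines
free convolution powers. It has only one solution: by the Schwarz-Pick lemma it determines
\<open>G\<^sub>\<sigma>(z)\<close> pointwise (lemma \<open>free_power_equation_unique\<close>), and the values of the Cauchy
transform near one point determine the measure (theorem \<open>cauchy_transform_determines_measure\<close>).
The limits found by compactness provide the convolution powers: estimates in Stolz cones show
that a solution of the functional equation satisfies the defining relation, and uniqueness shows
that no other measure does (theorem \<open>free_flow_finite_eqI\<close>). So all weak limits agree with the free
flow of \<open>M\<close>, and by weak compactness the whole sequence converges to it.\<close>


section \<open>Logarithmic derivatives of real-rooted polynomials\<close>

lemma Im_inverse_diff_real:
  assumes "x \<in> \<real>"
  shows "Im (1 / (z - x)) = - Im z / (norm (z - x))\<^sup>2"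
proof -
  obtain r where "x = of_real r" using assms by (auto elim: Reals_cases)
  then show ?thesis by (simp add: Im_divide cmod_power2)
qed

lemma Im_le_norm_diff_real: "x \<in> \<real> \<Longrightarrow> \<bar>Im z\<bar> \<le> norm (z - x)"
  using abs_Im_le_cmod[of "z - x"] by (simp add: complex_is_Real_iff)

text \<open>All summands have imaginary parts of the same strict sign; this forces the critical points of a real-rooted
polynomial to be real.\<close>

lemma Im_mult_Im_sum_inverse_neg:
  assumes "set_mset R \<subseteq> \<real>" "R \<noteq> {#}" "Im z \<noteq> 0"
  shows "Im z * Im (\<Sum>x\<in>#R. 1 / (z - x)) < 0"
  using assms
proof (induction R)
  case (add x R)
  have *: "Im z * Im (1 / (z - x)) < 0"
  proof -
    have "x \<in> \<real>" using add.prems by auto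
    moreover from this have "norm (z - x) > 0"
      using Im_le_norm_diff_real[of x z] add.prems by linarith
    ultimately show ?thesis
      using add.prems by (simp add: Im_inverse_diff_real zero_less_mult_iff flip: power2_eq_square)
  qed
  show ?case
  proof (cases "R = {#}")
    case False
    then have "Im z * Im (\<Sum>x\<in>#R. 1 / (z - x)) < 0" using add by auto
    with * show ?thesis by (simp add: distrib_left del: Im_divide)
  qed (use * in simp)
qed simp

text \<open>For real \<open>x\<close> the number \<open>1 / \<bar>z - x\<bar>\<^sup>2\<close> is \<open>- Im (1 / (z - x)) / Im z\<close>. Through this
identity every error term below is bounded by the logarithmic derivative itself, uniformly in the position of
the roots.\<close>

lemma norm_sum_inverse_square_le:
  assumes "set_mset R \<subseteq> \<real>" "Im z > 0"
  shows "norm (\<Sum>x\<in>#R. 1 / (z - x)^2) \<le> - Im (\<Sum>x\<in>#R. 1 / (z - x)) / Im z"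
  using assms
proof (induction R)
  case (add x R)
  have "norm (1 / (z - x)^2) = - Im (1 / (z - x)) / Im z"
    using add.prems by (simp add: Im_inverse_diff_real norm_divide norm_power)
  then have "norm (\<Sum>x\<in>#add_mset x R. 1 / (z - x)^2) \<le> - Im (1 / (z - x)) / Im z + norm (\<Sum>x\<in>#R. 1 / (z - x)^2)"
    using norm_triangle_ineq[of "1 / (z - x)^2" "\<Sum>x\<in>#R. 1 / (z - x)^2"] by (simp del: Im_divide)
  also have "norm (\<Sum>x\<in>#R. 1 / (z - x)^2) \<le> - Im (\<Sum>x\<in>#R. 1 / (z - x)) / Im z"
    using add by auto
  finally show ?case by (simp add: diff_divide_distrib del: Im_divide)
qed simp

text \<open>The remainder of a single summand is exactly \<open>c\<^sup>2 / ((z - x)\<^sup>2 (z + c - x))\<close>. An upward shift keeps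
\<open>\<bar>z + c - x\<bar> \<ge> Im z\<close>, so \<open>c\<close> may be large.\<close>

lemma norm_sum_inverse_shift_le:
  assumes "set_mset R \<subseteq> \<real>" "Im z > 0" "Im c \<ge> 0"
  shows "norm ((\<Sum>x\<in>#R. 1 / (z + c - x)) - (\<Sum>x\<in>#R. 1 / (z - x)) + c * (\<Sum>x\<in>#R. 1 / (z - x)^2))
      \<le> (norm c)\<^sup>2 * (- Im (\<Sum>x\<in>#R. 1 / (z - x))) / (Im z)\<^sup>2"
  using assms
proof (induction R)
  case (add x R)
  let ?t = "1 / (z + c - x) - 1 / (z - x) + c * (1 / (z - x)^2)"
  have x: "x \<in> \<real>" using add.prems by auto
  have n1: "norm (z - x) > 0" using Im_le_norm_diff_real[OF x, of z] assms by linarith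
  have n2: "norm (z + c - x) \<ge> Im z" using Im_le_norm_diff_real[OF x, of "z + c"] assms by simp
  have "z - x \<noteq> 0" "z + c - x \<noteq> 0" using n1 n2 assms by auto
  then have "?t = c^2 / ((z - x)^2 * (z + c - x))"
    by (simp add: divide_simps) (simp add: algebra_simps power2_eq_square)
  then have "norm ?t = (norm c)\<^sup>2 / ((norm (z - x))\<^sup>2 * norm (z + c - x))"
    by (simp add: norm_divide norm_mult norm_power)
  also have "\<dots> \<le> (norm c)\<^sup>2 / ((norm (z - x))\<^sup>2 * Im z)"
    using n1 n2 assms by (intro divide_left_mono mult_left_mono mult_pos_pos) auto
  also have "\<dots> = (norm c)\<^sup>2 * (- Im (1 / (z - x))) / (Im z)\<^sup>2"
    using x assms n1 by (simp add: Im_inverse_diff_real power2_eq_square divide_simps)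
  finally have t: "norm ?t \<le> (norm c)\<^sup>2 * (- Im (1 / (z - x))) / (Im z)\<^sup>2" .
  let ?T = "(\<Sum>x\<in>#R. 1 / (z + c - x)) - (\<Sum>x\<in>#R. 1 / (z - x)) + c * (\<Sum>x\<in>#R. 1 / (z - x)^2)"
  have "norm (?t + ?T) \<le> norm ?t + norm ?T" by (rule norm_triangle_ineq)
  also have "\<dots> \<le> (norm c)\<^sup>2 * (- Im (1 / (z - x))) / (Im z)\<^sup>2 + (norm c)\<^sup>2 * (- Im (\<Sum>x\<in>#R. 1 / (z - x))) / (Im z)\<^sup>2"
    using t add by (intro add_mono) auto
  also have "?t + ?T = (\<Sum>x\<in>#add_mset x R. 1 / (z + c - x)) - (\<Sum>x\<in>#add_mset x R. 1 / (z - x)) + c * (\<Sum>x\<in>#add_mset x R. 1 / (z - x)^2)"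
    by (simp add: algebra_simps)
  also have "(norm c)\<^sup>2 * (- Im (1 / (z - x))) / (Im z)\<^sup>2 + (norm c)\<^sup>2 * (- Im (\<Sum>x\<in>#R. 1 / (z - x))) / (Im z)\<^sup>2
     = (norm c)\<^sup>2 * (- Im (\<Sum>x\<in>#add_mset x R. 1 / (z - x))) / (Im z)\<^sup>2"
    by (simp add: diff_divide_distrib algebra_simps del: Im_divide)
  finally show ?case .
qed simp

definition real_rooted :: "complex poly \<Rightarrow> bool" where
  "real_rooted q \<longleftrightarrow> q \<noteq> 0 \<and> (\<forall>x. poly q x = 0 \<longrightarrow> x \<in> \<real>)"

definition log_deriv :: "complex poly \<Rightarrow> complex \<Rightarrow> complex" where
  "log_deriv q z = poly (pderiv q) z / poly q z"

lemma poly_pderiv_prod_linear: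
  fixes z :: complex
  assumes "z \<notin># R"
  shows "poly (pderiv (\<Prod>x\<in>#R. [:-x, 1:])) z = poly (\<Prod>x\<in>#R. [:-x, 1:]) z * (\<Sum>x\<in>#R. 1 / (z - x))"
  using assms
proof (induction R)
  case (add x R)
  let ?P = "\<Prod>x\<in>#R. [:-x, 1:]"
  have x: "z - x \<noteq> 0" using add.prems by auto
  have "poly (pderiv ([:-x, 1:] * ?P)) z = poly ?P z + (z - x) * poly (pderiv ?P) z"
    by (simp only: pderiv_mult poly_add poly_mult) (simp add: pderiv_pCons)
  also have "\<dots> = poly ?P z + (z - x) * (poly ?P z * (\<Sum>x\<in>#R. 1 / (z - x)))"
    using add by simp
  also have "\<dots> = (z - x) * poly ?P z * (1 / (z - x) + (\<Sum>x\<in>#R. 1 / (z - x)))"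
    using x by (simp add: field_simps)
  also have "(z - x) * poly ?P z = poly ([:-x, 1:] * ?P) z" by (simp only: poly_mult) simp
  finally show ?case by (simp only: image_mset_add_mset prod_mset.add_mset sum_mset.add_mset)
qed simp

lemma log_deriv_eq_sum:
  assumes "poly q z \<noteq> 0"
  shows "log_deriv q z = (\<Sum>x\<in>#proots q. 1 / (z - x))"
proof -
  let ?P = "\<Prod>x\<in>#proots q. [:-x, 1:]"
  have q: "q = smult (lead_coeff q) ?P" by (rule complex_poly_decompose_multiset[symmetric])
  have "q \<noteq> 0" using assms by auto
  then have z: "z \<notin># proots q" using assms by simp
  have "poly (pderiv q) z = lead_coeff q * poly (pderiv ?P) z"
    by (subst q) (simp add: pderiv_smult)
  also have "\<dots> = lead_coeff q * poly ?P z * (\<Sum>x\<in>#proots q. 1 / (z - x))"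
    by (simp add: poly_pderiv_prod_linear[OF z])
  also have "lead_coeff q * poly ?P z = poly q z"
    by (subst (3) q) simp
  finally show ?thesis using assms by (simp add: log_deriv_def)
qed

lemma real_rooted_proots: "real_rooted q \<Longrightarrow> set_mset (proots q) \<subseteq> \<real>"
  by (auto simp: real_rooted_def)

lemma real_rooted_nonzero: "real_rooted q \<Longrightarrow> Im z \<noteq> 0 \<Longrightarrow> poly q z \<noteq> 0"
  by (auto simp: real_rooted_def complex_is_Real_iff)

lemma Im_log_deriv_neg:
  assumes "real_rooted q" "degree q > 0" "Im z \<noteq> 0"
  shows "Im z * Im (log_deriv q z) < 0"
proof -
  have "proots q \<noteq> {#}" using assms(2) size_proots_complex[of q] by auto
  with assms show ?thesis
    by (simp add: log_deriv_eq_sum real_rooted_nonzero Im_mult_Im_sum_inverse_neg real_rooted_proots del: Im_divide)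
qed

lemma real_rooted_pderiv:
  assumes "real_rooted q" "degree q > 0"
  shows "real_rooted (pderiv q)"
  unfolding real_rooted_def
proof (intro conjI allI impI)
  show "pderiv q \<noteq> 0" using assms(2) by (simp add: pderiv_eq_0_iff)
  fix x assume x: "poly (pderiv q) x = 0"
  show "x \<in> \<real>"
  proof (rule ccontr)
    assume "x \<notin> \<real>"
    then have "Im x \<noteq> 0" by (simp add: complex_is_Real_iff)
    from Im_log_deriv_neg[OF assms this] x show False by (simp add: log_deriv_def)
  qed
qed

lemma DERIV_sum_inverse:
  fixes z :: complex
  assumes "z \<notin># R"
  shows "((\<lambda>w. \<Sum>x\<in>#R. 1 / (w - x)) has_field_derivative - (\<Sum>x\<in>#R. 1 / (z - x)^2)) (at z)"
  using assms
proof (induction R)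
  case (add x R)
  then have "z - x \<noteq> 0" by auto
  then have "((\<lambda>w. 1 / (w - x)) has_field_derivative - (1 / (z - x)^2)) (at z)"
    by (auto intro!: derivative_eq_intros simp: power2_eq_square)
  from DERIV_add[OF this add.IH] add.prems show ?case by simp
qed simp

text \<open>The derivative of \<open>u = q' / q\<close> is \<open>- \<Sum> 1 / (z - x)\<^sup>2\<close>, and \<open>q' = u q\<close> gives
\<open>q'' / q' = u + u' / u\<close>.\<close>

lemma log_deriv_pderiv:
  assumes "real_rooted q" "degree q > 0" "Im z > 0"
  shows "log_deriv (pderiv q) z = log_deriv q z - (\<Sum>x\<in>#proots q. 1 / (z - x)^2) / log_deriv q z"
proof -
  let ?S = "\<Sum>x\<in>#proots q. 1 / (z - x)^2"
  have q0: "poly q z \<noteq> 0" using assms real_rooted_nonzero by simp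
  have q1: "poly (pderiv q) z \<noteq> 0" using assms real_rooted_nonzero real_rooted_pderiv by simp
  have "(log_deriv q has_field_derivative
      (poly (pderiv (pderiv q)) z * poly q z - poly (pderiv q) z * poly (pderiv q) z) / (poly q z * poly q z)) (at z)"
    unfolding log_deriv_def[abs_def] using q0 by (intro derivative_intros poly_DERIV)
  moreover have "(log_deriv q has_field_derivative - ?S) (at z)"
  proof (rule has_field_derivative_transform_within_open[OF DERIV_sum_inverse])
    show "open {w. Im w > 0}" by (rule open_halfspace_Im_gt)
    show "z \<notin># proots q" using q0 assms by (auto simp: real_rooted_def)
  qed (use assms in \<open>simp_all add: log_deriv_eq_sum real_rooted_nonzero\<close>)
  ultimately have "(poly (pderiv (pderiv q)) z * poly q z - poly (pderiv q) z * poly (pderiv q) z) / (poly q z * poly q z) = - ?S"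
    by (rule DERIV_unique)
  then have "poly (pderiv (pderiv q)) z * poly q z = poly (pderiv q) z * poly (pderiv q) z - ?S * (poly q z * poly q z)"
    using q0 by (simp add: divide_eq_eq algebra_simps)
  then show ?thesis
    using q0 q1 by (simp add: log_deriv_def field_simps)
qed

text \<open>One step of the Euler scheme: the value of the logarithmic derivative of \<open>q'\<close> at \<open>z\<close> is, up to a small
error, the value of that of \<open>q\<close> at the higher point \<open>z + 1 / u(z)\<close>.\<close>

lemma log_deriv_pderiv_near:
  assumes "real_rooted q" "degree q > 0" "Im z > 0"
  shows "norm (log_deriv (pderiv q) z - log_deriv q z) \<le> 1 / Im z"
    and "norm (log_deriv q (z + 1 / log_deriv q z) - log_deriv (pderiv q) z)
           \<le> 1 / ((Im z)\<^sup>2 * norm (log_deriv q z))"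
    and "Im (z + 1 / log_deriv q z) \<ge> Im z"
proof -
  let ?u = "log_deriv q z" and ?R = "proots q"
  let ?S = "\<Sum>x\<in>#?R. 1 / (z - x)^2"
  have R: "set_mset ?R \<subseteq> \<real>" using assms real_rooted_proots by simp
  have u: "?u = (\<Sum>x\<in>#?R. 1 / (z - x))"
    using assms by (simp add: log_deriv_eq_sum real_rooted_nonzero)
  have neg: "Im ?u < 0" using Im_log_deriv_neg[of q z] assms by (simp add: mult_less_0_iff)
  then have u0: "norm ?u > 0" by auto
  have le: "- Im ?u \<le> norm ?u" using abs_Im_le_cmod[of ?u] by linarith
  have "norm ?S \<le> - Im ?u / Im z"
    using norm_sum_inverse_square_le[OF R] assms u by simp
  also have "\<dots> \<le> norm ?u / Im z" using le assms by (intro divide_right_mono) auto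
  finally have S: "norm ?S \<le> norm ?u / Im z" .
  show "norm (log_deriv (pderiv q) z - ?u) \<le> 1 / Im z"
    using S u0 assms by (simp add: log_deriv_pderiv norm_divide field_simps)
  have ic: "Im (1 / ?u) \<ge> 0" using neg by (simp add: Im_divide divide_nonpos_nonneg)
  then show "Im (z + 1 / ?u) \<ge> Im z" by simp
  then have "log_deriv q (z + 1 / ?u) = (\<Sum>x\<in>#?R. 1 / (z + 1 / ?u - x))"
    using assms by (intro log_deriv_eq_sum real_rooted_nonzero) auto
  then have "log_deriv q (z + 1 / ?u) - log_deriv (pderiv q) z =
      (\<Sum>x\<in>#?R. 1 / (z + 1 / ?u - x)) - (\<Sum>x\<in>#?R. 1 / (z - x)) + 1 / ?u * ?S"
    using assms u by (simp add: log_deriv_pderiv)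
  also have "norm \<dots> \<le> (norm (1 / ?u))\<^sup>2 * (- Im ?u) / (Im z)\<^sup>2"
    using norm_sum_inverse_shift_le[OF R, of z "1 / ?u"] ic assms u by simp
  also have "\<dots> \<le> (norm (1 / ?u))\<^sup>2 * norm ?u / (Im z)\<^sup>2"
    using le assms by (intro divide_right_mono mult_left_mono) auto
  also have "\<dots> = 1 / ((Im z)\<^sup>2 * norm ?u)"
    using u0 by (simp add: norm_divide power2_eq_square)
  finally show "norm (log_deriv q (z + 1 / ?u) - log_deriv (pderiv q) z) \<le> 1 / ((Im z)\<^sup>2 * norm ?u)" .
qed

lemma higher_pderiv_Suc: "(pderiv ^^ Suc k) q = (pderiv ^^ k) (pderiv q)"
  by (simp only: funpow_Suc_right o_apply)

lemma real_rooted_higher_pderiv: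
  "real_rooted q \<Longrightarrow> degree q > K \<Longrightarrow> real_rooted ((pderiv ^^ K) q)"
proof (induction K arbitrary: q)
  case (Suc K)
  then have "real_rooted (pderiv q)" "degree (pderiv q) > K"
    by (auto intro: real_rooted_pderiv simp: degree_pderiv)
  then show ?case using Suc.IH by (simp only: higher_pderiv_Suc)
qed simp

text \<open>The steps of the previous lemma are composed from the last derivative upwards. Here \<open>e\<close> is the error of one
step and \<open>C\<close> bounds the deviation of the logarithmic derivatives from the final value \<open>v\<close> along the path,
so \<open>C \<le> b\<close> keeps all of them above \<open>b\<close> in modulus, which in turn justifies the value of \<open>e\<close>.
When \<open>b\<close> is proportional to \<open>N\<close>, both \<open>N e\<close> and \<open>C\<close> stay bounded and the error in the position is
\<open>O(1 / N)\<close>.\<close>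

lemma backward_characteristic:
  fixes z v :: complex
  assumes "real_rooted q" "degree q > K" "K \<le> N" "Im z > 0" "b > 0"
    and v: "v = log_deriv ((pderiv ^^ K) q) z" "norm v \<ge> 2 * b"
    and e: "e = 1 / ((Im z)\<^sup>2 * b)"
    and C: "C = real N * e + 1 / Im z" "C \<le> b"
  shows "\<exists>w. Im w \<ge> Im z \<and> norm (log_deriv q w - v) \<le> real K * e \<and>
           norm (w - (z + of_nat K / v)) \<le> real K * (C / (2 * b\<^sup>2))"
  using assms(1-3) v
proof (induction K arbitrary: q)
  case 0
  then show ?case by (intro exI[of _ z]) auto
next
  case (Suc K)
  have d: "degree q > 0" and q': "real_rooted (pderiv q)" "degree (pderiv q) > K"
    using Suc.prems by (auto intro: real_rooted_pderiv simp: degree_pderiv)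
  then obtain w where w: "Im w \<ge> Im z" "norm (log_deriv (pderiv q) w - v) \<le> real K * e"
      "norm (w - (z + of_nat K / v)) \<le> real K * (C / (2 * b\<^sup>2))"
    using Suc.IH[of "pderiv q"] Suc.prems by (auto simp only: higher_pderiv_Suc Suc_leD)
  let ?u = "log_deriv q w"
  have Imw: "Im w > 0" using w assms by linarith
  note near = log_deriv_pderiv_near[OF Suc.prems(1) d Imw]
  have e0: "e \<ge> 0" using e assms by simp
  have "norm (?u - v) \<le> norm (log_deriv (pderiv q) w - ?u) + norm (log_deriv (pderiv q) w - v)"
    using norm_triangle_ineq4[of "log_deriv (pderiv q) w - v" "log_deriv (pderiv q) w - ?u"]
    by (simp add: add.commute)
  also have "\<dots> \<le> 1 / Im w + real K * e" using near(1) w by linarith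
  also have "\<dots> \<le> 1 / Im z + real N * e"
    using w assms e0 Suc.prems by (intro add_mono mult_right_mono divide_left_mono mult_pos_pos) auto
  finally have uv: "norm (?u - v) \<le> C" using C by simp
  have ub: "norm ?u \<ge> b"
    using uv C Suc.prems norm_triangle_ineq3[of ?u v] by linarith
  have v0: "norm v > 0" and u0: "norm ?u > 0" using Suc.prems ub assms by auto
  let ?w = "w + 1 / ?u"
  have "norm (log_deriv q ?w - log_deriv (pderiv q) w) \<le> 1 / ((Im w)\<^sup>2 * norm ?u)" by (rule near)
  also have "\<dots> \<le> e"
    unfolding e using ub w assms u0 Imw
    by (intro divide_left_mono mult_mono power_mono mult_pos_pos) auto
  finally have n1: "norm (log_deriv q ?w - log_deriv (pderiv q) w) \<le> e" .
  have "norm (log_deriv q ?w - v) \<le> norm (log_deriv q ?w - log_deriv (pderiv q) w) + norm (log_deriv (pderiv q) w - v)"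
    using norm_triangle_ineq[of "log_deriv q ?w - log_deriv (pderiv q) w" "log_deriv (pderiv q) w - v"] by simp
  then have 1: "norm (log_deriv q ?w - v) \<le> real (Suc K) * e"
    using n1 w by (simp add: distrib_right)
  have "norm (1 / ?u - 1 / v) = norm (?u - v) / (norm ?u * norm v)"
    using u0 v0 by (simp add: norm_divide[symmetric] norm_mult[symmetric] field_simps norm_minus_commute)
  also have "\<dots> \<le> C / (b * (2 * b))"
    using uv ub Suc.prems assms norm_ge_zero[of "?u - v"] by (intro frac_le mult_mono mult_pos_pos) auto
  finally have n2: "norm (1 / ?u - 1 / v) \<le> C / (2 * b\<^sup>2)" by (simp add: power2_eq_square mult_ac)
  have "?w - (z + of_nat (Suc K) / v) = (w - (z + of_nat K / v)) + (1 / ?u - 1 / v)"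
    by (simp add: add_divide_distrib)
  also have "norm \<dots> \<le> norm (w - (z + of_nat K / v)) + norm (1 / ?u - 1 / v)"
    by (rule norm_triangle_ineq)
  also have "\<dots> \<le> real (Suc K) * (C / (2 * b\<^sup>2))"
    using n2 w(3) unfolding of_nat_Suc distrib_right by linarith
  finally have 2: "norm (?w - (z + of_nat (Suc K) / v)) \<le> real (Suc K) * (C / (2 * b\<^sup>2))" .
  have "Im ?w \<ge> Im z" using near(3) w(1) by (rule order_trans[rotated])
  with 1 2 show ?case by (intro exI[of _ ?w] conjI)
qed

text \<open>This is Rolle's theorem in integrated form: \<open>- Im z Im u(z)\<close> counts the roots with the weight
\<open>(Im z)\<^sup>2 / \<bar>z - x\<bar>\<^sup>2\<close>, and a differentiation loses at most one from this count. It
prevents too many roots from escaping to infinity.\<close>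

lemma Im_log_deriv_higher_pderiv_le:
  assumes "real_rooted q" "degree q > K" "Im z > 0"
  shows "Im (log_deriv ((pderiv ^^ K) q) z) \<le> Im (log_deriv q z) + real K / Im z"
  using assms
proof (induction K arbitrary: q)
  case (Suc K)
  have d: "degree q > 0" and q': "real_rooted (pderiv q)" "degree (pderiv q) > K"
    using Suc.prems by (auto intro: real_rooted_pderiv simp: degree_pderiv)
  have "Im (log_deriv ((pderiv ^^ K) (pderiv q)) z) \<le> Im (log_deriv (pderiv q) z) + real K / Im z"
    using Suc.IH[OF q'] Suc.prems by simp
  moreover have "Im (log_deriv (pderiv q) z) - Im (log_deriv q z) \<le> 1 / Im z"
    using log_deriv_pderiv_near(1)[OF Suc.prems(1) d] Suc.prems(3)
      abs_Im_le_cmod[of "log_deriv (pderiv q) z - log_deriv q z"] by fastforce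
  ultimately show ?case by (simp only: higher_pderiv_Suc) (simp add: add_divide_distrib)
qed simp


section \<open>Cauchy transforms of measures on the extended real line\<close>

lemma measurable_Some_sphere [measurable]: "Some \<in> borel \<rightarrow>\<^sub>M sphere_borel"
  unfolding sphere_borel_def
proof (rule measurable_measure_of)
  fix U assume "U \<in> {U. openin riemann_sphere U}"
  then have "openin euclidean {x \<in> topspace euclidean. Some x \<in> U}"
    using openin_continuous_map_preimage[OF continuous_map_Some[of "euclidean :: complex topology"], of U]
    by (simp add: riemann_sphere_def)
  then show "Some -` U \<inter> space borel \<in> sets borel" by (simp add: vimage_def)
qed auto

lemma Some_image_sphere_borel: "B \<in> sets borel \<Longrightarrow> Some ` B \<in> sets sphere_borel"
proof -
  assume B: "B \<in> sets borel"
  define g :: "complex option \<Rightarrow> complex" where "g = case_option 0 id"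
  have "g \<in> borel_measurable sphere_borel"
  proof (rule borel_measurableI)
    fix S :: "complex set" assume "open S"
    then have "Some ` S \<in> sets sphere_borel"
      by (intro sphere_borel_openI) (simp add: riemann_sphere_def)
    moreover have "g -` S \<inter> space sphere_borel = Some ` S \<union> (if 0 \<in> S then {None} else {})"
      by (auto simp: g_def image_iff split: option.splits)
    ultimately show "g -` S \<inter> space sphere_borel \<in> sets sphere_borel"
      using infinity_sphere_borel by (simp del: Un_insert_right)
  qed
  then have "g -` B \<inter> space sphere_borel \<in> sets sphere_borel" using B by (rule measurable_sets)
  then have "(g -` B \<inter> space sphere_borel) \<inter> range Some \<in> sets sphere_borel"
    using finite_points_sphere_borel by (rule sets.Int)
  moreover have "(g -` B \<inter> space sphere_borel) \<inter> range Some = Some ` B"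
    by (auto simp: g_def)
  ultimately show ?thesis by simp
qed

text \<open>The Borel sets of the sphere restrict to the Borel sets of the plane, and the point at infinity is measurable,
so only the finite points matter for measurability.\<close>

lemma measurable_from_sphere:
  assumes f: "(\<lambda>x. f (Some x)) \<in> borel \<rightarrow>\<^sub>M N" and "f None \<in> space N"
  shows "f \<in> sphere_borel \<rightarrow>\<^sub>M N"
proof (rule measurableI)
  fix x show "f x \<in> space N"
    using assms(2) measurable_space[OF f] by (cases x) auto
next
  fix A assume "A \<in> sets N"
  then have "(\<lambda>x. f (Some x)) -` A \<inter> space borel \<in> sets borel" using f by (rule measurable_sets[rotated])
  then have "Some ` ((\<lambda>x. f (Some x)) -` A) \<in> sets sphere_borel" by (simp add: Some_image_sphere_borel)
  moreover have "f -` A \<inter> space sphere_borel = Some ` ((\<lambda>x. f (Some x)) -` A) \<union> (if f None \<in> A then {None} else {})"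
  proof (rule set_eqI)
    fix x show "x \<in> f -` A \<inter> space sphere_borel \<longleftrightarrow>
        x \<in> Some ` ((\<lambda>x. f (Some x)) -` A) \<union> (if f None \<in> A then {None} else {})"
      by (cases x) auto
  qed
  ultimately show "f -` A \<inter> space sphere_borel \<in> sets sphere_borel"
    using infinity_sphere_borel by (simp del: Un_insert_right)
qed

definition cauchy_kernel :: "complex \<Rightarrow> complex option \<Rightarrow> complex" where
  "cauchy_kernel z x = (case x of None \<Rightarrow> 0 | Some y \<Rightarrow> 1 / (z - y))"

lemma cauchy_kernel_simps [simp]:
  "cauchy_kernel z None = 0" "cauchy_kernel z (Some y) = 1 / (z - y)"
  by (simp_all add: cauchy_kernel_def)

lemma cauchy_transform_eq: "cauchy_transform \<mu> z = (LINT x|\<mu>. cauchy_kernel z x)"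
  by (simp add: cauchy_transform_def cauchy_kernel_def)

lemma cauchy_kernel_measurable [measurable]: "cauchy_kernel z \<in> borel_measurable sphere_borel"
  by (rule measurable_from_sphere) auto

lemma ext_real_cases:
  assumes "x \<in> extended_real_line"
  obtains "x = None" | r :: real where "x = Some (of_real r)"
  using assms by (auto simp: extended_real_line_def elim: Reals_cases)

lemma cauchy_kernel_diff:
  assumes "x \<in> extended_real_line" "Im z1 > 0" "Im z2 > 0"
  shows "cauchy_kernel z1 x - cauchy_kernel z2 x = (z2 - z1) * (cauchy_kernel z1 x * cauchy_kernel z2 x)"
  using assms(1)
proof (cases rule: ext_real_cases)
  case (2 r)
  then have "z1 - of_real r \<noteq> 0" "z2 - of_real r \<noteq> 0" using assms by (auto simp: complex_eq_iff)
  then show ?thesis using 2 by (simp add: field_simps)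
qed simp

lemma Im_cauchy_kernel:
  assumes "x \<in> extended_real_line"
  shows "Im (cauchy_kernel z x) = - Im z * (norm (cauchy_kernel z x))\<^sup>2"
  using assms
proof (cases rule: ext_real_cases)
  case (2 r)
  have "Im (1 / (z - of_real r)) = - Im z / (norm (z - of_real r))\<^sup>2"
    by (simp add: Im_divide cmod_power2)
  then show ?thesis using 2 by (simp add: norm_divide power_divide del: Im_divide)
qed simp

lemma norm_mult_cauchy_kernel_le:
  assumes "x \<in> extended_real_line" "Im z > 0"
  shows "norm (w * cauchy_kernel z x) \<le> norm w / Im z"
  using assms(1)
proof (cases rule: ext_real_cases)
  case (2 r)
  have "Im z \<le> norm (z - of_real r)" using abs_Im_le_cmod[of "z - of_real r"] by simp
  then show ?thesis using 2 assms by (auto simp: norm_divide norm_mult intro!: divide_left_mono mult_pos_pos)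
qed (use assms in simp)

lemma norm_cauchy_kernel_le:
  assumes "x \<in> extended_real_line" "Im z > 0"
  shows "norm (cauchy_kernel z x) \<le> 1 / Im z"
  using norm_mult_cauchy_kernel_le[OF assms, of 1] by simp

lemma cauchy_kernel_nonzero: "y \<in> \<real> \<Longrightarrow> Im z > 0 \<Longrightarrow> cauchy_kernel z (Some y) \<noteq> 0"
  by (auto simp: complex_is_Real_iff)

lemma compl_sphere_borel: "A \<in> sets sphere_borel \<Longrightarrow> - A \<in> sets sphere_borel"
  using sets.compl_sets[of A sphere_borel] by (simp add: Compl_eq_Diff_UNIV)

lemmas compl_extended_real_line = compl_sphere_borel[OF extended_real_line_sphere_borel]

lemma Im_of_real_divide: "Im (of_real c / g) = c * (- Im g) / (norm g)\<^sup>2"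
  by (simp only: Im_divide cmod_power2) simp

lemma Im_of_real_divide_nonneg: "c \<ge> 0 \<Longrightarrow> Im g \<le> 0 \<Longrightarrow> Im (of_real c / g) \<ge> 0"
  unfolding Im_of_real_divide by (intro divide_nonneg_nonneg mult_nonneg_nonneg) auto

text \<open>Probability measures carried by the extended real line, possibly with an atom at infinity. The Cauchy kernel
vanishes there, so such an atom is visible only in the missing mass.\<close>

locale ext_prob = prob_space M for M :: "complex option measure" +
  assumes sets_M [simp, measurable_cong]: "sets M = sets sphere_borel"
    and ext_M: "emeasure M (- extended_real_line) = 0"
begin

lemma space_M [simp]: "space M = UNIV"
  using sets_eq_imp_space_eq[OF sets_M] by simp

lemma prob_UNIV [simp]: "prob UNIV = 1"
  using prob_space by simp

lemma AE_ext: "AE x in M. x \<in> extended_real_line"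
  using ext_M compl_extended_real_line by (intro AE_I[of _ _ "- extended_real_line"]) auto

lemma integrable_ext_bounded:
  fixes f :: "complex option \<Rightarrow> 'b :: {banach, second_countable_topology}"
  assumes "f \<in> borel_measurable sphere_borel" "\<And>x. x \<in> extended_real_line \<Longrightarrow> norm (f x) \<le> B"
  shows "integrable M f"
proof (rule integrable_const_bound)
  show "AE x in M. norm (f x) \<le> B" using AE_ext by eventually_elim (use assms in auto)
  show "f \<in> borel_measurable M" using assms(1) by simp
qed

lemma integral_cong_ext:
  fixes f g :: "complex option \<Rightarrow> 'b :: {banach, second_countable_topology}"
  assumes "f \<in> borel_measurable sphere_borel" "g \<in> borel_measurable sphere_borel"
    "\<And>x. x \<in> extended_real_line \<Longrightarrow> f x = g x"
  shows "integral\<^sup>L M f = integral\<^sup>L M g"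
proof (rule integral_cong_AE)
  show "AE x in M. f x = g x" using AE_ext by eventually_elim (use assms in auto)
qed (use assms in auto)

lemma integrable_kernel: "Im z > 0 \<Longrightarrow> integrable M (cauchy_kernel z)"
  by (rule integrable_ext_bounded[OF _ norm_cauchy_kernel_le]) auto

lemma integrable_kernel_mult:
  assumes "Im z1 > 0" "Im z2 > 0"
  shows "integrable M (\<lambda>x. cauchy_kernel z1 x * cauchy_kernel z2 x)"
proof (rule integrable_ext_bounded)
  fix x assume "x \<in> extended_real_line"
  then show "norm (cauchy_kernel z1 x * cauchy_kernel z2 x) \<le> 1 / Im z1 * (1 / Im z2)"
    unfolding norm_mult using assms by (intro mult_mono norm_cauchy_kernel_le) auto
qed auto

lemma integrable_kernel_square:
  assumes "Im z > 0"
  shows "integrable M (\<lambda>x. (norm (cauchy_kernel z x))\<^sup>2)"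
  using integrable_norm[OF integrable_kernel_mult[OF assms assms]] by (simp add: norm_mult power2_eq_square)

lemma Im_cauchy_transform:
  assumes "Im z > 0"
  shows "Im (cauchy_transform M z) = - Im z * (LINT x|M. (norm (cauchy_kernel z x))\<^sup>2)"
proof -
  have "Im (cauchy_transform M z) = (LINT x|M. Im (cauchy_kernel z x))"
    unfolding cauchy_transform_eq using integrable_kernel[OF assms] by simp
  also have "\<dots> = (LINT x|M. - Im z * (norm (cauchy_kernel z x))\<^sup>2)"
    by (rule integral_cong_ext) (auto simp: Im_cauchy_kernel)
  finally show ?thesis by simp
qed

lemma cauchy_transform_diff:
  assumes "Im z1 > 0" "Im z2 > 0"
  shows "cauchy_transform M z1 - cauchy_transform M z2 =
    (z2 - z1) * (LINT x|M. cauchy_kernel z1 x * cauchy_kernel z2 x)"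
proof -
  have "cauchy_transform M z1 - cauchy_transform M z2 = (LINT x|M. cauchy_kernel z1 x - cauchy_kernel z2 x)"
    unfolding cauchy_transform_eq by (intro Bochner_Integration.integral_diff[symmetric] integrable_kernel assms)
  also have "\<dots> = (LINT x|M. (z2 - z1) * (cauchy_kernel z1 x * cauchy_kernel z2 x))"
    by (rule integral_cong_ext) (use assms in \<open>auto simp: cauchy_kernel_diff\<close>)
  finally show ?thesis by simp
qed

lemma cauchy_transform_lipschitz:
  assumes "Im z1 > 0" "Im z2 > 0"
  shows "norm (cauchy_transform M z1 - cauchy_transform M z2) \<le> norm (z1 - z2) / (Im z1 * Im z2)"
proof -
  have "norm (LINT x|M. cauchy_kernel z1 x * cauchy_kernel z2 x) \<le> (LINT x|M. norm (cauchy_kernel z1 x * cauchy_kernel z2 x))"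
    by (rule integral_norm_bound)
  also have "\<dots> \<le> (LINT x|M. 1 / Im z1 * (1 / Im z2))"
  proof (rule integral_mono_AE)
    show "AE x in M. norm (cauchy_kernel z1 x * cauchy_kernel z2 x) \<le> 1 / Im z1 * (1 / Im z2)"
      using AE_ext
    proof eventually_elim
      case (elim x)
      then show ?case unfolding norm_mult using assms by (intro mult_mono norm_cauchy_kernel_le) auto
    qed
  qed (use assms integrable_kernel_mult in auto)
  also have "\<dots> = 1 / (Im z1 * Im z2)" by (simp add: prob_space)
  finally have "norm (z2 - z1) * norm (LINT x|M. cauchy_kernel z1 x * cauchy_kernel z2 x)
      \<le> norm (z2 - z1) * (1 / (Im z1 * Im z2))"
    by (intro mult_left_mono) auto
  then show ?thesis using assms by (simp add: cauchy_transform_diff norm_mult norm_minus_commute)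
qed

lemma continuous_cauchy_transform: "continuous_on {z. Im z > 0} (cauchy_transform M)"
proof (rule continuous_at_imp_continuous_on, safe)
  fix z assume z: "Im z > 0"
  have "open {z. Im z > 0}" by (rule open_halfspace_Im_gt)
  then have "\<forall>\<^sub>F x in at z. x \<in> {z. Im z > 0}" using z by (intro eventually_at_in_open') auto
  then have "\<forall>\<^sub>F x in at z. norm (cauchy_transform M x - cauchy_transform M z) \<le> norm (x - z) / (Im x * Im z)"
    by eventually_elim (use z cauchy_transform_lipschitz in auto)
  moreover have "((\<lambda>x. norm (x - z) / (Im x * Im z)) \<longlongrightarrow> norm (z - z) / (Im z * Im z)) (at z)"
    using z by (intro tendsto_intros) auto
  then have "((\<lambda>x. norm (x - z) / (Im x * Im z)) \<longlongrightarrow> 0) (at z)" by simp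
  ultimately have "((\<lambda>x. cauchy_transform M x - cauchy_transform M z) \<longlongrightarrow> 0) (at z)"
    by (rule Lim_null_comparison)
  then show "isCont (cauchy_transform M) z" by (simp add: isCont_def LIM_zero_iff)
qed

lemma prob_finite: "measure M (range Some) = 1 - measure M {None}"
proof -
  have "range Some = space M - {None}" by (auto simp: notin_range_Some)
  then show ?thesis using prob_compl[of "{None}"] infinity_sphere_borel by simp
qed

lemma Im_cauchy_transform_neg:
  assumes "Im z > 0" "measure M {None} < 1"
  shows "Im (cauchy_transform M z) < 0"
proof -
  have "(LINT x|M. (norm (cauchy_kernel z x))\<^sup>2) > 0"
  proof (rule ccontr)
    assume "\<not> ?thesis"
    moreover have "(LINT x|M. (norm (cauchy_kernel z x))\<^sup>2) \<ge> 0" by simp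
    ultimately have "(LINT x|M. (norm (cauchy_kernel z x))\<^sup>2) = 0" by linarith
    then have "AE x in M. (norm (cauchy_kernel z x))\<^sup>2 = 0"
      using integrable_kernel_square[OF assms(1)] by (subst (asm) integral_nonneg_eq_0_iff_AE) auto
    with AE_ext have "AE x in M. x \<in> {None}"
    proof eventually_elim
      case (elim x)
      then show ?case using cauchy_kernel_nonzero[OF _ assms(1)]
        by (auto elim!: ext_real_cases simp del: cauchy_kernel_simps)
    qed
    then have "prob {None} = 1" using infinity_sphere_borel by (intro prob_eq_1[THEN iffD2]) auto
    then show False using assms by simp
  qed
  then show ?thesis using assms by (simp add: Im_cauchy_transform)
qed

text \<open>In a cone \<open>\<bar>z\<bar> \<le> C Im z\<close> the functions \<open>z / (z - x)\<close> are bounded by \<open>C\<close> and tend to 1 for each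
finite \<open>x\<close>, so dominated convergence applies. The bilinear version controls difference quotients of the
Cauchy transform.\<close>

lemma cauchy_transform_mult_tendsto:
  fixes v w :: "nat \<Rightarrow> complex"
  assumes "filterlim (\<lambda>k. Im (v k)) at_top sequentially" "filterlim (\<lambda>k. Im (w k)) at_top sequentially"
    and "\<And>k. norm (v k) \<le> C * Im (v k)" "\<And>k. norm (w k) \<le> C * Im (w k)"
    and "\<And>k. Im (v k) > 0" "\<And>k. Im (w k) > 0"
  shows "(\<lambda>k. v k * cauchy_transform M (v k)) \<longlonglongrightarrow> of_real (1 - measure M {None})" (is ?A)
    and "(\<lambda>k. v k * w k * (LINT x|M. cauchy_kernel (v k) x * cauchy_kernel (w k) x))
            \<longlonglongrightarrow> of_real (1 - measure M {None})" (is ?B)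
proof -
  have "(LINT x|M. complex_of_real (indicator (range Some) x)) = of_real (LINT x|M. indicator (range Some) x)"
    using finite_points_sphere_borel by (intro integral_of_real integrable_real_indicator) (auto simp: emeasure_eq_measure)
  then have fin: "(LINT x|M. (indicator (range Some) x :: complex)) = of_real (1 - measure M {None})"
    using finite_points_sphere_borel prob_finite by (simp add: of_real_indicator)
  have pw: "(\<lambda>k. u k * cauchy_kernel (u k) x) \<longlonglongrightarrow> indicator (range Some) x"
    if u: "filterlim (\<lambda>k. Im (u k)) at_top sequentially" "\<And>k. Im (u k) > 0" and x: "x \<in> extended_real_line"
    for u :: "nat \<Rightarrow> complex" and x
    using x
  proof (cases rule: ext_real_cases)
    case (2 r)
    have "(\<lambda>k. of_real r * cauchy_kernel (u k) x) \<longlonglongrightarrow> 0"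
    proof (rule Lim_null_comparison)
      show "\<forall>\<^sub>F k in sequentially. norm (of_real r * cauchy_kernel (u k) x) \<le> norm (complex_of_real r) / Im (u k)"
        by (intro always_eventually allI norm_mult_cauchy_kernel_le x u(2))
      show "(\<lambda>k. norm (complex_of_real r) / Im (u k)) \<longlonglongrightarrow> 0"
        by (rule real_tendsto_divide_at_top[OF tendsto_const u(1)])
    qed
    then have "(\<lambda>k. 1 + of_real r * cauchy_kernel (u k) x) \<longlonglongrightarrow> 1 + 0" by (intro tendsto_add tendsto_const)
    moreover have "1 + of_real r * cauchy_kernel (u k) x = u k * cauchy_kernel (u k) x" for k
    proof -
      have "u k - of_real r \<noteq> 0" using u(2)[of k] by (auto simp: complex_eq_iff)
      then show ?thesis using 2 by (simp add: field_simps)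
    qed
    ultimately show ?thesis using 2 by simp
  qed simp
  have bd: "norm (u * cauchy_kernel u x) \<le> C" if "norm u \<le> C * Im u" "Im u > 0" "x \<in> extended_real_line" for u x
  proof -
    have "norm u / Im u \<le> C" using that by (simp add: divide_le_eq)
    with norm_mult_cauchy_kernel_le[OF that(3,2), of u] show ?thesis by linarith
  qed
  have C: "C \<ge> 0"
  proof -
    have "0 \<le> C * Im (v 0)" using assms(3)[of 0] norm_ge_zero[of "v 0"] by linarith
    then show ?thesis using assms(5)[of 0] by (simp add: zero_le_mult_iff)
  qed
  have "(\<lambda>k. LINT x|M. v k * cauchy_kernel (v k) x) \<longlonglongrightarrow> (LINT x|M. indicator (range Some) x)"
  proof (rule integral_dominated_convergence[where w = "\<lambda>_. C"])
    show "AE x in M. (\<lambda>k. v k * cauchy_kernel (v k) x) \<longlonglongrightarrow> indicator (range Some) x"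
      using AE_ext by eventually_elim (use pw assms in auto)
    show "AE x in M. norm (v k * cauchy_kernel (v k) x) \<le> C" for k
      using AE_ext by eventually_elim (use bd assms in auto)
  qed (use finite_points_sphere_borel in auto)
  then show ?A using fin unfolding cauchy_transform_eq by simp
  have "(\<lambda>k. LINT x|M. (v k * cauchy_kernel (v k) x) * (w k * cauchy_kernel (w k) x)) \<longlonglongrightarrow> (LINT x|M. indicator (range Some) x)"
  proof (rule integral_dominated_convergence[where w = "\<lambda>_. C * C"])
    show "AE x in M. (\<lambda>k. (v k * cauchy_kernel (v k) x) * (w k * cauchy_kernel (w k) x)) \<longlonglongrightarrow> indicator (range Some) x"
      using AE_ext
    proof eventually_elim
      case (elim x)
      have "(\<lambda>k. (v k * cauchy_kernel (v k) x) * (w k * cauchy_kernel (w k) x)) \<longlonglongrightarrow> indicator (range Some) x * indicator (range Some) x"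
        by (intro tendsto_mult pw elim assms)
      then show ?case by (simp flip: indicator_inter_arith)
    qed
    show "AE x in M. norm ((v k * cauchy_kernel (v k) x) * (w k * cauchy_kernel (w k) x)) \<le> C * C" for k
      using AE_ext
    proof eventually_elim
      case (elim x)
      then show ?case unfolding norm_mult[of "v k * _"] by (intro mult_mono bd assms C) auto
    qed
  qed (use finite_points_sphere_borel in auto)
  moreover have "(LINT x|M. (v k * cauchy_kernel (v k) x) * (w k * cauchy_kernel (w k) x)) =
     v k * w k * (LINT x|M. cauchy_kernel (v k) x * cauchy_kernel (w k) x)" for k
    by (subst integral_mult_right_zero[symmetric]) (simp add: mult_ac)
  ultimately show ?B using fin by simp
qed

text \<open>The map \<open>w \<mapsto> z + c / G(w)\<close> sends the upper half plane into the half plane of points at least as high as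
\<open>z\<close>; by Schwarz-Pick it contracts the hyperbolic metric strictly and has at most one fixed point. In elementary terms,
two fixed points would give \<open>c \<integral> k\<^sub>1 k\<^sub>2 = G(w\<^sub>1) G(w\<^sub>2)\<close> for the kernels
\<open>k\<^sub>i = 1 / (w\<^sub>i - x)\<close>, whereas \<open>c \<integral> \<bar>k\<^sub>i\<bar>\<^sup>2 < \<bar>G(w\<^sub>i)\<bar>\<^sup>2\<close>
because \<open>Im w\<^sub>i\<close> exceeds \<open>Im (c / G(w\<^sub>i))\<close>.\<close>

lemma subordination_point_unique:
  assumes w: "Im w1 > 0" "Im w2 > 0" and z: "Im z > 0" and c: "c \<ge> 0"
    and eq: "w1 = z + of_real c / cauchy_transform M w1" "w2 = z + of_real c / cauchy_transform M w2"
    and M: "measure M {None} < 1"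
  shows "w1 = w2"
proof (rule ccontr)
  assume ne: "w1 \<noteq> w2"
  let ?G = "cauchy_transform M"
  let ?I = "LINT x|M. cauchy_kernel w1 x * cauchy_kernel w2 x"
  define A where "A w = (LINT x|M. (norm (cauchy_kernel w x))\<^sup>2)" for w
  have neg: "Im (?G w1) < 0" "Im (?G w2) < 0" using Im_cauchy_transform_neg w M by auto
  then have G0: "?G w1 \<noteq> 0" "?G w2 \<noteq> 0" by auto
  have cA: "c * A w < (norm (?G w))\<^sup>2" if "Im w > 0" "w = z + of_real c / ?G w" "Im (?G w) < 0" for w
  proof -
    have "A w * Im w = - Im (?G w)" using Im_cauchy_transform[OF that(1)] by (simp add: A_def)
    have G: "norm (?G w) > 0" using that(3) by auto
    have "Im w = Im z + Im (of_real c / ?G w)" using that(2) by (metis plus_complex.simps(2))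
    also note Im_of_real_divide
    finally have "c * (A w * Im w) / (norm (?G w))\<^sup>2 < Im w"
      using z \<open>A w * Im w = _\<close> by simp
    then have "c * A w * Im w < (norm (?G w))\<^sup>2 * Im w"
      using G by (simp add: divide_less_eq mult_ac)
    then show ?thesis using that by simp
  qed
  have "w1 - w2 = of_real c * (1 / ?G w1 - 1 / ?G w2)"
  proof -
    have "w1 - z = of_real c / ?G w1" by (metis eq(1) add_diff_cancel_left')
    moreover have "w2 - z = of_real c / ?G w2" by (metis eq(2) add_diff_cancel_left')
    moreover have "w1 - w2 = (w1 - z) - (w2 - z)" by simp
    ultimately show ?thesis by (simp add: right_diff_distrib)
  qed
  also have "1 / ?G w1 - 1 / ?G w2 = - (?G w1 - ?G w2) / (?G w1 * ?G w2)"
    using G0 by (simp add: field_simps)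
  also have "?G w1 - ?G w2 = (w2 - w1) * ?I" by (rule cauchy_transform_diff[OF w])
  finally have "w1 - w2 = (w1 - w2) * (of_real c * ?I / (?G w1 * ?G w2))"
    by (simp add: algebra_simps divide_simps)
  then have "(w1 - w2) * (of_real c * ?I / (?G w1 * ?G w2) - 1) = 0" by (simp add: algebra_simps)
  then have "of_real c * ?I / (?G w1 * ?G w2) = 1" using ne by (simp del: divide_eq_1_iff)
  then have I: "of_real c * ?I = ?G w1 * ?G w2" using G0 by (simp add: field_simps)
  \<comment> \<open>The weight in the arithmetic-geometric mean inequality is chosen such that \<open>l \<bar>G(w\<^sub>1)\<bar>\<^sup>2\<close> and
    \<open>\<bar>G(w\<^sub>2)\<bar>\<^sup>2 / l\<close> both equal \<open>\<bar>G(w\<^sub>1) G(w\<^sub>2)\<bar>\<close>.\<close>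
  define l where "l = norm (?G w2) / norm (?G w1)"
  have l: "l > 0" using G0 by (simp add: l_def)
  have "norm ?I \<le> (LINT x|M. norm (cauchy_kernel w1 x * cauchy_kernel w2 x))" by (rule integral_norm_bound)
  also have "\<dots> \<le> (LINT x|M. (l * (norm (cauchy_kernel w1 x))\<^sup>2 + (norm (cauchy_kernel w2 x))\<^sup>2 / l) / 2)"
  proof (rule integral_mono)
    fix x
    let ?a = "norm (cauchy_kernel w1 x)" and ?b = "norm (cauchy_kernel w2 x)"
    have "0 \<le> (l * ?a - ?b)\<^sup>2 / l" using l by simp
    also have "\<dots> = l * ?a\<^sup>2 + ?b\<^sup>2 / l - 2 * (?a * ?b)"
      using l by (simp add: power2_eq_square field_simps)
    finally show "norm (cauchy_kernel w1 x * cauchy_kernel w2 x) \<le> (l * ?a\<^sup>2 + ?b\<^sup>2 / l) / 2"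
      by (simp add: norm_mult)
  qed (use w integrable_kernel_mult integrable_kernel_square in auto)
  also have "\<dots> = (l * A w1 + A w2 / l) / 2"
    using w integrable_kernel_square by (simp add: A_def)
  finally have "c * norm ?I \<le> c * ((l * A w1 + A w2 / l) / 2)" using c by (rule mult_left_mono)
  also have "\<dots> = (l * (c * A w1) + (c * A w2) / l) / 2" by (simp add: algebra_simps)
  also have "\<dots> < (l * (norm (?G w1))\<^sup>2 + (norm (?G w2))\<^sup>2 / l) / 2"
    using cA[OF w(1) eq(1) neg(1)] cA[OF w(2) eq(2) neg(2)] l
    by (intro divide_strict_right_mono add_strict_mono mult_strict_left_mono) auto
  also have "\<dots> = norm (?G w1) * norm (?G w2)"
    using G0 by (simp add: l_def power2_eq_square field_simps)
  also have "\<dots> = c * norm ?I" using arg_cong[OF I, of norm] c by (simp add: norm_mult)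
  finally show False by simp
qed

text \<open>If \<open>g\<close> solves the equation, then \<open>w = z + (t - 1) / g\<close> satisfies \<open>g = t G(w)\<close>, so \<open>w\<close> is the fixed
point of the previous lemma for \<open>c = (t - 1) / t\<close>.\<close>

lemma free_power_equation_unique:
  assumes z: "Im z > 0" and t: "t \<ge> 1" and M: "measure M {None} < 1"
    and g: "Im g1 < 0" "g1 / of_real t = cauchy_transform M (z + of_real (t - 1) / g1)"
    and h: "Im g2 < 0" "g2 / of_real t = cauchy_transform M (z + of_real (t - 1) / g2)"
  shows "g1 = g2"
proof -
  let ?w = "\<lambda>g. z + of_real (t - 1) / g"
  have w: "Im (?w g) > 0" "?w g = z + of_real ((t - 1) / t) / cauchy_transform M (?w g)"
    if "Im g < 0" "g / of_real t = cauchy_transform M (?w g)" for g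
  proof -
    have "Im (of_real (t - 1) / g) \<ge> 0" using t that(1) by (intro Im_of_real_divide_nonneg) auto
    then show "Im (?w g) > 0" using z by simp
    show "?w g = z + of_real ((t - 1) / t) / cauchy_transform M (?w g)"
    proof -
      have "t \<noteq> 0" using t by auto
      then have "of_real ((t - 1) / t) / (g / of_real t) = of_real (t - 1) / g" by simp
      then show ?thesis unfolding that(2)[symmetric] by (simp only:)
    qed
  qed
  have "?w g1 = ?w g2"
    by (rule subordination_point_unique[where c = "(t - 1) / t" and z = z]) (use w g h z t M in auto)
  then have "g1 / of_real t = g2 / of_real t" using g(2) h(2) by metis
  then show ?thesis using t by simp
qed

end

lemma ext_probI: "M \<in> prob_measures_on extended_real_line \<Longrightarrow> ext_prob M"
  by (simp add: prob_measures_on_def ext_prob_def ext_prob_axioms_def)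

lemma ext_prob_iff: "ext_prob M \<longleftrightarrow> M \<in> prob_measures_on extended_real_line"
  by (auto simp: prob_measures_on_def ext_prob_def ext_prob_axioms_def)


section \<open>Measures on the unit circle and their moments\<close>

lemma power_series_coeffs_eq:
  fixes a b :: "nat \<Rightarrow> complex"
  assumes r: "r > 0" and ab: "\<And>x. norm x < r \<Longrightarrow> (\<lambda>k. a k * x ^ k) sums f x" "\<And>x. norm x < r \<Longrightarrow> (\<lambda>k. b k * x ^ k) sums f x"
  shows "a = b"
proof -
  have conv: "fps_conv_radius (Abs_fps c) > 0" if "\<And>x. norm x < r \<Longrightarrow> (\<lambda>k. c k * x ^ k) sums f x" for c
  proof -
    have "summable (\<lambda>k. c k * of_real (r / 2) ^ k)"
      using that[of "of_real (r / 2)"] r by (auto simp: sums_iff)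
    then have "ereal (norm (complex_of_real (r / 2))) \<le> conv_radius c" by (rule conv_radius_geI)
    moreover have "ereal (norm (complex_of_real (r / 2))) > 0" using r by simp
    ultimately have "conv_radius c > 0" by (rule less_le_trans[rotated])
    then show ?thesis by (simp add: fps_conv_radius_def)
  qed
  have "\<forall>\<^sub>F z in nhds (0 :: complex). norm z < r"
    using r eventually_nhds_in_open[of "ball 0 r" "0 :: complex"] by simp
  then have "\<forall>\<^sub>F z in nhds 0. eval_fps (Abs_fps a) z = eval_fps (Abs_fps b) z"
    by eventually_elim (use ab in \<open>auto simp: eval_fps_def sums_iff\<close>)
  then have "Abs_fps a = Abs_fps b"
    by (intro eval_fps_eqD conv ab)
  then show ?thesis by (simp add: fun_eq_iff fps_eq_iff)
qed

text \<open>Indicators of closed sets are limits of the continuous functions \<open>max 0 (1 - n dist(x, C))\<close>, and the closed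
sets generate the Borel sets and are stable under intersection.\<close>

lemma finite_measure_eqI_continuous:
  fixes \<mu> \<nu> :: "'a :: metric_space measure"
  assumes "finite_measure \<mu>" "finite_measure \<nu>" and s: "sets \<mu> = sets borel" "sets \<nu> = sets borel"
    and eq: "\<And>f :: 'a \<Rightarrow> real. continuous_on UNIV f \<Longrightarrow> (\<And>x. 0 \<le> f x \<and> f x \<le> 1) \<Longrightarrow> integral\<^sup>L \<mu> f = integral\<^sup>L \<nu> f"
  shows "\<mu> = \<nu>"
proof (rule measure_eqI_generator_eq)
  interpret \<mu>: finite_measure \<mu> by fact
  interpret \<nu>: finite_measure \<nu> by fact
  note [measurable_cong] = s
  show "Int_stable (Collect (closed :: 'a set \<Rightarrow> bool))" by (auto simp: Int_stable_def)
  show "sets \<mu> = sigma_sets UNIV (Collect closed)" "sets \<nu> = sigma_sets UNIV (Collect closed)"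
    using s by (auto simp: borel_eq_closed)
  show "range (\<lambda>_. UNIV :: 'a set) \<subseteq> Collect closed" by auto
  fix C :: "'a set" assume C: "C \<in> Collect closed"
  show "emeasure \<mu> C = emeasure \<nu> C"
  proof (cases "C = {}")
    case False
    define f where "f n x = max 0 (1 - real n * infdist x C)" for n x
    have f: "continuous_on UNIV (f n)" "0 \<le> f n x \<and> f n x \<le> 1" for n x
      unfolding f_def by (auto intro!: continuous_intros continuous_on_infdist simp: infdist_nonneg)
    have [measurable]: "C \<in> sets borel" using C by auto
    have [measurable]: "f n \<in> borel_measurable borel" for n using f(1) by (rule borel_measurable_continuous_onI)
    have pw: "(\<lambda>n. f n x) \<longlonglongrightarrow> indicator C x" for x
    proof (cases "x \<in> C")
      case False
      then have "infdist x C > 0" using C \<open>C \<noteq> {}\<close> by (simp add: infdist_pos_not_in_closed)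
      then have "filterlim (\<lambda>n. real n * infdist x C) at_top sequentially"
        by (intro filterlim_at_top_mult_tendsto_pos[OF tendsto_const _ filterlim_real_sequentially])
      then have "\<forall>\<^sub>F n in sequentially. real n * infdist x C \<ge> 1" by (simp add: filterlim_at_top)
      then have "\<forall>\<^sub>F n in sequentially. f n x = indicator C x"
        by eventually_elim (use False in \<open>auto simp: f_def\<close>)
      then show ?thesis by (rule tendsto_eventually)
    qed (simp add: f_def)
    have lim: "(\<lambda>n. integral\<^sup>L M (f n)) \<longlonglongrightarrow> measure M C" if "finite_measure M" "sets M = sets borel" for M :: "'a measure"
    proof -
      interpret M: finite_measure M by fact
      note [measurable_cong] = that(2)
      have "(\<lambda>n. integral\<^sup>L M (f n)) \<longlonglongrightarrow> integral\<^sup>L M (indicator C)"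
        by (rule integral_dominated_convergence[where w = "\<lambda>_. 1"])
          (use f pw C that(2) in \<open>auto intro!: AE_I2\<close>)
      then show ?thesis using C that(2) sets_eq_imp_space_eq[OF that(2)] by simp
    qed
    have "measure \<mu> C = measure \<nu> C"
      using lim[OF assms(1) s(1)] lim[OF assms(2) s(2)] eq[OF f] by (simp add: LIMSEQ_unique)
    then show ?thesis by (simp add: \<mu>.emeasure_eq_measure \<nu>.emeasure_eq_measure)
  qed simp
next
  interpret \<mu>: finite_measure \<mu> by fact
  show "emeasure \<mu> UNIV \<noteq> \<infinity>" for i :: nat by simp
qed auto

lemma cnj_mult_self_unit: "norm z = 1 \<Longrightarrow> cnj z * z = 1"
  using complex_norm_square[of z] by (simp add: mult.commute[of "cnj z"] del: complex_mult_cnj)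

text \<open>On the unit circle \<open>cnj z = 1 / z\<close>, so polynomials in the real and imaginary parts become Laurent polynomials
in \<open>z\<close>.\<close>

lemma real_polynomial_function_on_circle:
  fixes g :: "complex \<Rightarrow> real"
  assumes "real_polynomial_function g"
  shows "\<exists>N P. \<forall>z. norm z = 1 \<longrightarrow> of_real (g z) = cnj z ^ N * poly P z"
  using assms
proof (induction rule: real_polynomial_function.induct)
  case (linear f)
  then interpret bounded_linear f .
  have "of_real (f z) = cnj z ^ 1 * poly [:(f 1 + \<i> * f \<i>) / 2, 0, (f 1 - \<i> * f \<i>) / 2:] z" if "norm z = 1" for z
  proof -
    have "z = Re z *\<^sub>R 1 + Im z *\<^sub>R \<i>" by (simp add: complex_eq_iff)
    then have "f z = f (Re z *\<^sub>R 1 + Im z *\<^sub>R \<i>)" by (rule arg_cong)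
    also have "\<dots> = Re z * f 1 + Im z * f \<i>" by (subst add, subst (1 2) scaleR) simp
    finally have f: "f z = Re z * f 1 + Im z * f \<i>" .
    note c = cnj_mult_self_unit[OF that]
    have "cnj z ^ 1 * poly [:(f 1 + \<i> * f \<i>) / 2, 0, (f 1 - \<i> * f \<i>) / 2:] z
       = (f 1 + \<i> * f \<i>) / 2 * cnj z + (cnj z * z) * z * (f 1 - \<i> * f \<i>) / 2"
      by (simp add: algebra_simps)
    also have "\<dots> = of_real (f z)" unfolding c f by (simp add: complex_eq_iff field_simps)
    finally show ?thesis by simp
  qed
  then show ?case by blast
next
  case (const c)
  show ?case by (intro exI[of _ 0] exI[of _ "[:of_real c:]"]) auto
next
  case (add f g)
  then obtain N P N' P' where *: "\<And>z. norm z = 1 \<Longrightarrow> of_real (f z) = cnj z ^ N * poly P z"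
    "\<And>z. norm z = 1 \<Longrightarrow> of_real (g z) = cnj z ^ N' * poly P' z" by blast
  have "of_real (f z + g z) = cnj z ^ (N + N') * poly (monom 1 N' * P + monom 1 N * P') z" if "norm z = 1" for z
  proof -
    have c: "cnj z ^ k * z ^ k = 1" for k
      by (simp only: power_mult_distrib[symmetric] cnj_mult_self_unit[OF that] power_one)
    have "cnj z ^ (N + N') * poly (monom 1 N' * P + monom 1 N * P') z
      = (cnj z ^ N' * z ^ N') * (cnj z ^ N * poly P z) + (cnj z ^ N * z ^ N) * (cnj z ^ N' * poly P' z)"
      by (simp add: poly_monom power_add algebra_simps)
    then show ?thesis unfolding c using *[OF that] by simp
  qed
  then show ?case by blast
next
  case (mult f g)
  then obtain N P N' P' where *: "\<And>z. norm z = 1 \<Longrightarrow> of_real (f z) = cnj z ^ N * poly P z"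
    "\<And>z. norm z = 1 \<Longrightarrow> of_real (g z) = cnj z ^ N' * poly P' z" by blast
  have "of_real (f z * g z) = cnj z ^ (N + N') * poly (P * P') z" if "norm z = 1" for z
    using *[OF that] by (simp add: power_add mult_ac)
  then show ?case by blast
qed

text \<open>The moments determine the integrals of all Laurent polynomials, and these are uniformly dense in the continuous
functions on the circle by the Stone-Weierstrass theorem.\<close>

lemma circle_measure_eqI:
  fixes \<mu> \<nu> :: "complex measure"
  assumes "prob_space \<mu>" "prob_space \<nu>" and s: "sets \<mu> = sets borel" "sets \<nu> = sets borel"
    and circ: "AE z in \<mu>. norm z = 1" "AE z in \<nu>. norm z = 1"
    and moments: "\<And>k. (LINT z|\<mu>. z ^ k) = (LINT z|\<nu>. z ^ k)"
  shows "\<mu> = \<nu>"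
proof (rule finite_measure_eqI_continuous[OF _ _ s])
  interpret \<mu>: prob_space \<mu> by fact
  interpret \<nu>: prob_space \<nu> by fact
  show "finite_measure \<mu>" "finite_measure \<nu>" by unfold_locales
  define good where "good M \<longleftrightarrow> prob_space M \<and> sets M = sets borel \<and> (AE z in M. norm z = 1)" for M :: "complex measure"
  have good: "good \<mu>" "good \<nu>" using assms by (auto simp: good_def)
  have meas: "h \<in> borel_measurable M" if "good M" "continuous_on UNIV h" for M and h :: "complex \<Rightarrow> complex"
  proof -
    have "borel_measurable M = (borel_measurable borel :: (complex \<Rightarrow> complex) set)"
      using that(1) by (intro measurable_cong_sets) (auto simp: good_def)
    then show ?thesis using borel_measurable_continuous_onI[OF that(2)] by simp
  qed
  have int: "integrable M h" if "good M" "h \<in> borel_measurable borel" "\<And>z. norm z = 1 \<Longrightarrow> norm (h z) \<le> B"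
    for M and h :: "complex \<Rightarrow> 'b :: {banach, second_countable_topology}" and B
  proof -
    interpret prob_space M using that by (simp add: good_def)
    have "AE z in M. norm z = 1" using that by (simp add: good_def)
    then have "AE z in M. norm (h z) \<le> B" by eventually_elim (use that in auto)
    moreover have "borel_measurable M = (borel_measurable borel :: (complex \<Rightarrow> 'b) set)"
      using that(1) by (intro measurable_cong_sets) (auto simp: good_def)
    ultimately show ?thesis using that(2) by (intro integrable_const_bound) auto
  qed
  define m where "m k = (LINT z|\<mu>. z ^ k)" for k
  have zkl: "(LINT z|M. cnj z ^ l * z ^ k) = (if l \<le> k then m (k - l) else cnj (m (l - k)))" if M: "M = \<mu> \<or> M = \<nu>" for M k l
  proof -
    have g: "good M" and mk: "\<And>k. (LINT z|M. z ^ k) = m k" using M good moments by (auto simp: m_def)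
    have AE1: "AE z in M. norm z = 1" and sM: "sets M = sets borel" using g by (auto simp: good_def)
    note [measurable_cong] = sM
    have c: "cnj z ^ k * z ^ k = 1" if "norm z = 1" for z k
      by (simp only: power_mult_distrib[symmetric] cnj_mult_self_unit[OF that] power_one)
    show ?thesis
    proof (cases "l \<le> k")
      case True
      have "(LINT z|M. cnj z ^ l * z ^ k) = (LINT z|M. z ^ (k - l))"
      proof (rule integral_cong_AE)
        show "AE z in M. cnj z ^ l * z ^ k = z ^ (k - l)" using AE1
        proof eventually_elim
          case (elim z)
          have "cnj z ^ l * z ^ k = (cnj z ^ l * z ^ l) * z ^ (k - l)"
            using True by (simp flip: power_add)
          then show ?case using c[OF elim] by simp
        qed
      qed (intro meas g continuous_intros)+
      then show ?thesis using True mk by simp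
    next
      case False
      have "(LINT z|M. cnj z ^ l * z ^ k) = (LINT z|M. cnj (z ^ (l - k)))"
      proof (rule integral_cong_AE)
        show "AE z in M. cnj z ^ l * z ^ k = cnj (z ^ (l - k))" using AE1
        proof eventually_elim
          case (elim z)
          have "cnj z ^ l = cnj z ^ (l - k) * cnj z ^ k"
            using False by (simp flip: power_add)
          then show ?case using c[OF elim, of k] by (simp add: mult.assoc)
        qed
      qed (intro meas g continuous_intros)+
      also have "\<dots> = cnj (m (l - k))" by (simp add: mk del: complex_cnj_power)
      finally show ?thesis using False by simp
    qed
  qed
  fix f :: "complex \<Rightarrow> real" assume f: "continuous_on UNIV f" "\<And>x. 0 \<le> f x \<and> f x \<le> 1"
  have [measurable]: "f \<in> borel_measurable borel" using f(1) by (rule borel_measurable_continuous_onI)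
  have fint: "integrable M f" if "good M" for M by (rule int[OF that, of _ 1]) (use f(2) in auto)
  show "integral\<^sup>L \<mu> f = integral\<^sup>L \<nu> f"
  proof (rule ccontr)
    assume ne: "\<not> ?thesis"
    define e where "e = \<bar>integral\<^sup>L \<mu> f - integral\<^sup>L \<nu> f\<bar> / 3"
    have e: "e > 0" using ne by (simp add: e_def)
    obtain g where g: "real_polynomial_function g" "\<And>x. x \<in> sphere 0 1 \<Longrightarrow> \<bar>f x - g x\<bar> < e"
      using Stone_Weierstrass_real_polynomial_function[OF compact_sphere continuous_on_subset[OF f(1)] e, of 0 1] by auto
    have "continuous_on UNIV g"
      using g(1) by (intro continuous_on_polymonial_function) (simp add: real_polynomial_function_eq)
    then have [measurable]: "g \<in> borel_measurable borel" by (rule borel_measurable_continuous_onI)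
    have gb: "\<bar>g z\<bar> \<le> 1 + e" if "norm z = 1" for z using g(2)[of z] f(2)[of z] that by (auto simp: abs_le_iff abs_less_iff)
    have gint: "integrable M g" if "good M" for M
      by (rule int[OF that, of _ "1 + e"]) (use gb in auto)
    obtain N P where NP: "\<And>z. norm z = 1 \<Longrightarrow> of_real (g z) = cnj z ^ N * poly P z"
      using real_polynomial_function_on_circle[OF g(1)] by blast
    have gval: "of_real (integral\<^sup>L M g) = (\<Sum>k\<le>degree P. coeff P k * (if N \<le> k then m (k - N) else cnj (m (N - k))))"
      if M: "M = \<mu> \<or> M = \<nu>" for M
    proof -
      have gM: "good M" using M good by auto
      then have AE1: "AE z in M. norm z = 1" and sM: "sets M = sets borel" by (auto simp: good_def)
      note [measurable_cong] = sM
      have "of_real (integral\<^sup>L M g) = (LINT z|M. complex_of_real (g z))"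
        using gint[OF gM] by simp
      also have "\<dots> = (LINT z|M. (\<Sum>k\<le>degree P. coeff P k * (cnj z ^ N * z ^ k)))"
      proof (rule integral_cong_AE)
        show "AE z in M. complex_of_real (g z) = (\<Sum>k\<le>degree P. coeff P k * (cnj z ^ N * z ^ k))" using AE1
          by eventually_elim (simp add: NP poly_altdef sum_distrib_left mult_ac)
      qed (use gint[OF gM] in \<open>auto intro!: meas gM continuous_intros\<close>)
      also have "\<dots> = (\<Sum>k\<le>degree P. coeff P k * (LINT z|M. cnj z ^ N * z ^ k))"
      proof -
        have "integrable M (\<lambda>z. cnj z ^ N * z ^ k)" for k
          by (rule int[OF gM, of _ 1]) (auto simp: norm_mult norm_power intro!: borel_measurable_continuous_onI continuous_intros)
        then show ?thesis by (subst Bochner_Integration.integral_sum) auto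
      qed
      finally show ?thesis by (simp add: zkl[OF M])
    qed
    have "complex_of_real (integral\<^sup>L \<mu> g) = of_real (integral\<^sup>L \<nu> g)"
      by (rule trans[OF gval[OF disjI1[OF refl]] gval[OF disjI2[OF refl], symmetric]])
    then have geq: "integral\<^sup>L \<mu> g = integral\<^sup>L \<nu> g" by (simp only: of_real_eq_iff)
    have fg: "\<bar>integral\<^sup>L M f - integral\<^sup>L M g\<bar> \<le> e" if M: "good M" for M
    proof -
      interpret prob_space M using M by (simp add: good_def)
      have "\<bar>integral\<^sup>L M f - integral\<^sup>L M g\<bar> = \<bar>LINT z|M. f z - g z\<bar>"
        using fint[OF M] gint[OF M] by simp
      also have "\<dots> \<le> (LINT z|M. \<bar>f z - g z\<bar>)" by (rule integral_abs_bound)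
      also have "\<dots> \<le> (LINT z|M. e)"
      proof (rule integral_mono_AE)
        have "AE z in M. norm z = 1" using M by (simp add: good_def)
        then show "AE z in M. \<bar>f z - g z\<bar> \<le> e" by eventually_elim (use g(2) in \<open>auto intro: less_imp_le\<close>)
      qed (use fint[OF M] gint[OF M] in auto)
      also have "\<dots> = e" using prob_space by simp
      finally show ?thesis .
    qed
    have "\<bar>integral\<^sup>L \<mu> f - integral\<^sup>L \<nu> f\<bar> \<le> 2 * e"
      using fg[OF good(1)] fg[OF good(2)] geq by linarith
    then show False using e by (simp add: e_def)
  qed
qed


section \<open>The Cauchy transform determines the measure\<close>

text \<open>The value 1 outside the extended real line, a null set for the measures of interest, places all values on the
unit circle.\<close>
definition cayley :: "complex \<Rightarrow> complex option \<Rightarrow> complex" where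
  "cayley w x = (if x \<in> extended_real_line then (case x of None \<Rightarrow> 1 | Some y \<Rightarrow> (y - cnj w) / (y - w)) else 1)"

text \<open>The point 1 of the circle is the image of infinity.\<close>

definition inverse_cayley :: "complex \<Rightarrow> complex \<Rightarrow> complex option" where
  "inverse_cayley w z = (if z = 1 then None else Some ((z * w - cnj w) / (z - 1)))"

lemma cayley_measurable [measurable]: "cayley w \<in> borel_measurable sphere_borel"
proof -
  have [measurable]: "cnj \<in> borel_measurable borel" by (intro borel_measurable_continuous_onI continuous_intros)
  have "(\<lambda>x. case x of None \<Rightarrow> 1 | Some y \<Rightarrow> (y - cnj w) / (y - w)) \<in> borel_measurable sphere_borel"
    by (rule measurable_from_sphere) auto
  then show ?thesis unfolding cayley_def
    using extended_real_line_sphere_borel by (intro measurable_If) auto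
qed

lemma inverse_cayley_measurable [measurable]: "inverse_cayley w \<in> borel \<rightarrow>\<^sub>M sphere_borel"
proof -
  have "(\<lambda>z. Some ((z * w - cnj w) / (z - 1))) \<in> borel \<rightarrow>\<^sub>M sphere_borel"
    by (rule measurable_compose[OF _ measurable_Some_sphere]) measurable
  then show ?thesis unfolding inverse_cayley_def by (intro measurable_If) auto
qed

lemma norm_cayley: "Im w > 0 \<Longrightarrow> norm (cayley w x) = 1"
proof (cases "x \<in> extended_real_line")
  case True
  assume w: "Im w > 0"
  from True show ?thesis
  proof (cases rule: ext_real_cases)
    case (2 r)
    have "norm (of_real r - w) = norm (cnj (of_real r - w))" by (simp only: complex_mod_cnj)
    then have "norm (of_real r - w) = norm (of_real r - cnj w)" by simp
    moreover have "of_real r - w \<noteq> 0" "of_real r - cnj w \<noteq> 0" using w by (auto simp: complex_eq_iff)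
    ultimately show ?thesis using 2 True by (simp add: cayley_def norm_divide)
  qed (simp add: cayley_def)
qed (simp add: cayley_def)

lemma inverse_cayley_cayley:
  assumes "Im w > 0" "x \<in> extended_real_line"
  shows "inverse_cayley w (cayley w x) = x"
  using assms(2)
proof (cases rule: ext_real_cases)
  case (2 r)
  have n: "of_real r - w \<noteq> 0" "w - cnj w \<noteq> 0" using assms by (auto simp: complex_eq_iff)
  have c: "cayley w x - 1 = (w - cnj w) / (of_real r - w)"
    using 2 n assms by (simp add: cayley_def field_simps)
  have "cayley w x * w - cnj w = of_real r * (w - cnj w) / (of_real r - w)"
    using 2 n assms by (simp add: cayley_def field_simps)
  then have "(cayley w x * w - cnj w) / (cayley w x - 1) = of_real r"
    unfolding c using n by simp
  moreover have "cayley w x - 1 \<noteq> 0" unfolding c using n by simp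
  ultimately show ?thesis using 2 by (simp add: inverse_cayley_def)
qed (simp add: inverse_cayley_def cayley_def extended_real_line_def)

lemma (in ext_prob) distr_inverse_cayley:
  assumes "Im w > 0"
  shows "distr (distr M borel (cayley w)) sphere_borel (inverse_cayley w) = M"
proof -
  have "distr (distr M borel (cayley w)) sphere_borel (inverse_cayley w)
      = distr M sphere_borel (inverse_cayley w \<circ> cayley w)"
    by (rule distr_distr) auto
  also have "\<dots> = distr M sphere_borel (\<lambda>x. x)"
  proof (rule distr_cong_AE)
    show "AE x in M. (inverse_cayley w \<circ> cayley w) x = x"
      using AE_ext by eventually_elim (simp add: inverse_cayley_cayley assms)
  qed auto
  also have "\<dots> = M" by (rule distr_id2) simp
  finally show ?thesis .
qed

text \<open>The generating function of the moments of the Cayley image of \<open>M\<close> is the integral of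
\<open>1 / (1 - \<zeta> cayley w x)\<close>. As a function of \<open>x\<close> this is a Moebius transformation with its pole at \<open>v\<close>,
so the Cauchy transform at \<open>v\<close> computes its integral.\<close>

lemma (in ext_prob) cayley_moments_sums:
  assumes w: "Im w > 0" and \<zeta>: "norm \<zeta> < 1" and v: "v = (w - \<zeta> * cnj w) / (1 - \<zeta>)" "Im v > 0"
  shows "(\<lambda>k. (LINT x|M. cayley w x ^ k) * \<zeta> ^ k) sums ((1 - (v - w) * cauchy_transform M v) / (1 - \<zeta>))"
proof -
  have nt: "norm (\<zeta> * cayley w x) < 1" for x using \<zeta> by (simp add: norm_mult norm_cayley[OF w])
  have "(\<lambda>k. LINT x|M. (\<zeta> * cayley w x) ^ k) sums (LINT x|M. (\<Sum>k. (\<zeta> * cayley w x) ^ k))"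
  proof (rule sums_integral)
    show "integrable M (\<lambda>x. (\<zeta> * cayley w x) ^ k)" for k
      by (rule integrable_ext_bounded[where B = "norm \<zeta> ^ k"]) (auto simp: norm_power norm_mult norm_cayley[OF w])
    show "AE x in M. summable (\<lambda>k. norm ((\<zeta> * cayley w x) ^ k))"
      using nt by (auto simp: norm_power intro!: AE_I2 summable_geometric)
    show "summable (\<lambda>k. LINT x|M. norm ((\<zeta> * cayley w x) ^ k))"
      using \<zeta> by (simp add: norm_power norm_mult norm_cayley[OF w])
  qed
  also have "(LINT x|M. (\<Sum>k. (\<zeta> * cayley w x) ^ k)) = (LINT x|M. 1 / (1 - \<zeta> * cayley w x))"
    using nt by (simp add: suminf_geometric)
  also have "\<dots> = (LINT x|M. (1 - (v - w) * cauchy_kernel v x) / (1 - \<zeta>))"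
  proof (rule integral_cong_ext)
    fix x assume x: "x \<in> extended_real_line"
    have z1: "1 - \<zeta> \<noteq> 0" using \<zeta> by auto
    from x show "1 / (1 - \<zeta> * cayley w x) = (1 - (v - w) * cauchy_kernel v x) / (1 - \<zeta>)"
    proof (cases rule: ext_real_cases)
      case (2 r)
      let ?y = "complex_of_real r"
      have n: "?y - w \<noteq> 0" "?y - v \<noteq> 0" "v - ?y \<noteq> 0" using w v(2) by (auto simp: complex_eq_iff)
      have vz: "v * (1 - \<zeta>) = w - \<zeta> * cnj w" using z1 by (simp add: v)
      have "1 - \<zeta> * cayley w x = ((?y - w) - \<zeta> * (?y - cnj w)) / (?y - w)"
      proof -
        have "cayley w x = (?y - cnj w) / (?y - w)" using 2 x by (simp add: cayley_def)
        then show ?thesis by (simp only:) (use n(1) in \<open>simp add: field_simps\<close>)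
      qed
      also have "(?y - w) - \<zeta> * (?y - cnj w) = ?y * (1 - \<zeta>) - (w - \<zeta> * cnj w)" by (simp add: algebra_simps)
      also have "\<dots> = (1 - \<zeta>) * (?y - v)" unfolding vz[symmetric] by (simp add: algebra_simps)
      finally have "1 / (1 - \<zeta> * cayley w x) = (?y - w) / (?y - v) / (1 - \<zeta>)" by simp
      also have "(?y - w) / (?y - v) = 1 - (v - w) * cauchy_kernel v x"
        using 2 n by (simp add: field_simps)
      finally show ?thesis .
    qed (simp add: cayley_def x)
  qed auto
  also have "\<dots> = (1 - (v - w) * cauchy_transform M v) / (1 - \<zeta>)"
    using integrable_kernel[OF v(2)] by (simp add: cauchy_transform_eq)
  finally have "(\<lambda>k. LINT x|M. (\<zeta> * cayley w x) ^ k) sums \<dots>" .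
  moreover have "(LINT x|M. (\<zeta> * cayley w x) ^ k) = (LINT x|M. cayley w x ^ k) * \<zeta> ^ k" for k
    by (simp add: power_mult_distrib mult.commute)
  ultimately show ?thesis by simp
qed

text \<open>As \<open>\<zeta>\<close> runs through a small disc around 0, the pole \<open>v\<close> of the previous lemma stays close to \<open>w\<close>. So
both measures have the same moment generating function near 0, hence the same moments on the circle.\<close>

theorem cauchy_transform_determines_measure:
  assumes M: "ext_prob M" and N: "ext_prob N" and w: "Im w > 0" and r: "r > 0"
    and eq: "\<And>v. norm (v - w) < r \<Longrightarrow> cauchy_transform M v = cauchy_transform N v"
  shows "M = N"
proof -
  interpret M: ext_prob M by fact
  interpret N: ext_prob N by fact
  \<comment> \<open>For \<open>\<bar>\<zeta>\<bar> \<le> 1/2\<close> one has \<open>\<bar>v - w\<bar> \<le> 4 \<bar>\<zeta>\<bar> Im w\<close>, so this radius keeps \<open>v\<close> in the upper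
    half plane and within distance \<open>r\<close> of \<open>w\<close>.\<close>
  define r' where "r' = min (1/2) (min r (Im w) / (4 * Im w))"
  have r': "r' > 0" using w r by (simp add: r'_def)
  define F where "F \<zeta> = (let v = (w - \<zeta> * cnj w) / (1 - \<zeta>) in (1 - (v - w) * cauchy_transform M v) / (1 - \<zeta>))" for \<zeta>
  have sums: "(\<lambda>k. (LINT x|M. cayley w x ^ k) * \<zeta> ^ k) sums F \<zeta>"
    "(\<lambda>k. (LINT x|N. cayley w x ^ k) * \<zeta> ^ k) sums F \<zeta>" if "norm \<zeta> < r'" for \<zeta>
  proof -
    have z: "norm \<zeta> < 1/2" "norm \<zeta> < min r (Im w) / (4 * Im w)" using that by (auto simp: r'_def)
    then have z1: "1 - \<zeta> \<noteq> 0" by auto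
    define v where "v = (w - \<zeta> * cnj w) / (1 - \<zeta>)"
    have "v - w = \<zeta> * (w - cnj w) / (1 - \<zeta>)" using z1 by (simp add: v_def field_simps)
    then have "norm (v - w) = norm \<zeta> * norm (w - cnj w) / norm (1 - \<zeta>)" by (simp add: norm_mult norm_divide)
    also have "norm (w - cnj w) = 2 * Im w"
      using w by (simp add: complex_diff_cnj norm_mult)
    also have "norm \<zeta> * (2 * Im w) / norm (1 - \<zeta>) \<le> norm \<zeta> * (2 * Im w) / (1/2)"
      using norm_triangle_ineq2[of 1 \<zeta>] z w by (intro divide_left_mono mult_pos_pos) auto
    also have "\<dots> < min r (Im w)" using z(2) w by (simp add: field_simps)
    finally have d: "norm (v - w) < r" "norm (v - w) < Im w" by auto
    have "Im v > 0" using d(2) abs_Im_le_cmod[of "v - w"] by (auto simp: abs_if split: if_splits)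
    moreover have "norm \<zeta> < 1" using z by simp
    ultimately show "(\<lambda>k. (LINT x|M. cayley w x ^ k) * \<zeta> ^ k) sums F \<zeta>"
      "(\<lambda>k. (LINT x|N. cayley w x ^ k) * \<zeta> ^ k) sums F \<zeta>"
      using M.cayley_moments_sums[OF w _ v_def] N.cayley_moments_sums[OF w _ v_def] eq[OF d(1)]
      by (simp_all add: F_def Let_def flip: v_def)
  qed
  have mom: "(LINT x|M. cayley w x ^ k) = (LINT x|N. cayley w x ^ k)" for k
    using power_series_coeffs_eq[OF r' sums] by (rule fun_cong)
  have "distr M borel (cayley w) = distr N borel (cayley w)"
  proof (rule circle_measure_eqI)
    show "prob_space (distr M borel (cayley w))" "prob_space (distr N borel (cayley w))"
      by (auto intro!: M.prob_space_distr N.prob_space_distr)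
    show "AE z in distr M borel (cayley w). norm z = 1" "AE z in distr N borel (cayley w). norm z = 1"
      by (subst AE_distr_iff; simp add: norm_cayley[OF w])+
    show "(LINT z|distr M borel (cayley w). z ^ k) = (LINT z|distr N borel (cayley w). z ^ k)" for k
      by (subst (1 2) integral_distr) (auto simp: mom)
  qed auto
  then show ?thesis using M.distr_inverse_cayley[OF w] N.distr_inverse_cayley[OF w] by metis
qed


section \<open>Weak convergence on the extended real line\<close>

abbreviation ext_continuous :: "(complex option \<Rightarrow> real) \<Rightarrow> bool" where
  "ext_continuous \<equiv> continuous_map (subtopology riemann_sphere extended_real_line) euclideanreal"

text \<open>Complements of compact sets are the neighbourhoods of infinity in the one-point compactification, so continuity
there is a limit along both ends of the real line.\<close>

lemma ext_continuous_iff: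
  fixes f :: "complex option \<Rightarrow> real"
  shows "ext_continuous f \<longleftrightarrow>
    continuous_on UNIV (\<lambda>x :: real. f (Some (of_real x))) \<and>
    ((\<lambda>x :: real. f (Some (of_real x))) \<longlongrightarrow> f None) at_infinity" (is "?L \<longleftrightarrow> ?C \<and> ?T")
proof
  assume L: ?L
  have "continuous_map euclideanreal euclidean complex_of_real"
    by (simp add: continuous_on_of_real_id)
  then have "continuous_map euclideanreal riemann_sphere (Some \<circ> complex_of_real)"
    unfolding riemann_sphere_def by (rule continuous_map_compose[OF _ continuous_map_Some])
  then have "continuous_map euclideanreal (subtopology riemann_sphere extended_real_line) (Some \<circ> complex_of_real)"
    by (auto simp: continuous_map_in_subtopology extended_real_line_def)
  from continuous_map_compose[OF this L] have ?C by (simp add: o_def)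
  moreover have ?T
  proof (rule tendstoI)
    fix e :: real assume e: "e > 0"
    have "openin (subtopology riemann_sphere extended_real_line)
        {x \<in> topspace (subtopology riemann_sphere extended_real_line). f x \<in> ball (f None) e}"
      using L by (rule openin_continuous_map_preimage) simp
    then obtain V where V: "openin riemann_sphere V" "{x \<in> extended_real_line. f x \<in> ball (f None) e} = V \<inter> extended_real_line"
      by (auto simp: openin_subtopology)
    have "None \<in> {x \<in> extended_real_line. f x \<in> ball (f None) e}"
      using e by (simp add: extended_real_line_def)
    then have "None \<in> V" using V by blast
    then obtain C where C: "compact C" "V = insert None (Some ` (- C))"
      using V(1) by (auto simp: riemann_sphere_def openin_Alexandroff_compactification Compl_eq_Diff_UNIV)
    obtain B where B: "\<And>z. z \<in> C \<Longrightarrow> norm z \<le> B" using compact_imp_bounded[OF C(1)] by (auto simp: bounded_iff)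
    show "\<forall>\<^sub>F x in at_infinity. dist (f (Some (of_real x))) (f None) < e"
      unfolding eventually_at_infinity
    proof (intro exI[of _ "B + 1"] allI impI)
      fix x :: real assume x: "B + 1 \<le> norm x"
      then have "complex_of_real x \<notin> C" using B[of "of_real x"] by auto
      then have "Some (complex_of_real x) \<in> V \<inter> extended_real_line" using C by (auto simp: extended_real_line_def)
      then have "Some (complex_of_real x) \<in> {x \<in> extended_real_line. f x \<in> ball (f None) e}" using V(2) by blast
      then show "dist (f (Some (of_real x))) (f None) < e" by (simp add: dist_commute)
    qed
  qed
  ultimately show "?C \<and> ?T" ..
next
  assume CT: "?C \<and> ?T"
  show ?L
    unfolding continuous_map_def
  proof (intro conjI allI impI)
    fix U :: "real set" assume "openin euclideanreal U"
    then have U: "open U" by simp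
    define A where "A = {x :: real. f (Some (of_real x)) \<in> U}"
    have "open ((\<lambda>x :: real. f (Some (of_real x))) -` U)"
      using CT by (intro open_vimage U) auto
    then have A: "open A" by (simp add: A_def vimage_def)
    show "openin (subtopology riemann_sphere extended_real_line)
        {x \<in> topspace (subtopology riemann_sphere extended_real_line). f x \<in> U}"
    proof (cases "f None \<in> U")
      case False
      have "open {z. Re z \<in> A}" using open_vimage[OF A continuous_on_Re[OF continuous_on_id]] by (simp add: vimage_def)
      then have "openin riemann_sphere (Some ` {z. Re z \<in> A})" by (simp add: riemann_sphere_def)
      moreover have "{x \<in> extended_real_line. f x \<in> U} = Some ` {z. Re z \<in> A} \<inter> extended_real_line"
      proof (rule set_eqI)
        fix x show "x \<in> {x \<in> extended_real_line. f x \<in> U} \<longleftrightarrow> x \<in> Some ` {z. Re z \<in> A} \<inter> extended_real_line"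
        proof (cases "x \<in> extended_real_line")
          case x: True
          then show ?thesis
          proof (cases rule: ext_real_cases)
            case (2 r)
            then show ?thesis using x by (simp add: A_def image_iff)
          qed (use False in auto)
        qed simp
      qed
      ultimately show ?thesis by (auto simp: openin_subtopology)
    next
      case True
      then have "\<forall>\<^sub>F x :: real in at_infinity. f (Some (of_real x)) \<in> U"
        using CT U by (auto dest: topological_tendstoD)
      then obtain B where B: "\<And>x :: real. B \<le> norm x \<Longrightarrow> x \<in> A" by (auto simp: eventually_at_infinity A_def)
      have "bounded (- A)" unfolding bounded_iff
        using B by (intro exI[of _ B]) (metis ComplD linear)
      then have "compact (- A)" using A by (simp add: compact_eq_bounded_closed closed_Compl)
      then have "compact (complex_of_real ` (- A))"
        by (intro compact_continuous_image continuous_intros)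
      then have "openin riemann_sphere (insert None (Some ` (- complex_of_real ` (- A))))"
        by (auto simp: riemann_sphere_def openin_Alexandroff_compactification Compl_eq_Diff_UNIV compact_imp_closed)
      moreover have "{x \<in> extended_real_line. f x \<in> U} = insert None (Some ` (- complex_of_real ` (- A))) \<inter> extended_real_line"
      proof (rule set_eqI)
        fix x show "x \<in> {x \<in> extended_real_line. f x \<in> U} \<longleftrightarrow>
            x \<in> insert None (Some ` (- complex_of_real ` (- A))) \<inter> extended_real_line"
        proof (cases "x \<in> extended_real_line")
          case x: True
          then show ?thesis
          proof (cases rule: ext_real_cases)
            case (2 r)
            then show ?thesis using x by (simp add: A_def image_iff)
          qed (use True x in auto)
        qed simp
      qed
      ultimately show ?thesis by (auto simp: openin_subtopology)
    qed
  qed auto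
qed

lemma ext_continuous_measurable:
  fixes f :: "complex option \<Rightarrow> real"
  assumes "ext_continuous f"
  shows "(\<lambda>x. indicator extended_real_line x *\<^sub>R f x) \<in> borel_measurable sphere_borel"
proof (rule measurable_from_sphere)
  let ?F = "\<lambda>x :: real. f (Some (of_real x))"
  have "?F \<in> borel_measurable borel"
    using assms by (intro borel_measurable_continuous_onI) (simp add: ext_continuous_iff)
  then have "(\<lambda>y. ?F (Re y)) \<in> borel_measurable borel"
    by (rule measurable_compose[OF borel_measurable_continuous_onI[OF continuous_on_Re[OF continuous_on_id]]])
  moreover have "(indicator (\<real> :: complex set) :: complex \<Rightarrow> real) \<in> borel_measurable borel"
    using closed_complex_Reals by (intro borel_measurable_indicator borel_closed)
  ultimately have "(\<lambda>y. indicator \<real> y *\<^sub>R ?F (Re y)) \<in> borel_measurable borel"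
    by (rule borel_measurable_scaleR[rotated])
  moreover have "indicator extended_real_line (Some y) *\<^sub>R f (Some y) = indicator \<real> y *\<^sub>R ?F (Re y)" for y
    by (auto simp: indicator_def extended_real_line_def elim: Reals_cases)
  ultimately show "(\<lambda>y. indicator extended_real_line (Some y) *\<^sub>R f (Some y)) \<in> borel_measurable borel" by simp
qed simp

lemma (in ext_prob) set_integral_ext:
  fixes f :: "complex option \<Rightarrow> real"
  assumes "f \<in> borel_measurable sphere_borel"
  shows "(LINT x:extended_real_line|M. f x) = integral\<^sup>L M f"
  unfolding set_lebesgue_integral_def
  by (rule integral_cong_ext) (use assms extended_real_line_sphere_borel in auto)

lemma weakly_converges_prob:
  assumes "weakly_converges M N"
  shows "ext_prob (M j)" "ext_prob N"
  using assms by (auto simp: weakly_converges_def intro: ext_probI)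

text \<open>Real and imaginary part of the Cauchy kernel are admissible test functions, as the kernel vanishes at infinity.\<close>

lemma weakly_converges_imp_cauchy_transform:
  assumes w: "weakly_converges M N" and z: "Im z > 0"
  shows "(\<lambda>j. cauchy_transform (M j) z) \<longlonglongrightarrow> cauchy_transform N z"
proof -
  have "filterlim (\<lambda>x :: real. norm x) at_top at_infinity" by (rule filterlim_norm_at_top)
  then have "filterlim (\<lambda>x :: real. - complex_of_real x) at_infinity at_infinity"
    by (simp add: filterlim_at_infinity_conv_norm_at_top)
  then have "filterlim (\<lambda>x :: real. z + - complex_of_real x) at_infinity at_infinity"
    by (rule tendsto_add_filterlim_at_infinity[OF tendsto_const])
  then have ker: "((\<lambda>x. cauchy_kernel z (Some (complex_of_real x))) \<longlongrightarrow> 0) at_infinity"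
    using tendsto_divide_0[OF tendsto_const] by simp
  have ne: "z - complex_of_real x \<noteq> 0" for x using z by (auto simp: complex_eq_iff)
  have cont: "continuous_on UNIV (\<lambda>x. cauchy_kernel z (Some (complex_of_real x)))"
    using ne by (auto intro!: continuous_intros)
  have part: "(\<lambda>j. LINT x|M j. g (cauchy_kernel z x)) \<longlonglongrightarrow> (LINT x|N. g (cauchy_kernel z x))"
    if g: "bounded_linear g" for g :: "complex \<Rightarrow> real"
  proof -
    interpret g: bounded_linear g by fact
    obtain K where K: "\<And>x. norm (g x) \<le> norm x * K" using g.bounded by auto
    let ?f = "\<lambda>x. g (cauchy_kernel z x)"
    have [measurable]: "g \<in> borel_measurable borel"
      by (intro borel_measurable_continuous_onI g.continuous_on continuous_on_id)
    have "ext_continuous ?f"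
      unfolding ext_continuous_iff
      using g.tendsto[OF ker] g.continuous_on[OF cont] by (simp add: g.zero)
    moreover have "bounded (?f ` extended_real_line)"
      unfolding bounded_iff
    proof (intro exI[of _ "1 / Im z * \<bar>K\<bar>"] ballI)
      fix y assume "y \<in> ?f ` extended_real_line"
      then obtain x where x: "x \<in> extended_real_line" "y = ?f x" by auto
      have "norm y \<le> norm (cauchy_kernel z x) * K" using K x by simp
      also have "\<dots> \<le> norm (cauchy_kernel z x) * \<bar>K\<bar>" by (intro mult_left_mono) auto
      also have "\<dots> \<le> 1 / Im z * \<bar>K\<bar>" using norm_cauchy_kernel_le[OF x(1) z] by (intro mult_right_mono) auto
      finally show "norm y \<le> 1 / Im z * \<bar>K\<bar>" .
    qed
    ultimately have "(\<lambda>j. LINT x:extended_real_line|M j. ?f x) \<longlonglongrightarrow> (LINT x:extended_real_line|N. ?f x)"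
      using w unfolding weakly_converges_def by blast
    moreover have "(LINT x:extended_real_line|P. ?f x) = integral\<^sup>L P ?f" if "ext_prob P" for P
      by (rule ext_prob.set_integral_ext[OF that]) measurable
    ultimately show ?thesis using weakly_converges_prob[OF w] by simp
  qed
  have ct: "cauchy_transform P z = Complex (LINT x|P. Re (cauchy_kernel z x)) (LINT x|P. Im (cauchy_kernel z x))"
    if "ext_prob P" for P
    using ext_prob.integrable_kernel[OF that z] by (simp add: cauchy_transform_eq complex_eq_iff)
  show ?thesis
    using part[OF bounded_linear_Re] part[OF bounded_linear_Im] weakly_converges_prob[OF w]
    by (simp add: ct tendsto_Complex)
qed

lemma ext_prob_distr:
  assumes M: "ext_prob M" and h: "h \<in> sphere_borel \<rightarrow>\<^sub>M sphere_borel" "\<And>x. x \<in> extended_real_line \<Longrightarrow> h x \<in> extended_real_line"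
  shows "ext_prob (distr M sphere_borel h)"
proof -
  interpret M: ext_prob M by fact
  have h': "h \<in> M \<rightarrow>\<^sub>M sphere_borel" using h(1) by simp
  have "prob_space (distr M sphere_borel h)" using h' by (rule M.prob_space_distr)
  moreover have "emeasure (distr M sphere_borel h) (- extended_real_line) = 0"
  proof -
    have "emeasure (distr M sphere_borel h) (- extended_real_line) = emeasure M (h -` (- extended_real_line))"
      using h' compl_extended_real_line by (simp add: emeasure_distr)
    also have "\<dots> \<le> emeasure M (- extended_real_line)"
      using h(2) compl_extended_real_line by (intro emeasure_mono) auto
    finally show ?thesis using M.ext_M by simp
  qed
  ultimately show ?thesis by (simp add: ext_prob_def ext_prob_axioms_def)
qed

lemma weakly_converges_distr:
  assumes w: "weakly_converges M N"
    and h: "h \<in> sphere_borel \<rightarrow>\<^sub>M sphere_borel" "\<And>x. x \<in> extended_real_line \<Longrightarrow> h x \<in> extended_real_line"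
    and ch: "\<And>f :: complex option \<Rightarrow> real. ext_continuous f \<Longrightarrow>
       ext_continuous (\<lambda>x. f (h x))"
  shows "weakly_converges (\<lambda>j. distr (M j) sphere_borel h) (distr N sphere_borel h)"
  unfolding weakly_converges_def
proof (intro conjI allI impI)
  fix j show "distr (M j) sphere_borel h \<in> prob_measures_on extended_real_line"
    using ext_prob_distr[OF weakly_converges_prob(1)[OF w] h] by (simp add: ext_prob_iff)
next
  show "distr N sphere_borel h \<in> prob_measures_on extended_real_line"
    using ext_prob_distr[OF weakly_converges_prob(2)[OF w] h] by (simp add: ext_prob_iff)
next
  fix f :: "complex option \<Rightarrow> real"
  assume f: "ext_continuous f \<and> bounded (f ` extended_real_line)"
  let ?g = "\<lambda>x. indicator extended_real_line x *\<^sub>R f x"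
  have cfh: "ext_continuous (\<lambda>x. f (h x))"
    using ch f by blast
  have mg: "?g \<in> borel_measurable sphere_borel" using f ext_continuous_measurable by blast
  have eq: "(LINT x:extended_real_line|distr P sphere_borel h. f x) = (LINT x:extended_real_line|P. f (h x))"
    if P: "ext_prob P" for P
  proof -
    interpret P: ext_prob P by fact
    have "(LINT x:extended_real_line|distr P sphere_borel h. f x) = (LINT x|P. ?g (h x))"
      unfolding set_lebesgue_integral_def using h mg by (intro integral_distr) auto
    also have "\<dots> = (LINT x|P. indicator extended_real_line x *\<^sub>R f (h x))"
    proof (rule P.integral_cong_ext)
      show "(\<lambda>x. ?g (h x)) \<in> borel_measurable sphere_borel" using h(1) mg by (rule measurable_compose)
      show "(\<lambda>x. indicator extended_real_line x *\<^sub>R f (h x)) \<in> borel_measurable sphere_borel"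
        by (rule ext_continuous_measurable[OF cfh])
    qed (use h(2) in auto)
    finally show ?thesis by (simp add: set_lebesgue_integral_def)
  qed
  have "bounded ((\<lambda>x. f (h x)) ` extended_real_line)"
    using f h(2) by (elim conjE bounded_subset) auto
  then have "(\<lambda>j. LINT x:extended_real_line|M j. f (h x)) \<longlonglongrightarrow> (LINT x:extended_real_line|N. f (h x))"
    using w cfh unfolding weakly_converges_def by blast
  then show "(\<lambda>j. LINT x:extended_real_line|distr (M j) sphere_borel h. f x) \<longlonglongrightarrow> (LINT x:extended_real_line|distr N sphere_borel h. f x)"
    by (simp add: eq weakly_converges_prob[OF w])
qed

text \<open>Otherwise some subsequence would stay away from the limit.\<close>

lemma tendsto_subseq_criterion:
  fixes a :: "nat \<Rightarrow> 'a :: metric_space"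
  assumes "\<And>r :: nat \<Rightarrow> nat. strict_mono r \<Longrightarrow> \<exists>r' :: nat \<Rightarrow> nat. strict_mono r' \<and> (\<lambda>k. a (r (r' k))) \<longlonglongrightarrow> L"
  shows "a \<longlonglongrightarrow> L"
proof (rule ccontr)
  assume "\<not> ?thesis"
  then obtain e where e: "e > 0" "\<not> (\<forall>\<^sub>F n in sequentially. dist (a n) L < e)"
    by (auto simp: tendsto_iff)
  have "infinite {n. \<not> dist (a n) L < e}"
    using e(2) by (simp add: eventually_cofinite[symmetric] cofinite_eq_sequentially)
  then obtain r :: "nat \<Rightarrow> nat" where r: "strict_mono r" "\<And>n. r n \<in> {n. \<not> dist (a n) L < e}"
    using infinite_enumerate by blast
  obtain r' where r': "(\<lambda>k. a (r (r' k))) \<longlonglongrightarrow> L" using assms[OF r(1)] by blast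
  have "\<forall>\<^sub>F k in sequentially. dist (a (r (r' k))) L < e" using r' e(1) by (rule tendstoD)
  then obtain k where "dist (a (r (r' k))) L < e" by (auto dest: eventually_happens)
  with r(2)[of "r' k"] show False by simp
qed

lemma weakly_converges_subseq_criterion:
  assumes "\<And>j. ext_prob (M j)" "ext_prob N"
    and "\<And>r :: nat \<Rightarrow> nat. strict_mono r \<Longrightarrow> \<exists>r' :: nat \<Rightarrow> nat. strict_mono r' \<and> weakly_converges (\<lambda>k. M (r (r' k))) N"
  shows "weakly_converges M N"
  unfolding weakly_converges_def
proof (intro conjI allI impI tendsto_subseq_criterion)
  fix f :: "complex option \<Rightarrow> real" and r :: "nat \<Rightarrow> nat"
  assume f: "ext_continuous f \<and> bounded (f ` extended_real_line)"
    and "strict_mono r"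
  from assms(3)[OF this(2)] obtain r' where "strict_mono r'" "weakly_converges (\<lambda>k. M (r (r' k))) N" by blast
  with f show "\<exists>r'. strict_mono r' \<and> (\<lambda>k. LINT x:extended_real_line|M (r (r' k)). f x) \<longlonglongrightarrow> (LINT x:extended_real_line|N. f x)"
    unfolding weakly_converges_def by blast
qed (use assms in \<open>auto simp: ext_prob_iff\<close>)

lemma weakly_converges_subseq:
  assumes "weakly_converges M N" "strict_mono r"
  shows "weakly_converges (\<lambda>k. M (r k)) N"
  unfolding weakly_converges_def
proof (intro conjI allI impI)
  fix f :: "complex option \<Rightarrow> real"
  assume "ext_continuous f \<and> bounded (f ` extended_real_line)"
  then have "(\<lambda>j. LINT x:extended_real_line|M j. f x) \<longlonglongrightarrow> (LINT x:extended_real_line|N. f x)"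
    using assms(1) unfolding weakly_converges_def by blast
  from LIMSEQ_subseq_LIMSEQ[OF this assms(2)]
  show "(\<lambda>k. LINT x:extended_real_line|M (r k). f x) \<longlonglongrightarrow> (LINT x:extended_real_line|N. f x)"
    by (simp add: o_def)
qed (use assms in \<open>auto simp: weakly_converges_def\<close>)

text \<open>The extended real line is a circle; it is unwound to an interval of angles so that Helly's selection theorem for
measures on the real line applies.\<close>

definition angle :: "complex option \<Rightarrow> real" where
  "angle x = (case x of None \<Rightarrow> pi / 2 | Some y \<Rightarrow> arctan (Re y))"

text \<open>All angles beyond \<open>\<plusminus>\<pi>/2\<close> go to infinity, which makes this map continuous on the whole real line.\<close>

definition point_of_angle :: "real \<Rightarrow> complex option" where
  "point_of_angle \<theta> = (if \<bar>\<theta>\<bar> < pi / 2 then Some (of_real (tan \<theta>)) else None)"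

lemma point_of_angle_angle: "x \<in> extended_real_line \<Longrightarrow> point_of_angle (angle x) = x"
proof (elim ext_real_cases)
  fix r assume "x = Some (complex_of_real r)"
  then show ?thesis using arctan_bounded[of r] by (auto simp: point_of_angle_def angle_def tan_arctan)
qed (simp add: point_of_angle_def angle_def)

lemma angle_measurable [measurable]: "angle \<in> borel_measurable sphere_borel"
proof (rule measurable_from_sphere)
  have "arctan \<in> borel_measurable borel" by (intro borel_measurable_continuous_onI continuous_intros)
  then show "(\<lambda>x. angle (Some x)) \<in> borel_measurable borel" unfolding angle_def by simp
qed simp

lemma point_of_angle_measurable [measurable]: "point_of_angle \<in> borel \<rightarrow>\<^sub>M sphere_borel"
proof -
  have "(\<lambda>\<theta>. Some (complex_of_real (sin \<theta> / cos \<theta>))) \<in> borel \<rightarrow>\<^sub>M sphere_borel"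
    by (rule measurable_compose[OF _ measurable_Some_sphere])
      (auto intro!: borel_measurable_of_real borel_measurable_divide borel_measurable_continuous_onI continuous_intros)
  then show ?thesis unfolding point_of_angle_def tan_def by (intro measurable_If) auto
qed

lemma isCont_point_of_angle:
  fixes f :: "complex option \<Rightarrow> real"
  assumes f: "ext_continuous f"
  shows "isCont (\<lambda>\<theta>. f (point_of_angle \<theta>)) \<theta>"
proof -
  let ?F = "\<lambda>x :: real. f (Some (of_real x))"
  have F: "continuous_on UNIV ?F" "(?F \<longlongrightarrow> f None) at_infinity" using f by (auto simp: ext_continuous_iff)
  consider "\<bar>\<theta>\<bar> < pi / 2" | "\<bar>\<theta>\<bar> > pi / 2" | "\<bar>\<theta>\<bar> = pi / 2" by linarith
  then show ?thesis
  proof cases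
    case 1
    have "-(pi/2) < \<theta>" "\<theta> < pi/2" using 1 by linarith+
    then have "cos \<theta> \<noteq> 0" using cos_gt_zero_pi[of \<theta>] by simp
    then have "isCont (\<lambda>\<theta>. ?F (tan \<theta>)) \<theta>"
      using F(1) by (intro isCont_o2[OF isCont_tan] continuous_on_interior[of UNIV]) auto
    moreover have "\<forall>\<^sub>F t in nhds \<theta>. f (point_of_angle t) = ?F (tan t)"
    proof -
      have "open {t :: real. \<bar>t\<bar> < pi / 2}" by (intro open_Collect_less continuous_intros)
      then have "\<forall>\<^sub>F t in nhds \<theta>. t \<in> {t. \<bar>t\<bar> < pi / 2}" using 1 by (intro eventually_nhds_in_open) auto
      then show ?thesis by eventually_elim (simp add: point_of_angle_def)
    qed
    ultimately show ?thesis by (simp add: isCont_cong)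
  next
    case 2
    have "open {t :: real. \<bar>t\<bar> > pi / 2}" by (intro open_Collect_less continuous_intros)
    then have "\<forall>\<^sub>F t in nhds \<theta>. t \<in> {t. \<bar>t\<bar> > pi / 2}" using 2 by (intro eventually_nhds_in_open) auto
    then have "\<forall>\<^sub>F t in nhds \<theta>. f (point_of_angle t) = f None" by eventually_elim (simp add: point_of_angle_def)
    then show ?thesis by (simp add: isCont_cong)
  next
    case 3
    have c0: "cos \<theta> = 0" using 3 by (metis cos_abs_real cos_pi_half)
    have s0: "sin \<theta> \<noteq> 0" using c0 sin_cos_squared_add[of \<theta>] by auto
    \<comment> \<open>At \<open>\<plusminus>\<pi>/2\<close> the tangent tends to infinity, without a definite sign.\<close>
    have nz: "\<forall>\<^sub>F t in at \<theta>. cos t \<noteq> 0"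
    proof -
      have "(cos has_real_derivative - sin \<theta>) (at \<theta>)" by (rule DERIV_cos)
      then have "((\<lambda>t. (cos t - cos \<theta>) / (t - \<theta>)) \<longlongrightarrow> - sin \<theta>) (at \<theta>)"
        by (simp add: has_field_derivative_iff)
      from tendsto_imp_eventually_ne[OF this, of 0]
      have "\<forall>\<^sub>F t in at \<theta>. (cos t - cos \<theta>) / (t - \<theta>) \<noteq> 0" using s0 by simp
      then show ?thesis by eventually_elim (metis c0 diff_self div_0)
    qed
    have "(cos \<longlongrightarrow> cos \<theta>) (at \<theta>)" using isCont_cos[of \<theta>] by (simp add: isCont_def)
    then have "filterlim cos (at 0) (at \<theta>)" using nz c0 by (simp add: filterlim_at)
    moreover have "(sin \<longlongrightarrow> sin \<theta>) (at \<theta>)" using isCont_sin[of \<theta>] by (simp add: isCont_def)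
    ultimately have "filterlim (\<lambda>t. sin t / cos t) at_infinity (at \<theta>)"
      using s0 by (intro filterlim_divide_at_infinity)
    then have "filterlim tan at_infinity (at \<theta>)" by (simp add: tan_def[abs_def])
    then have "((\<lambda>t. ?F (tan t)) \<longlongrightarrow> f None) (at \<theta>)" by (rule filterlim_compose[OF F(2)])
    then have "((\<lambda>t. \<bar>?F (tan t) - f None\<bar>) \<longlongrightarrow> 0) (at \<theta>)"
      by (simp add: tendsto_rabs_zero_iff LIM_zero_iff)
    then have "((\<lambda>t. f (point_of_angle t) - f None) \<longlongrightarrow> 0) (at \<theta>)"
      by (rule Lim_null_comparison[rotated]) (auto simp: point_of_angle_def)
    then have "((\<lambda>t. f (point_of_angle t)) \<longlongrightarrow> f None) (at \<theta>)" by (simp add: LIM_zero_iff)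
    then show ?thesis using 3 by (simp add: isCont_def point_of_angle_def)
  qed
qed

lemma point_of_angle_in_ext: "point_of_angle \<theta> \<in> extended_real_line"
  by (auto simp: point_of_angle_def extended_real_line_def)

text \<open>The angles lie in a bounded interval, so the image measures are tight. A limit of them may charge any angle, but
its image under \<open>point_of_angle\<close> is a measure on the extended real line again.\<close>

lemma weak_compactness:
  fixes M :: "nat \<Rightarrow> complex option measure"
  assumes M: "\<And>j. ext_prob (M j)"
  shows "\<exists>(r :: nat \<Rightarrow> nat) \<sigma>. strict_mono r \<and> weakly_converges (\<lambda>k. M (r k)) \<sigma>"
proof -
  define L where "L j = distr (M j) borel angle" for j
  have mang: "angle \<in> borel_measurable (M j)" for j
    using angle_measurable by (simp add: ext_prob.sets_M[OF M] cong: measurable_cong_sets)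
  have L: "real_distribution (L j)" for j
  proof -
    interpret ext_prob "M j" by (rule M)
    show ?thesis unfolding L_def by (intro real_distribution_distr) simp
  qed
  have "tight L"
    unfolding tight_def
  proof (intro conjI allI impI)
    fix j show "real_distribution (L j)" by (rule L)
  next
    fix e :: real assume e: "e > 0"
    have "measure (L j) {-pi<..pi} = 1" for j
    proof -
      interpret ext_prob "M j" by (rule M)
      have "angle x \<in> {-pi<..pi}" for x
      proof (cases x)
        case (Some y)
        then show ?thesis using arctan_bounded[of "Re y"] pi_gt_zero by (auto simp: angle_def)
      qed (simp add: angle_def)
      then have "angle -` {-pi<..pi} \<inter> space (M j) = space (M j)" by auto
      then show ?thesis unfolding L_def by (subst measure_distr) (use prob_space in auto)
    qed
    then show "\<exists>a b. a < b \<and> (\<forall>n. 1 - e < measure (L n) {a<..b})"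
      using e pi_gt_zero by (intro exI[of _ "-pi"] exI[of _ pi]) (simp del: pi_gt_zero)
  qed
  then obtain r \<nu> where r: "strict_mono r" and \<nu>: "real_distribution \<nu>" and wc: "weak_conv_m (L \<circ> id \<circ> r) \<nu>"
    using tight_imp_convergent_subsubsequence[of L id] strict_mono_id by blast
  interpret \<nu>: real_distribution \<nu> by fact
  define \<sigma> where "\<sigma> = distr \<nu> sphere_borel point_of_angle"
  have m\<nu>: "point_of_angle \<in> \<nu> \<rightarrow>\<^sub>M sphere_borel" by simp
  have \<sigma>: "ext_prob \<sigma>"
  proof -
    have "prob_space \<sigma>" unfolding \<sigma>_def using m\<nu> by (rule \<nu>.prob_space_distr)
    moreover have "emeasure \<sigma> (- extended_real_line) = 0"
    proof -
      have "point_of_angle -` (- extended_real_line) = {}" using point_of_angle_in_ext by auto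
      then show ?thesis using m\<nu> compl_extended_real_line by (simp add: \<sigma>_def emeasure_distr)
    qed
    ultimately show ?thesis by (simp add: ext_prob_def ext_prob_axioms_def \<sigma>_def)
  qed
  have "weakly_converges (\<lambda>k. M (r k)) \<sigma>"
    unfolding weakly_converges_def
  proof (intro conjI allI impI)
    fix f :: "complex option \<Rightarrow> real"
    assume f: "ext_continuous f \<and> bounded (f ` extended_real_line)"
    let ?g = "\<lambda>x. indicator extended_real_line x *\<^sub>R f x"
    have mg: "?g \<in> borel_measurable sphere_borel" using f ext_continuous_measurable by blast
    obtain B where B: "\<And>x. x \<in> extended_real_line \<Longrightarrow> norm (f x) \<le> B" using f by (auto simp: bounded_iff)
    have cont: "isCont (\<lambda>\<theta>. f (point_of_angle \<theta>)) \<theta>" for \<theta> using isCont_point_of_angle f by blast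
    have mf: "(\<lambda>\<theta>. f (point_of_angle \<theta>)) \<in> borel_measurable borel"
      using cont by (intro borel_measurable_continuous_onI continuous_at_imp_continuous_on) auto
    have "(\<lambda>k. integral\<^sup>L ((L \<circ> id \<circ> r) k) (\<lambda>\<theta>. f (point_of_angle \<theta>))) \<longlonglongrightarrow> integral\<^sup>L \<nu> (\<lambda>\<theta>. f (point_of_angle \<theta>))"
      using L B point_of_angle_in_ext
      by (intro weak_conv_imp_integral_bdd_continuous_conv[OF _ \<nu> wc cont, where B = B]) auto
    moreover have "integral\<^sup>L \<nu> (\<lambda>\<theta>. f (point_of_angle \<theta>)) = (LINT x:extended_real_line|\<sigma>. f x)"
      unfolding \<sigma>_def set_lebesgue_integral_def
      by (subst integral_distr[OF m\<nu> mg]) (simp add: point_of_angle_in_ext)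
    moreover have "integral\<^sup>L (L j) (\<lambda>\<theta>. f (point_of_angle \<theta>)) = (LINT x:extended_real_line|M j. f x)" for j
    proof -
      interpret ext_prob "M j" by (rule M)
      have "integral\<^sup>L (L j) (\<lambda>\<theta>. f (point_of_angle \<theta>)) = (LINT x|M j. f (point_of_angle (angle x)))"
        unfolding L_def by (rule integral_distr[OF mang mf])
      also have "\<dots> = (LINT x|M j. ?g x)"
      proof (rule integral_cong_ext)
        show "(\<lambda>x. f (point_of_angle (angle x))) \<in> borel_measurable sphere_borel"
          using angle_measurable mf by (rule measurable_compose)
      qed (use mg point_of_angle_angle in auto)
      finally show ?thesis by (simp add: set_lebesgue_integral_def)
    qed
    ultimately show "(\<lambda>k. LINT x:extended_real_line|M (r k). f x) \<longlonglongrightarrow> (LINT x:extended_real_line|\<sigma>. f x)" by simp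
  qed (use M \<sigma> in \<open>auto simp: ext_prob_iff\<close>)
  with r show ?thesis by blast
qed


section \<open>Free convolution powers as solutions of a functional equation\<close>

lemma stolz_cone_mono: "\<alpha> \<le> \<alpha>' \<Longrightarrow> \<beta>' \<le> \<beta> \<Longrightarrow> \<beta> \<ge> 0 \<Longrightarrow> stolz_cone \<alpha> \<beta> \<subseteq> stolz_cone \<alpha>' \<beta>'"
proof
  fix w assume *: "\<alpha> \<le> \<alpha>'" "\<beta>' \<le> \<beta>" "\<beta> \<ge> 0" "w \<in> stolz_cone \<alpha> \<beta>"
  then have "\<alpha> * Im w \<le> \<alpha>' * Im w" by (intro mult_right_mono) (auto simp: stolz_cone_def)
  moreover have "\<bar>Re w\<bar> < \<alpha> * Im w" "Im w > \<beta>'" using * by (auto simp: stolz_cone_def)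
  ultimately show "w \<in> stolz_cone \<alpha>' \<beta>'" unfolding stolz_cone_def by (blast intro: less_le_trans)
qed

lemma stolz_coneD: "w \<in> stolz_cone \<alpha> \<beta> \<Longrightarrow> \<beta> > 0 \<Longrightarrow> Im w > 0"
  by (auto simp: stolz_cone_def)

lemma open_stolz_cone: "open (stolz_cone \<alpha> \<beta>)"
  unfolding stolz_cone_def Collect_conj_eq by (intro open_Int open_Collect_less continuous_intros)

lemma stolz_cone_convex_combination:
  assumes "v \<in> stolz_cone \<alpha> \<beta>" "w \<in> stolz_cone \<alpha> \<beta>" "0 \<le> s" "s \<le> 1"
  shows "of_real s * v + of_real (1 - s) * w \<in> stolz_cone \<alpha> \<beta>"
proof -

  have im: "s * Im v + (1 - s) * Im w > \<beta>"
    using convex_bound_lt[of "- Im v" "- \<beta>" "- Im w" s "1 - s"] assms by (simp add: stolz_cone_def)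
  have "\<bar>s * Re v + (1 - s) * Re w\<bar> \<le> s * \<bar>Re v\<bar> + (1 - s) * \<bar>Re w\<bar>"
    using abs_triangle_ineq[of "s * Re v" "(1 - s) * Re w"] assms by (simp add: abs_mult)
  moreover have "s * (\<bar>Re v\<bar> - \<alpha> * Im v) + (1 - s) * (\<bar>Re w\<bar> - \<alpha> * Im w) < 0"
    using assms by (intro convex_bound_lt) (auto simp: stolz_cone_def)
  moreover have "s * (\<bar>Re v\<bar> - \<alpha> * Im v) + (1 - s) * (\<bar>Re w\<bar> - \<alpha> * Im w) =
      (s * \<bar>Re v\<bar> + (1 - s) * \<bar>Re w\<bar>) - \<alpha> * (s * Im v + (1 - s) * Im w)"
    by (simp add: algebra_simps)
  ultimately have "\<bar>s * Re v + (1 - s) * Re w\<bar> < \<alpha> * (s * Im v + (1 - s) * Im w)" by linarith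
  with im show ?thesis by (simp add: stolz_cone_def)
qed

lemma stolz_cone_norm: "w \<in> stolz_cone 1 \<beta> \<Longrightarrow> \<beta> > 0 \<Longrightarrow> norm w \<le> 2 * Im w"
  using cmod_le[of w] by (auto simp: stolz_cone_def)

text \<open>Probability measures carried by the real line, in terms of the previous locale.\<close>

locale real_prob = ext_prob +
  assumes no_mass_infinity: "measure M {None} = 0"
begin

text \<open>Counterexamples at all heights \<open>\<beta> = 1, 2, \<dots>\<close> would form a sequence contradicting
\<open>cauchy_transform_mult_tendsto\<close>.\<close>

lemma cauchy_transform_asymptotics:
  assumes "\<epsilon> > 0"
  shows "\<exists>\<beta>>0. \<forall>w \<in> stolz_cone 1 \<beta>. norm (w * cauchy_transform M w - 1) < \<epsilon>"
proof (rule ccontr)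
  assume "\<not> ?thesis"
  then have bad: "\<exists>w. w \<in> stolz_cone 1 \<beta> \<and> norm (w * cauchy_transform M w - 1) \<ge> \<epsilon>" if "\<beta> > 0" for \<beta>
    using that by (metis linorder_not_less)
  have "\<forall>k. \<exists>w. w \<in> stolz_cone 1 (real (Suc k)) \<and> norm (w * cauchy_transform M w - 1) \<ge> \<epsilon>"
    by (intro allI bad) (rule of_nat_0_less_iff[THEN iffD2, OF zero_less_Suc])
  then obtain w where w: "\<And>k. w k \<in> stolz_cone 1 (real (Suc k))" "\<And>k. norm (w k * cauchy_transform M (w k) - 1) \<ge> \<epsilon>"
    by metis
  have Im: "Im (w k) > real k" for k using w(1)[of k] by (simp add: stolz_cone_def)
  have "filterlim (\<lambda>k. Im (w k)) at_top sequentially"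
    by (rule filterlim_at_top_mono[OF filterlim_real_sequentially])
      (rule always_eventually, rule allI, rule less_imp_le, rule Im)
  moreover have "norm (w k) \<le> 2 * Im (w k)" "Im (w k) > 0" for k
    using stolz_cone_norm[OF w(1)] stolz_coneD[OF w(1)] of_nat_0_less_iff[THEN iffD2, OF zero_less_Suc] by blast+
  ultimately have "(\<lambda>k. w k * cauchy_transform M (w k)) \<longlonglongrightarrow> of_real (1 - measure M {None})"
    by (intro cauchy_transform_mult_tendsto(1)[where w = w and C = 2])
  then have "\<forall>\<^sub>F k in sequentially. dist (w k * cauchy_transform M (w k)) 1 < \<epsilon>"
    using assms by (intro tendstoD) (simp_all add: no_mass_infinity)
  then obtain k where "dist (w k * cauchy_transform M (w k)) 1 < \<epsilon>" by (auto dest: eventually_happens)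
  with w(2)[of k] show False by (simp add: dist_norm)
qed

text \<open>Two points \<open>v \<noteq> w\<close> with the same value make the integral of the product of their Cauchy kernels vanish,
whereas \<open>v w\<close> times this integral is close to 1 high up in the cone.\<close>

lemma cauchy_transform_inj_on_cone: "\<exists>\<beta>>0. inj_on (cauchy_transform M) (stolz_cone 1 \<beta>)"
proof (rule ccontr)
  assume "\<not> ?thesis"
  then have "\<forall>k. \<not> inj_on (cauchy_transform M) (stolz_cone 1 (real (Suc k)))"
    by (metis of_nat_0_less_iff zero_less_Suc)
  then have "\<forall>k. \<exists>v w. v \<in> stolz_cone 1 (real (Suc k)) \<and> w \<in> stolz_cone 1 (real (Suc k)) \<and> v \<noteq> w \<and>
      cauchy_transform M v = cauchy_transform M w"
    unfolding inj_on_def by blast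
  then obtain v w where vw: "\<And>k. v k \<in> stolz_cone 1 (real (Suc k))" "\<And>k. w k \<in> stolz_cone 1 (real (Suc k))"
    "\<And>k. v k \<noteq> w k" "\<And>k. cauchy_transform M (v k) = cauchy_transform M (w k)"
    by metis
  have Im: "Im (w k) > real k" "Im (v k) > real k" for k using vw(1,2)[of k] by (auto simp: stolz_cone_def)
  then have pos: "Im (v k) > 0" "Im (w k) > 0" for k using of_nat_0_le_iff[of k] by (meson le_less_trans)+
  have top: "filterlim (\<lambda>k. Im (v k)) at_top sequentially" "filterlim (\<lambda>k. Im (w k)) at_top sequentially"
  proof -
    show "filterlim (\<lambda>k. Im (v k)) at_top sequentially"
      by (rule filterlim_at_top_mono[OF filterlim_real_sequentially])
        (rule always_eventually, rule allI, rule less_imp_le, rule Im)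
    show "filterlim (\<lambda>k. Im (w k)) at_top sequentially"
      by (rule filterlim_at_top_mono[OF filterlim_real_sequentially])
        (rule always_eventually, rule allI, rule less_imp_le, rule Im)
  qed
  have "norm (v k) \<le> 2 * Im (v k)" "norm (w k) \<le> 2 * Im (w k)" for k
    using stolz_cone_norm[OF vw(1)] stolz_cone_norm[OF vw(2)] of_nat_0_less_iff[THEN iffD2, OF zero_less_Suc] by blast+
  then have "(\<lambda>k. v k * w k * (LINT x|M. cauchy_kernel (v k) x * cauchy_kernel (w k) x)) \<longlonglongrightarrow> of_real (1 - measure M {None})"
    using pos by (intro cauchy_transform_mult_tendsto(2)[OF top, where C = 2])
  moreover have "(LINT x|M. cauchy_kernel (v k) x * cauchy_kernel (w k) x) = 0" for k
    using cauchy_transform_diff[OF pos(1)[of k] pos(2)[of k]] vw(3,4)[of k] by simp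
  ultimately have "(\<lambda>k :: nat. 0) \<longlonglongrightarrow> (1 :: complex)" by (simp add: no_mass_infinity)
  then show False by (simp add: LIMSEQ_const_iff)
qed

text \<open>High up in the cone \<open>1 / G(w)\<close> is close to \<open>w\<close> relative to \<open>\<bar>w\<bar>\<close>. So \<open>w \<mapsto> \<zeta> + w - 1 / G(w)\<close> maps
the disc of radius \<open>\<bar>\<zeta>\<bar> / 10\<close> around \<open>\<zeta>\<close> into itself, and a fixed point given by Brouwer's theorem
satisfies \<open>G(w) = 1 / \<zeta>\<close>. The narrower and higher cone for \<open>\<zeta>\<close> ensures that this disc lies in the cone where the
estimate holds.\<close>

lemma cauchy_transform_covers_cone:
  assumes \<beta>: "\<beta> > 0" and close: "\<And>w. w \<in> stolz_cone 1 \<beta> \<Longrightarrow> norm (w * cauchy_transform M w - 1) < 1 / 20"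
    and \<zeta>: "\<zeta> \<in> stolz_cone (1/2) (2 * \<beta>)"
  shows "\<exists>w \<in> stolz_cone 1 \<beta>. cauchy_transform M w = 1 / \<zeta>"
proof -
  have I: "Im \<zeta> > 2 * \<beta>" "\<bar>Re \<zeta>\<bar> < Im \<zeta> / 2" using \<zeta> by (auto simp: stolz_cone_def)
  have n\<zeta>: "norm \<zeta> \<le> 3/2 * Im \<zeta>" using cmod_le[of \<zeta>] I \<beta> by linarith
  define e where "e = norm \<zeta> / 10"
  have \<zeta>0: "\<zeta> \<noteq> 0" using I \<beta> by auto
  then have e: "e > 0" by (simp add: e_def)
  have cone: "w \<in> stolz_cone 1 \<beta>" if "w \<in> cball \<zeta> e" for w
  proof -
    have d: "norm (w - \<zeta>) \<le> e" using that by (simp add: dist_norm norm_minus_commute)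
    have "\<bar>Im w - Im \<zeta>\<bar> \<le> e" "\<bar>Re w - Re \<zeta>\<bar> \<le> e"
      using abs_Im_le_cmod[of "w - \<zeta>"] abs_Re_le_cmod[of "w - \<zeta>"] d by auto
    moreover have "e \<le> 3/20 * Im \<zeta>" using n\<zeta> by (simp add: e_def)
    ultimately show ?thesis using I \<beta> by (simp add: stolz_cone_def) linarith
  qed
  have pos: "Im w > 0" if "w \<in> cball \<zeta> e" for w using cone[OF that] \<beta> by (rule stolz_coneD)
  have G0: "cauchy_transform M w \<noteq> 0" if "w \<in> cball \<zeta> e" for w
    using Im_cauchy_transform_neg[OF pos[OF that]] no_mass_infinity by auto
  have "continuous_on (cball \<zeta> e) (cauchy_transform M)"
    using continuous_cauchy_transform by (rule continuous_on_subset) (use pos in auto)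
  then have "continuous_on (cball \<zeta> e) (\<lambda>w. \<zeta> + w - 1 / cauchy_transform M w)"
    using G0 by (intro continuous_intros) auto
  moreover have "(\<lambda>w. \<zeta> + w - 1 / cauchy_transform M w) \<in> cball \<zeta> e \<rightarrow> cball \<zeta> e"
  proof
    fix w assume w: "w \<in> cball \<zeta> e"
    let ?a = "w * cauchy_transform M w"
    have a: "norm (?a - 1) < 1/20" using close cone[OF w] by blast
    then have a1: "norm ?a \<ge> 19/20" using norm_triangle_ineq2[of 1 "1 - ?a"] by (simp add: norm_minus_commute)
    have "norm w \<le> norm \<zeta> + e" using w norm_triangle_ineq2[of w \<zeta>] by (simp add: dist_norm norm_minus_commute)
    then have nw: "norm w \<le> 11 * e" by (simp add: e_def)
    have "w - 1 / cauchy_transform M w = w * (?a - 1) / ?a"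
    proof -
      have "w \<noteq> 0" using a1 by auto
      then show ?thesis using G0[OF w] by (simp add: divide_simps)
    qed
    then have "norm (w - 1 / cauchy_transform M w) = norm w * norm (?a - 1) / norm ?a"
      by (simp add: norm_mult norm_divide)
    also have "\<dots> \<le> (11 * e) * (1/20) / (19/20)"
      using a a1 nw e by (intro frac_le mult_mono mult_nonneg_nonneg) auto
    also have "\<dots> \<le> e" using e by simp
    finally show "\<zeta> + w - 1 / cauchy_transform M w \<in> cball \<zeta> e"
      by (simp add: dist_norm norm_minus_commute add_diff_eq[symmetric])
  qed
  ultimately obtain w where w: "w \<in> cball \<zeta> e" "\<zeta> + w - 1 / cauchy_transform M w = w"
    using brouwer_ball[OF e] by blast
  then have "\<zeta> = 1 / cauchy_transform M w" by (simp add: algebra_simps)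
  then show ?thesis using cone[OF w(1)] by (intro bexI[of _ w]) auto
qed

end

lemma real_probI:
  assumes "M \<in> prob_measures_on real_line"
  shows "real_prob M"
proof -
  have null: "emeasure M A = 0" if "A \<subseteq> - real_line" for A
  proof -
    have "- real_line \<in> sets M"
      using assms compl_sphere_borel[OF real_line_sphere_borel] by (simp add: prob_measures_on_def)
    from emeasure_mono[OF that this] show ?thesis using assms by (simp add: prob_measures_on_def)
  qed
  have "emeasure M (- extended_real_line) = 0" "emeasure M {None} = 0"
    by (rule null; auto simp: real_line_def extended_real_line_def)+
  then show ?thesis
    using assms
    by (simp add: prob_measures_on_def real_prob_def real_prob_axioms_def ext_prob_def ext_prob_axioms_def measure_def)
qed

lemma real_prob_iff: "real_prob M \<longleftrightarrow> M \<in> prob_measures_on real_line"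
proof
  assume "real_prob M"
  then interpret real_prob M .
  have "- real_line = {None} \<union> - extended_real_line" by (auto simp: real_line_def extended_real_line_def)
  moreover have "emeasure M ({None} \<union> - extended_real_line) \<le> emeasure M {None} + emeasure M (- extended_real_line)"
    using infinity_sphere_borel compl_extended_real_line by (intro emeasure_subadditive) auto
  moreover have "emeasure M {None} = 0" using no_mass_infinity by (simp add: emeasure_eq_measure)
  ultimately have "emeasure M (- real_line) = 0" using ext_M by (metis add_0 le_zero_eq)
  then show "M \<in> prob_measures_on real_line"
    using prob_space_axioms by (simp add: prob_measures_on_def)
qed (rule real_probI)

lemma map_option_measurable: "(\<lambda>x. f x) \<in> borel_measurable borel \<Longrightarrow> map_option f \<in> sphere_borel \<rightarrow>\<^sub>M sphere_borel"
  by (rule measurable_from_sphere) (auto intro: measurable_compose[OF _ measurable_Some_sphere])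

lemma cauchy_transform_dilation:
  assumes "ext_prob M" "t > 0"
  shows "cauchy_transform (distr M sphere_borel (map_option (\<lambda>x. of_real t * x))) (of_real t * z) = cauchy_transform M z / of_real t"
proof -
  interpret ext_prob M by fact
  have "map_option (\<lambda>x. of_real t * x) \<in> M \<rightarrow>\<^sub>M sphere_borel"
    using map_option_measurable[of "\<lambda>x. of_real t * x"] by simp
  then have "cauchy_transform (distr M sphere_borel (map_option (\<lambda>x. of_real t * x))) (of_real t * z)
     = (LINT x|M. cauchy_kernel (of_real t * z) (map_option (\<lambda>x. of_real t * x) x))"
    unfolding cauchy_transform_eq by (rule integral_distr) simp
  also have "\<dots> = (LINT x|M. cauchy_kernel z x / of_real t)"
  proof (rule Bochner_Integration.integral_cong[OF refl])
    fix x show "cauchy_kernel (of_real t * z) (map_option (\<lambda>x. of_real t * x) x) = cauchy_kernel z x / of_real t"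
      using assms(2) by (cases x) (auto simp: right_diff_distrib[symmetric])
  qed
  also have "\<dots> = cauchy_transform M z / of_real t" by (simp add: cauchy_transform_eq)
  finally show ?thesis .
qed

lemma real_prob_dilation:
  assumes "real_prob M" "t > 0"
  shows "real_prob (distr M sphere_borel (map_option (\<lambda>x. of_real t * x)))" (is "real_prob ?N")
proof -
  interpret real_prob M by fact
  have m: "map_option (\<lambda>x. of_real t * x) \<in> sphere_borel \<rightarrow>\<^sub>M sphere_borel"
    using map_option_measurable[of "\<lambda>x. of_real t * x"] by simp
  have "ext_prob ?N"
    by (rule ext_prob_distr[OF ext_prob_axioms m]) (auto simp: extended_real_line_def)
  moreover have "measure ?N {None} = 0"
  proof -
    have "map_option (\<lambda>x. complex_of_real t * x) -` {None} = {None}" by auto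
    then show ?thesis using m infinity_sphere_borel no_mass_infinity by (simp add: measure_distr)
  qed
  ultimately show ?thesis by (simp add: real_prob_def real_prob_axioms_def)
qed

text \<open>Let \<open>\<kappa>\<close> be the dilation of \<open>\<rho>\<close> by \<open>t\<close>, the candidate for the convolution power, so that
\<open>G\<^sub>\<kappa>(w) = G\<^sub>\<rho>(w / t) / t\<close>. If \<open>G\<^sub>\<kappa>(w) = 1 / \<zeta>\<close>, the functional equation at
\<open>z = w / t\<close> says \<open>G\<^sub>\<nu>(w') = 1 / \<zeta>\<close> for \<open>w' = w / t + (1 - 1 / t) \<zeta>\<close>, which means
\<open>w - \<zeta> = t (w' - \<zeta>)\<close>: this is the relation between the R-transforms at \<open>1 / \<zeta>\<close>. Moreover \<open>w'\<close> is a convex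
combination and remains in the cone. Conversely, the R-transform relation for another measure \<open>\<kappa>'\<close> gives back
the functional equation on a nonempty open set, where its solution is unique, so \<open>\<kappa>'\<close> and \<open>\<kappa>\<close> have the same
Cauchy transform there.\<close>

theorem free_flow_finite_eqI:
  assumes \<nu>: "real_prob \<nu>" and \<rho>: "real_prob \<rho>" and t: "t \<ge> 1"
    and FE: "\<And>z. Im z > 0 \<Longrightarrow>
      cauchy_transform \<rho> z / of_real t = cauchy_transform \<nu> (z + of_real (t - 1) / cauchy_transform \<rho> z)"
  shows "free_flow_finite t \<nu> = \<rho>"
proof -
  interpret \<nu>: real_prob \<nu> by fact
  interpret \<rho>: real_prob \<rho> by fact
  have t0: "t > 0" "t \<noteq> 0" using t by auto
  define \<kappa> where "\<kappa> = distr \<rho> sphere_borel (map_option (\<lambda>x. of_real t * x))"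
  have \<kappa>: "real_prob \<kappa>" unfolding \<kappa>_def by (rule real_prob_dilation[OF \<rho> t0(1)])
  interpret \<kappa>: real_prob \<kappa> by fact
  have G\<kappa>: "cauchy_transform \<rho> (w / of_real t) = of_real t * cauchy_transform \<kappa> w" for w
    using cauchy_transform_dilation[OF \<rho>.ext_prob_axioms t0(1), of "w / of_real t"] t0 by (simp add: \<kappa>_def)
  have scaled: "R_transforms_scaled t \<nu> \<kappa>"
  proof -
    obtain \<beta>1 where \<beta>1: "\<beta>1 > 0" "inj_on (cauchy_transform \<nu>) (stolz_cone 1 \<beta>1)"
      using \<nu>.cauchy_transform_inj_on_cone by blast
    obtain \<beta>2 where \<beta>2: "\<beta>2 > 0" "inj_on (cauchy_transform \<kappa>) (stolz_cone 1 \<beta>2)"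
      using \<kappa>.cauchy_transform_inj_on_cone by blast
    obtain \<beta>3 where \<beta>3: "\<beta>3 > 0" "\<forall>w \<in> stolz_cone 1 \<beta>3. norm (w * cauchy_transform \<kappa> w - 1) < 1/20"
      using \<kappa>.cauchy_transform_asymptotics[of "1/20"] by auto
    define \<beta> where "\<beta> = max \<beta>1 (max \<beta>2 \<beta>3)"
    have \<beta>: "\<beta> > 0" using \<beta>1 by (simp add: \<beta>_def less_max_iff_disj)
    let ?\<Gamma> = "stolz_cone 1 \<beta>"
    have sub: "?\<Gamma> \<subseteq> stolz_cone 1 \<beta>1" "?\<Gamma> \<subseteq> stolz_cone 1 \<beta>2" "?\<Gamma> \<subseteq> stolz_cone 1 \<beta>3"
      using \<beta> by (intro stolz_cone_mono; simp add: \<beta>_def)+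
    have inj: "inj_on (cauchy_transform \<nu>) ?\<Gamma>" "inj_on (cauchy_transform \<kappa>) ?\<Gamma>"
      using \<beta>1(2) \<beta>2(2) sub inj_on_subset by blast+
    have "1 / \<zeta> \<in> cauchy_transform \<nu> ` ?\<Gamma> \<inter> cauchy_transform \<kappa> ` ?\<Gamma> \<and>
        R_transform ?\<Gamma> \<kappa> (1 / \<zeta>) = of_real t * R_transform ?\<Gamma> \<nu> (1 / \<zeta>)"
      if \<zeta>: "\<zeta> \<in> stolz_cone (1/2) (2 * \<beta>)" for \<zeta>
    proof -
      have "\<zeta> \<in> ?\<Gamma>" using stolz_cone_mono[of "1/2" 1 \<beta> "2 * \<beta>"] \<zeta> \<beta> by auto
      then have \<zeta>0: "\<zeta> \<noteq> 0" using stolz_coneD[of \<zeta> 1 \<beta>] \<beta> by auto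
      obtain w where w: "w \<in> ?\<Gamma>" "cauchy_transform \<kappa> w = 1 / \<zeta>"
        using \<kappa>.cauchy_transform_covers_cone[OF \<beta> _ \<zeta>] \<beta>3(2) sub(3) by blast
      define w' where "w' = of_real (1 / t) * w + of_real (1 - 1 / t) * \<zeta>"
      have w'\<Gamma>: "w' \<in> ?\<Gamma>"
        unfolding w'_def using w(1) \<open>\<zeta> \<in> ?\<Gamma>\<close> t by (intro stolz_cone_convex_combination) auto
      have Imz: "Im (w / of_real t) > 0" using stolz_coneD[OF w(1) \<beta>] t0 by simp
      have "cauchy_transform \<rho> (w / of_real t) = of_real t / \<zeta>" using w(2) by (simp add: G\<kappa>)
      then have "1 / \<zeta> = cauchy_transform \<nu> (w / of_real t + of_real (t - 1) / (of_real t / \<zeta>))"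
        using FE[OF Imz] t0 by simp
      also have "w / of_real t + of_real (t - 1) / (of_real t / \<zeta>) = w'"
        using t0 by (simp add: w'_def field_simps)
      finally have w': "cauchy_transform \<nu> w' = 1 / \<zeta>" by simp
      have "R_transform ?\<Gamma> \<kappa> (1 / \<zeta>) = w - \<zeta>"
        using the_inv_into_f_eq[OF inj(2) w(2) w(1)] by (simp add: R_transform_def)
      moreover have "R_transform ?\<Gamma> \<nu> (1 / \<zeta>) = w' - \<zeta>"
        using the_inv_into_f_eq[OF inj(1) w' w'\<Gamma>] by (simp add: R_transform_def)
      moreover have "w - \<zeta> = of_real t * (w' - \<zeta>)" using t0 by (simp add: w'_def field_simps)
      ultimately show ?thesis using w w' w'\<Gamma> by (auto intro: rev_image_eqI)
    qed
    then show ?thesis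
      unfolding R_transforms_scaled_def Let_def using \<beta> inj
      by (intro exI[of _ 1] exI[of _ \<beta>] exI[of _ "1/2"] exI[of _ "2 * \<beta>"]) auto
  qed
  have unique: "\<kappa>' = \<kappa>" if \<kappa>': "\<kappa>' \<in> prob_measures_on real_line" "R_transforms_scaled t \<nu> \<kappa>'" for \<kappa>'
  proof -
    interpret \<kappa>': real_prob \<kappa>' using \<kappa>'(1) by (rule real_probI)
    obtain \<alpha> \<beta> \<alpha>' \<beta>' where pos: "\<alpha> > 0" "\<beta> > 0" "\<alpha>' > 0" "\<beta>' > 0"
      and inj: "inj_on (cauchy_transform \<nu>) (stolz_cone \<alpha> \<beta>)" "inj_on (cauchy_transform \<kappa>') (stolz_cone \<alpha> \<beta>)"
      and R: "\<And>\<zeta>. \<zeta> \<in> stolz_cone \<alpha>' \<beta>' \<Longrightarrow>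
         1 / \<zeta> \<in> cauchy_transform \<nu> ` stolz_cone \<alpha> \<beta> \<inter> cauchy_transform \<kappa>' ` stolz_cone \<alpha> \<beta> \<and>
         R_transform (stolz_cone \<alpha> \<beta>) \<kappa>' (1 / \<zeta>) = of_real t * R_transform (stolz_cone \<alpha> \<beta>) \<nu> (1 / \<zeta>)"
      using \<kappa>'(2) unfolding R_transforms_scaled_def Let_def by blast
    let ?\<Gamma> = "stolz_cone \<alpha> \<beta>"
    have G0: "Im (cauchy_transform \<kappa>' w) < 0" if "w \<in> ?\<Gamma>" for w
      using \<kappa>'.Im_cauchy_transform_neg[OF stolz_coneD[OF that pos(2)]] \<kappa>'.no_mass_infinity by simp
    define W where "W = ?\<Gamma> \<inter> (\<lambda>w. 1 / cauchy_transform \<kappa>' w) -` stolz_cone \<alpha>' \<beta>'"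
    have "continuous_on ?\<Gamma> (cauchy_transform \<kappa>')"
      using \<kappa>'.continuous_cauchy_transform by (rule continuous_on_subset) (use stolz_coneD[OF _ pos(2)] in auto)
    then have "continuous_on ?\<Gamma> (\<lambda>w. 1 / cauchy_transform \<kappa>' w)"
      using G0 by (intro continuous_intros ballI) (metis less_irrefl zero_complex.simps(2))+
    then have W: "open W"
      unfolding W_def by (intro continuous_open_preimage open_stolz_cone)
    have eqW: "cauchy_transform \<kappa>' w = cauchy_transform \<kappa> w" if "w \<in> W" for w
    proof -
      define \<zeta> where "\<zeta> = 1 / cauchy_transform \<kappa>' w"
      have w: "w \<in> ?\<Gamma>" "\<zeta> \<in> stolz_cone \<alpha>' \<beta>'" using that by (auto simp: W_def \<zeta>_def)
      have \<zeta>0: "\<zeta> \<noteq> 0" using stolz_coneD[OF w(2) pos(4)] by auto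
      have G: "cauchy_transform \<kappa>' w = 1 / \<zeta>" by (simp add: \<zeta>_def)
      obtain w' where w': "w' \<in> ?\<Gamma>" "cauchy_transform \<nu> w' = 1 / \<zeta>" using R[OF w(2)] by auto
      have "R_transform ?\<Gamma> \<kappa>' (1 / \<zeta>) = w - \<zeta>"
        using the_inv_into_f_eq[OF inj(2) G w(1)] by (simp add: R_transform_def)
      moreover have "R_transform ?\<Gamma> \<nu> (1 / \<zeta>) = w' - \<zeta>"
        using the_inv_into_f_eq[OF inj(1) w'(2) w'(1)] by (simp add: R_transform_def)
      ultimately have "w - \<zeta> = of_real t * (w' - \<zeta>)" using R[OF w(2)] by simp
      then have w'eq: "w' = w / of_real t + of_real (t - 1) / (of_real t / \<zeta>)"
        using t0 by (simp add: field_simps)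
      have Imz: "Im (w / of_real t) > 0" using stolz_coneD[OF w(1) pos(2)] t0 by simp
      have "of_real t * cauchy_transform \<kappa>' w = cauchy_transform \<rho> (w / of_real t)"
      proof (rule \<nu>.free_power_equation_unique[OF Imz t])
        show "measure \<nu> {None} < 1" by (simp add: \<nu>.no_mass_infinity)
        show "Im (of_real t * cauchy_transform \<kappa>' w) < 0" using G0[OF w(1)] t0 by (simp add: mult_pos_neg)
        show "of_real t * cauchy_transform \<kappa>' w / of_real t =
            cauchy_transform \<nu> (w / of_real t + of_real (t - 1) / (of_real t * cauchy_transform \<kappa>' w))"
          using t0 w'(2) unfolding w'eq by (simp add: G)
        show "Im (cauchy_transform \<rho> (w / of_real t)) < 0"
          using \<rho>.Im_cauchy_transform_neg[OF Imz] \<rho>.no_mass_infinity by simp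
        show "cauchy_transform \<rho> (w / of_real t) / of_real t =
            cauchy_transform \<nu> (w / of_real t + of_real (t - 1) / cauchy_transform \<rho> (w / of_real t))"
          by (rule FE[OF Imz])
      qed
      then show ?thesis using t0 by (simp add: G\<kappa>)
    qed
    obtain \<zeta>0 where \<zeta>0: "\<zeta>0 \<in> stolz_cone \<alpha>' \<beta>'"
    proof
      show "Complex 0 (\<beta>' + 1) \<in> stolz_cone \<alpha>' \<beta>'" using pos by (simp add: stolz_cone_def)
    qed
    then obtain w where w: "w \<in> ?\<Gamma>" "cauchy_transform \<kappa>' w = 1 / \<zeta>0" using R by (metis IntD2 imageE)
    then have "w \<in> W" using \<zeta>0 by (simp add: W_def)
    then obtain r where r: "r > 0" "ball w r \<subseteq> W" using W open_contains_ball by blast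
    show ?thesis
    proof (rule cauchy_transform_determines_measure[OF _ _ _ r(1)])
      show "ext_prob \<kappa>'" "ext_prob \<kappa>" by unfold_locales
      show "Im w > 0" using stolz_coneD[OF w(1) pos(2)] .
      fix v assume "norm (v - w) < r"
      then have "v \<in> W" using r(2) by (auto simp: dist_norm norm_minus_commute)
      then show "cauchy_transform \<kappa>' v = cauchy_transform \<kappa> v" by (rule eqW)
    qed
  qed
  have "free_power \<nu> t = \<kappa>"
    unfolding free_power_def
  proof (rule the_equality)
    show "\<kappa> \<in> prob_measures_on real_line \<and> R_transforms_scaled t \<nu> \<kappa>"
      using scaled \<kappa> by (simp add: real_prob_iff)
  next
    fix \<kappa>' assume "\<kappa>' \<in> prob_measures_on real_line \<and> R_transforms_scaled t \<nu> \<kappa>'"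
    then show "\<kappa>' = \<kappa>" using unique by blast
  qed
  then have "free_flow_finite t \<nu> = distr (distr \<rho> sphere_borel (map_option (\<lambda>x. of_real t * x))) sphere_borel (map_option (\<lambda>x. x / of_real t))"
    by (simp add: free_flow_finite_def \<kappa>_def)
  also have "\<dots> = distr \<rho> sphere_borel (map_option (\<lambda>x. x / of_real t) \<circ> map_option (\<lambda>x. of_real t * x))"
  proof (rule distr_distr)
    show "map_option (\<lambda>x. x / complex_of_real t) \<in> sphere_borel \<rightarrow>\<^sub>M sphere_borel"
      by (rule map_option_measurable) simp
    show "map_option (\<lambda>x. complex_of_real t * x) \<in> \<rho> \<rightarrow>\<^sub>M sphere_borel"
      using map_option_measurable[of "\<lambda>x. of_real t * x"] by simp
  qed
  also have "map_option (\<lambda>x. x / of_real t) \<circ> map_option (\<lambda>x. complex_of_real t * x) = (\<lambda>x. x)"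
    using t0 by (auto simp: fun_eq_iff option.map_comp o_def option.map_ident)
  also have "distr \<rho> sphere_borel (\<lambda>x. x) = \<rho>" by (rule distr_id2) simp
  finally show ?thesis .
qed


section \<open>Polar derivatives and Moebius transformations\<close>

lemma sum_mset_eq_sum_count:
  fixes f :: "'a \<Rightarrow> complex"
  assumes "finite S" "set_mset R \<subseteq> S"
  shows "(\<Sum>x\<in>#R. f x) = (\<Sum>x\<in>S. of_nat (count R x) * f x)"
  using assms(2)
proof (induction R)
  case (add y R)
  have "(\<Sum>x\<in>S. of_nat (count (add_mset y R) x) * f x) =
      (\<Sum>x\<in>S. of_nat (count R x) * f x + (if x = y then f x else 0))"
    by (intro sum.cong) (auto simp: algebra_simps)
  then show ?case using add assms(1) by (simp add: sum.distrib)
qed simp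

lemma replicate_mset_add: "replicate_mset (m + n) x = replicate_mset m x + replicate_mset n x"
  by (induction m) auto

lemma count_image_mset_inj: "inj f \<Longrightarrow> count (image_mset f M) (f x) = count M x"
  by (induction M) (auto dest: injD)

lemma integral_root_measure:
  fixes f :: "complex option \<Rightarrow> complex"
  assumes "n > 0" "degree p \<le> n" "f \<in> borel_measurable sphere_borel"
  shows "integral\<^sup>L (root_measure n p) f = (\<Sum>x\<in>#sphere_roots n p. f x) / of_nat n"
proof -
  let ?R = "sphere_roots n p"
  have s: "size ?R = n" by (rule size_sphere_roots[OF assms(2)])
  then have ne: "?R \<noteq> {#}" using assms(1) by auto
  have "integral\<^sup>L (root_measure n p) f = integral\<^sup>L (measure_pmf (pmf_of_multiset ?R)) f"
    unfolding root_measure_def using assms(3) by (subst integral_distr) auto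
  also have "\<dots> = (\<Sum>x\<in>set_mset ?R. pmf (pmf_of_multiset ?R) x *\<^sub>R f x)"
    by (rule integral_measure_pmf) (use ne in auto)
  also have "\<dots> = (\<Sum>x\<in>set_mset ?R. of_nat (count ?R x) * f x) / of_nat n"
    using ne s by (simp add: scaleR_conv_of_real sum_divide_distrib)
  also have "(\<Sum>x\<in>set_mset ?R. of_nat (count ?R x) * f x) = (\<Sum>x\<in>#?R. f x)"
    by (rule sum_mset_eq_sum_count[symmetric]) auto
  finally show ?thesis .
qed

lemma cauchy_transform_root_measure:
  assumes "n > 0" "degree q \<le> n" "poly q z \<noteq> 0"
  shows "cauchy_transform (root_measure n q) z = log_deriv q z / of_nat n"
  unfolding cauchy_transform_eq
  by (subst integral_root_measure[OF assms(1,2)])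
    (auto simp: sphere_roots_def log_deriv_eq_sum[OF assms(3)] image_mset.compositionality o_def)

lemma sets_root_measure [simp]: "sets (root_measure n p) = sets sphere_borel"
  by (simp add: root_measure_def)

lemma measurable_root_measure: "root_measure n p \<rightarrow>\<^sub>M N = sphere_borel \<rightarrow>\<^sub>M N"
  by (rule measurable_cong_sets) auto

lemma ext_prob_root_measure:
  assumes "n > 0" "degree p \<le> n" "set_mset (sphere_roots n p) \<subseteq> extended_real_line"
  shows "ext_prob (root_measure n p)"
proof -
  have "prob_space (root_measure n p)"
    unfolding root_measure_def by (rule measure_pmf.prob_space_distr) simp
  moreover have "emeasure (root_measure n p) (- extended_real_line) = 0"
  proof -
    have "emeasure (root_measure n p) (- extended_real_line) =
        ennreal (1 / n * (\<Sum>z\<in>#sphere_roots n p. indicator (- extended_real_line) z))"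
      by (rule emeasure_root_measure[OF assms(1,2) compl_extended_real_line])
    also have "(\<Sum>z\<in>#sphere_roots n p. indicator (- extended_real_line) z) = (\<Sum>z\<in>#sphere_roots n p. 0 :: real)"
      using assms(3) by (intro arg_cong[of _ _ sum_mset] image_mset_cong) auto
    finally show ?thesis by simp
  qed
  ultimately show ?thesis by (simp add: ext_prob_def ext_prob_axioms_def)
qed

lemma root_measure_image:
  assumes "n > 0" "degree p \<le> n" "degree q \<le> n"
    and h: "h \<in> sphere_borel \<rightarrow>\<^sub>M sphere_borel" "sphere_roots n q = image_mset h (sphere_roots n p)"
  shows "root_measure n q = distr (root_measure n p) sphere_borel h"
proof (rule measure_eqI)
  fix A assume "A \<in> sets (root_measure n q)"
  then have A: "A \<in> sets sphere_borel" by simp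
  have h': "h \<in> root_measure n p \<rightarrow>\<^sub>M sphere_borel" using h(1) by (simp only: measurable_root_measure)
  have hA: "h -` A \<in> sets sphere_borel" using measurable_sets[OF h(1) A] by simp
  have "space (root_measure n p) = UNIV" using sets_eq_imp_space_eq[OF sets_root_measure] by simp
  then have "emeasure (distr (root_measure n p) sphere_borel h) A = emeasure (root_measure n p) (h -` A)"
    using A h' by (simp add: emeasure_distr)
  also have "\<dots> = ennreal (1 / n * (\<Sum>z\<in>#sphere_roots n p. indicator (h -` A) z))"
    by (rule emeasure_root_measure[OF assms(1,2) hA])
  also have "\<dots> = emeasure (root_measure n q) A"
  proof -
    have "indicator (h -` A) = (\<lambda>z. indicator A (h z) :: real)" by (auto simp: indicator_def fun_eq_iff)
    then show ?thesis
      by (simp add: emeasure_root_measure[OF assms(1,3) A] h(2) image_mset.compositionality o_def)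
  qed
  finally show "emeasure (root_measure n q) A = emeasure (distr (root_measure n p) sphere_borel h) A" ..
qed simp

lemma inv_to_infinity:
  "inv (to_infinity (Some c)) = (\<lambda>w. case w of None \<Rightarrow> Some c | Some v \<Rightarrow> if v = 0 then None else Some (c + 1 / v))"
  (is "_ = ?g")
proof (rule inv_unique_comp)
  show "to_infinity (Some c) \<circ> ?g = id"
    by (rule ext, rename_tac x, case_tac x) auto
  show "?g \<circ> to_infinity (Some c) = id"
    by (rule ext, rename_tac x, case_tac x) auto
qed

lemma to_infinity_None_eq: "to_infinity None = (\<lambda>x. x)"
  by auto

lemma to_infinity_measurable [measurable]: "to_infinity a \<in> sphere_borel \<rightarrow>\<^sub>M sphere_borel"
proof (cases a)
  case (Some c)
  have "(\<lambda>z. Some (1 / (z - c))) \<in> borel \<rightarrow>\<^sub>M sphere_borel"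
    by (rule measurable_compose[OF _ measurable_Some_sphere]) measurable
  then have "(\<lambda>z. to_infinity (Some c) (Some z)) \<in> borel \<rightarrow>\<^sub>M sphere_borel"
    unfolding to_infinity.simps by (intro measurable_If) auto
  then show ?thesis unfolding Some by (rule measurable_from_sphere) simp
qed (simp add: to_infinity_None_eq)

lemma inv_to_infinity_measurable [measurable]: "inv (to_infinity a) \<in> sphere_borel \<rightarrow>\<^sub>M sphere_borel"
proof (cases a)
  case None
  have "inv (\<lambda>x. x) = (\<lambda>x :: complex option. x)" using inv_id by (simp add: id_def)
  then show ?thesis by (simp add: None to_infinity_None_eq)
next
  case (Some c)
  have "(\<lambda>z. Some (c + 1 / z)) \<in> borel \<rightarrow>\<^sub>M sphere_borel"
    by (rule measurable_compose[OF _ measurable_Some_sphere]) measurable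
  then have "(\<lambda>v. if v = 0 then None else Some (c + 1 / v)) \<in> borel \<rightarrow>\<^sub>M sphere_borel"
    by (intro measurable_If) auto
  then show ?thesis unfolding Some inv_to_infinity by (intro measurable_from_sphere) auto
qed

lemma to_infinity_ext:
  assumes "a \<in> extended_real_line" "x \<in> extended_real_line"
  shows "to_infinity a x \<in> extended_real_line" "inv (to_infinity a) x \<in> extended_real_line"
proof -
  show "to_infinity a x \<in> extended_real_line"
    using assms(1)
  proof (cases rule: ext_real_cases)
    case a: (2 c)
    from assms(2) show ?thesis
    proof (cases rule: ext_real_cases)
      case (2 r)
      then show ?thesis using a by (cases "r = c") (auto simp: extended_real_line_def)
    qed (simp add: a extended_real_line_def)
  qed (simp add: assms(2) to_infinity_None_eq)
  have inv1: "inv (\<lambda>x. x) = (\<lambda>x :: complex option. x)" using inv_id by (simp add: id_def)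
  show "inv (to_infinity a) x \<in> extended_real_line"
    using assms(1)
  proof (cases rule: ext_real_cases)
    case a: (2 c)
    from assms(2) show ?thesis
    proof (cases rule: ext_real_cases)
      case (2 r)
      then show ?thesis using a by (cases "r = 0") (auto simp: extended_real_line_def inv_to_infinity)
    qed (simp add: a extended_real_line_def inv_to_infinity)
  qed (simp add: assms(2) to_infinity_None_eq inv1)
qed

text \<open>The case \<open>b = 0\<close> is \<open>to_infinity\<close>, the case \<open>a = 0\<close> its inverse. The limit \<open>L\<close> at infinity and the value at the
pole \<open>a\<close> are exchanged.\<close>

lemma continuous_real_moebius:
  fixes F :: "real \<Rightarrow> real" and a b :: real
  assumes F: "continuous_on UNIV F" "(F \<longlongrightarrow> L) at_infinity"
  defines "H \<equiv> \<lambda>x. if x = a then L else F (b + 1 / (x - a))"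
  shows "continuous_on UNIV H" "(H \<longlongrightarrow> F b) at_infinity"
proof -
  have isF: "isCont F x" for x using F(1) by (simp add: continuous_on_eq_continuous_at)
  have "isCont H x" for x
  proof (cases "x = a")
    case False
    have "isCont (\<lambda>x. F (b + 1 / (x - a))) x"
      using False by (intro isCont_o2[OF _ isF] continuous_intros) auto
    moreover have "\<forall>\<^sub>F y in nhds x. y \<noteq> a" using False by (rule t1_space_nhds)
    then have "\<forall>\<^sub>F y in nhds x. H y = F (b + 1 / (y - a))" by eventually_elim (simp add: H_def)
    ultimately show ?thesis by (simp add: isCont_cong)
  next
    case True
    have "((\<lambda>y. y - a) \<longlongrightarrow> a - a) (at a)" by (intro tendsto_diff tendsto_ident_at tendsto_const)
    then have "filterlim (\<lambda>y. y - a) (at 0) (at a)" by (simp add: filterlim_at eventually_at_filter)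
    then have "filterlim (\<lambda>y. 1 / (y - a)) at_infinity (at a)"
      by (intro filterlim_divide_at_infinity[OF tendsto_const]) auto
    then have "filterlim (\<lambda>y. b + 1 / (y - a)) at_infinity (at a)"
      by (rule tendsto_add_filterlim_at_infinity[OF tendsto_const])
    then have "((\<lambda>y. F (b + 1 / (y - a))) \<longlongrightarrow> L) (at a)" by (rule filterlim_compose[OF F(2)])
    moreover have "\<forall>\<^sub>F y in at a. F (b + 1 / (y - a)) = H y" by (simp add: H_def eventually_at_filter)
    ultimately have "(H \<longlongrightarrow> L) (at a)" by (rule Lim_transform_eventually)
    then show ?thesis using True by (simp add: isCont_def H_def)
  qed
  then show "continuous_on UNIV H" by (simp add: continuous_on_eq_continuous_at)
  have "filterlim (\<lambda>y :: real. - a + y) at_infinity at_infinity"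
    by (intro tendsto_add_filterlim_at_infinity[OF tendsto_const] filterlim_ident)
  then have "filterlim (\<lambda>y. y - a) at_infinity at_infinity" by simp
  then have "((\<lambda>y. 1 / (y - a)) \<longlongrightarrow> 0) at_infinity" by (rule tendsto_divide_0[OF tendsto_const])
  then have "((\<lambda>y. b + 1 / (y - a)) \<longlongrightarrow> b + 0) at_infinity" by (intro tendsto_add tendsto_const)
  then have "((\<lambda>y. F (b + 1 / (y - a))) \<longlongrightarrow> F b) at_infinity"
    using isCont_tendsto_compose[OF isF] by fastforce
  moreover have "\<forall>\<^sub>F y in at_infinity. F (b + 1 / (y - a)) = H y"
    unfolding eventually_at_infinity by (intro exI[of _ "\<bar>a\<bar> + 1"]) (auto simp: H_def)
  ultimately show "(H \<longlongrightarrow> F b) at_infinity" by (rule Lim_transform_eventually)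
qed

lemma ext_continuous_to_infinity:
  fixes f :: "complex option \<Rightarrow> real"
  assumes a: "a \<in> extended_real_line"
    and f: "ext_continuous f"
  shows "ext_continuous (\<lambda>x. f (to_infinity a x))"
    and "ext_continuous (\<lambda>x. f (inv (to_infinity a) x))"
proof -
  let ?F = "\<lambda>x :: real. f (Some (of_real x))"
  have F: "continuous_on UNIV ?F" "(?F \<longlongrightarrow> f None) at_infinity" using f by (auto simp: ext_continuous_iff)
  have inv1: "inv (\<lambda>x. x) = (\<lambda>x :: complex option. x)" using inv_id by (simp add: id_def)
  from a show "ext_continuous (\<lambda>x. f (to_infinity a x))"
  proof (cases rule: ext_real_cases)
    case (2 c)
    have "f (to_infinity a (Some (of_real x))) = (if x = c then f None else ?F (0 + 1 / (x - c)))" for x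
      using 2 by simp
    then show ?thesis using continuous_real_moebius[OF F, of c 0] 2 by (simp add: ext_continuous_iff)
  qed (simp add: f to_infinity_None_eq)
  from a show "ext_continuous (\<lambda>x. f (inv (to_infinity a) x))"
  proof (cases rule: ext_real_cases)
    case (2 c)
    have "f (inv (to_infinity a) (Some (of_real x))) = (if x = 0 then f None else ?F (c + 1 / (x - 0)))" for x
      using 2 by (simp add: inv_to_infinity)
    then show ?thesis using continuous_real_moebius[OF F, of 0 c] 2 by (simp add: ext_continuous_iff inv_to_infinity)
  qed (simp add: f to_infinity_None_eq inv1)
qed

lemma sphere_roots_mult:
  assumes "p \<noteq> 0" "q \<noteq> 0" "degree p \<le> k" "degree q \<le> l"
  shows "sphere_roots (k + l) (p * q) = sphere_roots k p + sphere_roots l q"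
proof -
  have "k + l - degree (p * q) = (k - degree p) + (l - degree q)"
    using assms by (simp add: degree_mult_eq)
  then show ?thesis
    unfolding sphere_roots_def proots_mult[OF assms(1,2)] by (simp only: image_mset_union replicate_mset_add add_ac)
qed

lemma sphere_roots_smult: "c \<noteq> 0 \<Longrightarrow> sphere_roots n (smult c p) = sphere_roots n p"
  by (simp add: sphere_roots_def)

text \<open>The substitution turns a factor \<open>w - l\<close> into \<open>(1 + (c - l) x) / x\<close>, and \<open>1 + (c - l) x\<close> has its root at
\<open>1 / (l - c)\<close>; for \<open>l = c\<close> its degree drops, which is a root at infinity.\<close>

lemma moebius_linear_factors:
  fixes c :: complex and R :: "complex multiset"
  defines "P \<equiv> (\<Prod>l\<in>#R. [:1, c - l:])"
  shows "P \<noteq> 0 \<and> degree P \<le> size R \<and>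
    sphere_roots (size R) P = image_mset (to_infinity (Some c)) (image_mset Some R) \<and>
    (\<forall>x. x \<noteq> 0 \<longrightarrow> poly P x = x ^ size R * poly (\<Prod>l\<in>#R. [:-l, 1:]) (c + 1 / x))"
  unfolding P_def
proof (induction R)
  case empty
  show ?case by (simp add: sphere_roots_def)
next
  case (add l R)
  let ?P = "\<Prod>l\<in>#R. [:1, c - l:]" and ?f = "[:1, c - l:]" and ?Q = "\<Prod>l\<in>#R. [:-l, 1:]"
  have P0: "?P \<noteq> 0" and d: "degree ?P \<le> size R"
    and roots: "sphere_roots (size R) ?P = image_mset (to_infinity (Some c)) (image_mset Some R)"
    and val: "\<And>x. x \<noteq> 0 \<Longrightarrow> poly ?P x = x ^ size R * poly ?Q (c + 1 / x)"
    using add.IH by auto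
  have f: "?f \<noteq> 0" "degree ?f \<le> 1" by simp_all
  have prod: "(\<Prod>l\<in>#add_mset l R. [:1, c - l:]) = ?f * ?P" by (simp only: image_mset_add_mset prod_mset.add_mset)
  have ne: "?f * ?P \<noteq> 0" using P0 f(1) by (simp only: mult_eq_0_iff) simp
  have deg: "degree (?f * ?P) \<le> size (add_mset l R)"
    using d f(2) unfolding degree_mult_eq[OF f(1) P0] by simp
  have rl: "sphere_roots 1 ?f = {#to_infinity (Some c) (Some l)#}"
  proof (cases "l = c")
    case False
    have "?f = smult (c - l) [:- (1 / (l - c)), 1:]" using False by (simp add: field_simps)
    then have "sphere_roots 1 ?f = sphere_roots 1 [:- (1 / (l - c)), 1:]"
      using False by (simp only: sphere_roots_smult right_minus_eq not_sym)
    then show ?thesis using False unfolding sphere_roots_def proots_linear_factor by simp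
  qed (simp add: sphere_roots_def)
  have "sphere_roots (size (add_mset l R)) (?f * ?P) = sphere_roots 1 ?f + sphere_roots (size R) ?P"
    using sphere_roots_mult[OF f(1) P0 f(2) d] by simp
  also have "\<dots> = image_mset (to_infinity (Some c)) (image_mset Some (add_mset l R))"
    unfolding rl roots by (simp del: to_infinity.simps)
  finally have 1: "sphere_roots (size (add_mset l R)) (?f * ?P) =
      image_mset (to_infinity (Some c)) (image_mset Some (add_mset l R))" .
  have 2: "poly (?f * ?P) x = x ^ size (add_mset l R) * poly (\<Prod>l\<in>#add_mset l R. [:-l, 1:]) (c + 1 / x)"
    if "x \<noteq> 0" for x
  proof -
    have "poly (?f * ?P) x = (1 + x * (c - l)) * (x ^ size R * poly ?Q (c + 1 / x))"
      by (simp only: poly_mult val[OF that]) simp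
    also have "1 + x * (c - l) = x * (c + 1 / x - l)" using that by (simp add: field_simps)
    also have "x * (c + 1 / x - l) * (x ^ size R * poly ?Q (c + 1 / x)) =
        x ^ size (add_mset l R) * (poly [:-l, 1:] (c + 1 / x) * poly ?Q (c + 1 / x))"
      by simp
    finally show ?thesis by (simp only: image_mset_add_mset prod_mset.add_mset poly_mult)
  qed
  show ?case unfolding prod using ne 1 2 deg by blast
qed

text \<open>The polynomials represent the same form of degree \<open>n\<close> in the coordinates \<open>w = c + 1 / x\<close> and \<open>x\<close>. The point
\<open>x = 0\<close> corresponds to \<open>w = \<infinity>\<close>, and the values at the other points determine the polynomials.\<close>

definition moebius_related :: "complex \<Rightarrow> nat \<Rightarrow> complex poly \<Rightarrow> complex poly \<Rightarrow> bool" where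
  "moebius_related c n p q \<longleftrightarrow> (\<forall>x. x \<noteq> 0 \<longrightarrow> poly q x = x ^ n * poly p (c + 1 / x))"

lemma moebius_related_unique:
  assumes "moebius_related c n p q" "moebius_related c n p q'"
  shows "q = q'"
proof (rule ccontr)
  assume "q \<noteq> q'"
  then have "finite {x. poly (q - q') x = 0}" by (intro poly_roots_finite) simp
  moreover have "UNIV - {0} \<subseteq> {x. poly (q - q') x = 0}" using assms by (auto simp: moebius_related_def)
  ultimately have "finite (UNIV - {0 :: complex})" by (rule finite_subset[rotated])
  then show False using infinite_UNIV_char_0[where 'a = complex] by simp
qed

lemma moebius_related_exists:
  assumes "p \<noteq> 0" "degree p \<le> n"
  obtains q where "moebius_related c n p q" "q \<noteq> 0" "degree q \<le> n"
    "sphere_roots n q = image_mset (to_infinity (Some c)) (sphere_roots n p)"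
proof -
  let ?R = "proots p"
  let ?P = "\<Prod>l\<in>#?R. [:1, c - l:]" and ?X = "monom (1 :: complex) (n - degree p)"
  note P = moebius_linear_factors[where R = ?R and c = c]
  have s: "size ?R = degree p" by (rule size_proots_complex)
  have X0: "?X \<noteq> 0" by simp
  have P0: "?P \<noteq> 0" and dP: "degree ?P \<le> degree p" using P s by auto
  have lc: "lead_coeff p \<noteq> 0" using assms by simp
  have "proots ?X = replicate_mset (n - degree p) 0"
    unfolding monom_altdef using proots_linear_factor[of "0 :: complex"] by (simp add: proots_power)
  then have rX: "sphere_roots (n - degree p) ?X = replicate_mset (n - degree p) (Some 0)"
    by (simp add: sphere_roots_def degree_monom_eq)
  define q where "q = smult (lead_coeff p) (?P * ?X)"
  show ?thesis
  proof (rule that)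
    show "moebius_related c n p q"
      unfolding moebius_related_def
    proof (intro allI impI)
      fix x :: complex assume x: "x \<noteq> 0"
      have "poly q x = lead_coeff p * (x ^ degree p * poly (\<Prod>l\<in>#?R. [:-l, 1:]) (c + 1 / x) * x ^ (n - degree p))"
        using P x s by (simp add: q_def poly_monom)
      also have "\<dots> = (x ^ degree p * x ^ (n - degree p)) * poly (smult (lead_coeff p) (\<Prod>l\<in>#?R. [:-l, 1:])) (c + 1 / x)"
        by simp
      also have "smult (lead_coeff p) (\<Prod>l\<in>#?R. [:-l, 1:]) = p" by (rule complex_poly_decompose_multiset)
      also have "x ^ degree p * x ^ (n - degree p) = x ^ n" using assms(2) by (simp flip: power_add)
      finally show "poly q x = x ^ n * poly p (c + 1 / x)" .
    qed
    show "q \<noteq> 0" unfolding q_def using lc P0 X0 by (simp only: smult_eq_0_iff mult_eq_0_iff) simp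
    have "degree q = degree ?P + (n - degree p)"
      unfolding q_def using lc by (simp only: degree_smult_eq degree_mult_eq[OF P0 X0]) (simp add: degree_monom_eq)
    then show "degree q \<le> n" using dP assms(2) by simp
    have "sphere_roots (degree p + (n - degree p)) q = sphere_roots (degree p) ?P + sphere_roots (n - degree p) ?X"
      unfolding q_def sphere_roots_smult[OF lc]
      by (rule sphere_roots_mult[OF P0 X0 dP]) (simp add: degree_monom_eq)
    also have "sphere_roots (degree p) ?P = image_mset (to_infinity (Some c)) (image_mset Some ?R)"
      using P s by metis
    finally show "sphere_roots n q = image_mset (to_infinity (Some c)) (sphere_roots n p)"
      using assms(2) unfolding rX by (simp add: sphere_roots_def)
  qed
qed

text \<open>With \<open>w = c + 1 / x\<close> one has \<open>w - c = 1 / x\<close>, and the derivative of \<open>x^n p(w)\<close> is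
\<open>x^(n - 1) (n p(w) - (w - c) p'(w))\<close>.\<close>

lemma moebius_related_polar_deriv:
  assumes pq: "moebius_related c n p q" and n: "n > 0"
  shows "moebius_related c (n - 1) (polar_deriv (Some c) n p) (pderiv q)"
  unfolding moebius_related_def
proof (intro allI impI)
  fix x :: complex assume x: "x \<noteq> 0"
  obtain k where k: "n = Suc k" using n by (cases n) auto
  let ?w = "c + 1 / x"
  have "((\<lambda>y. c + 1 / y) has_field_derivative - (1 / x^2)) (at x)"
    using x by (auto intro!: derivative_eq_intros simp: power2_eq_square)
  from DERIV_chain2[OF poly_DERIV this]
  have "((\<lambda>y. poly p (c + 1 / y)) has_field_derivative poly (pderiv p) ?w * - (1 / x^2)) (at x)" .
  from DERIV_mult[OF DERIV_power[OF DERIV_ident, of n x] this]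
  have "((\<lambda>y. y ^ n * poly p (c + 1 / y)) has_field_derivative
      of_nat n * x ^ (n - Suc 0) * poly p ?w + poly (pderiv p) ?w * - (1 / x^2) * x ^ n) (at x)"
    by simp
  then have "(poly q has_field_derivative
      of_nat n * x ^ (n - Suc 0) * poly p ?w + poly (pderiv p) ?w * - (1 / x^2) * x ^ n) (at x)"
    by (rule has_field_derivative_transform_within_open[where S = "- {0}"])
      (use x pq in \<open>auto simp: moebius_related_def\<close>)
  then have "poly (pderiv q) x = of_nat n * x ^ (n - Suc 0) * poly p ?w + poly (pderiv p) ?w * - (1 / x^2) * x ^ n"
    using DERIV_unique poly_DERIV by blast
  also have "\<dots> = x ^ (n - 1) * poly (polar_deriv (Some c) n p) ?w"
    using x by (simp add: polar_deriv_def k power2_eq_square field_simps)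
  finally show "poly (pderiv q) x = x ^ (n - 1) * poly (polar_deriv (Some c) n p) (c + 1 / x)" .
qed

lemma degree_polar_deriv:
  assumes "degree p \<le> n" "n > 0"
  shows "degree (polar_deriv a n p) \<le> n - 1"
proof (cases a)
  case None
  then show ?thesis using assms by (simp add: polar_deriv_def degree_pderiv)
next
  case (Some c)
  show ?thesis
  proof (rule degree_le, intro allI impI)
    fix i assume i: "n - 1 < i"
    then obtain j where j: "i = Suc j" using assms(2) by (cases i) auto
    have "coeff (polar_deriv a n p) i = of_nat n * coeff p i - (- c * (of_nat (Suc i) * coeff p (Suc i)) + of_nat i * coeff p i)"
      by (simp add: Some polar_deriv_def j coeff_pderiv)
    also have "coeff p (Suc i) = 0" using i assms by (intro coeff_eq_0) simp
    also have "of_nat n * coeff p i - (- c * (of_nat (Suc i) * 0) + of_nat i * coeff p i) = (of_nat n - of_nat i) * coeff p i"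
      by (simp add: algebra_simps)
    also have "\<dots> = 0" using i assms by (cases "i = n") (auto intro!: coeff_eq_0)
    finally show "coeff (polar_deriv a n p) i = 0" .
  qed
qed

lemma degree_polar_deriv_iter:
  "degree p \<le> n \<Longrightarrow> K \<le> n \<Longrightarrow> degree (polar_deriv_iter a K n p) \<le> n - K"
proof (induction K arbitrary: n p)
  case (Suc K)
  have "degree (polar_deriv_iter a K (n - 1) (polar_deriv a n p)) \<le> n - 1 - K"
    using Suc.prems by (intro Suc.IH degree_polar_deriv) auto
  then show ?case by simp
qed simp

lemma moebius_related_polar_deriv_iter:
  "moebius_related c n p q \<Longrightarrow> K \<le> n \<Longrightarrow>
   moebius_related c (n - K) (polar_deriv_iter (Some c) K n p) ((pderiv ^^ K) q)"
proof (induction K arbitrary: n p q)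
  case (Suc K)
  have "moebius_related c (n - 1 - K) (polar_deriv_iter (Some c) K (n - 1) (polar_deriv (Some c) n p)) ((pderiv ^^ K) (pderiv q))"
    using Suc.prems by (intro Suc.IH moebius_related_polar_deriv) auto
  then show ?case by (simp only: higher_pderiv_Suc polar_deriv_iter.simps) simp
qed simp

lemma polar_deriv_iter_None: "polar_deriv_iter None K n p = (pderiv ^^ K) p"
  by (induction K arbitrary: n p) (simp_all add: higher_pderiv_Suc polar_deriv_def del: funpow.simps(2))

lemma count_sphere_roots_None:
  "count (sphere_roots n q) None = n - degree q"
proof -
  have "count (image_mset Some M) None = 0" for M :: "complex multiset" by (induction M) auto
  then show ?thesis by (simp add: sphere_roots_def)
qed

text \<open>The multiplicity of \<open>a\<close> as a root of \<open>p\<close> is the degree defect of \<open>q\<close>. Bounding it by \<open>m\<close> means that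
\<open>n - m\<close> differentiations do not annihilate \<open>q\<close>, nor even make it constant.\<close>

lemma polar_derivative_as_derivative:
  assumes a: "a \<in> extended_real_line" and p: "p \<in> polys_with_roots_in n extended_real_line"
    and m: "0 < m" "m \<le> n" and cnt: "count (sphere_roots n p) a < m"
  obtains q where "real_rooted q" "degree q \<le> n" "degree q > n - m"
    "root_measure n q = distr (root_measure n p) sphere_borel (to_infinity a)"
    "root_measure m (polar_deriv_down a m n p) =
       distr (root_measure m ((pderiv ^^ (n - m)) q)) sphere_borel (inv (to_infinity a))"
proof -
  have p0: "p \<noteq> 0" and dp: "degree p \<le> n" and rp: "set_mset (sphere_roots n p) \<subseteq> extended_real_line"
    using p by (auto simp: polys_with_roots_in_def)
  have n: "n > 0" using m by simp
  have rr: "real_rooted q" if "q \<noteq> 0" "set_mset (sphere_roots n q) \<subseteq> extended_real_line" for q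
    unfolding real_rooted_def
  proof (intro conjI allI impI)
    fix x assume "poly q x = 0"
    then have "Some x \<in># sphere_roots n q" using that(1) by (simp add: sphere_roots_def)
    then show "x \<in> \<real>" using that(2) by (auto simp: extended_real_line_def)
  qed (rule that)
  show ?thesis
  proof (cases a)
    case None
    have "inv (\<lambda>x. x) = (\<lambda>x :: complex option. x)" using inv_id by (simp add: id_def)
    moreover have "degree p > n - m" using cnt dp m unfolding None count_sphere_roots_None by linarith
    ultimately show ?thesis using that[of p] rr[OF p0 rp] dp
      by (simp add: None to_infinity_None_eq polar_deriv_down_def polar_deriv_iter_None distr_id2)
  next
    case (Some c)
    let ?T = "to_infinity (Some c)" and ?K = "n - m"
    obtain q where q: "moebius_related c n p q" "q \<noteq> 0" "degree q \<le> n"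
      "sphere_roots n q = image_mset ?T (sphere_roots n p)"
      using moebius_related_exists[OF p0 dp] by blast
    have inj: "inj ?T" using bij_to_infinity bij_is_inj by blast
    have "set_mset (sphere_roots n q) \<subseteq> extended_real_line"
      using rp to_infinity_ext(1)[OF a] by (auto simp: q(4) Some)
    then have q_real: "real_rooted q" using q(2) rr by blast
    have "count (sphere_roots n q) (?T (Some c)) = count (sphere_roots n p) (Some c)"
      unfolding q(4) by (rule count_image_mset_inj[OF inj])
    then have dq: "degree q > ?K" using cnt m by (simp add: count_sphere_roots_None Some)
    let ?p = "polar_deriv_down a m n p" and ?q = "(pderiv ^^ ?K) q"
    have rel: "moebius_related c m ?p ?q"
      using moebius_related_polar_deriv_iter[OF q(1), of ?K] m by (simp add: polar_deriv_down_def Some)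
    have q'0: "?q \<noteq> 0" using real_rooted_higher_pderiv[OF q_real dq] by (simp add: real_rooted_def)
    have p'0: "?p \<noteq> 0"
    proof
      assume "?p = 0"
      then have "moebius_related c m ?p 0" by (simp add: moebius_related_def)
      with rel have "?q = 0" by (rule moebius_related_unique)
      with q'0 show False by simp
    qed
    have dp': "degree ?p \<le> m"
      using degree_polar_deriv_iter[OF dp, of ?K a] m by (simp add: polar_deriv_down_def)
    obtain q' where q': "moebius_related c m ?p q'" "degree q' \<le> m"
      "sphere_roots m q' = image_mset ?T (sphere_roots m ?p)"
      using moebius_related_exists[OF p'0 dp'] by blast
    have eq: "q' = ?q" using q'(1) rel by (rule moebius_related_unique)
    have "root_measure m ?q = distr (root_measure m ?p) sphere_borel ?T"
      using q' m dp' by (intro root_measure_image) (auto simp: eq)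
    then have "distr (root_measure m ?q) sphere_borel (inv ?T) = distr (distr (root_measure m ?p) sphere_borel ?T) sphere_borel (inv ?T)"
      by simp
    also have "\<dots> = distr (root_measure m ?p) sphere_borel (inv ?T \<circ> ?T)"
      by (intro distr_distr) (simp_all only: measurable_root_measure to_infinity_measurable inv_to_infinity_measurable)
    also have "inv ?T \<circ> ?T = (\<lambda>x. x)" using inj by (simp add: inv_o_cancel id_def)
    also have "distr (root_measure m ?p) sphere_borel (\<lambda>x. x) = root_measure m ?p" by (rule distr_id2) simp
    finally have 2: "root_measure m ?p = distr (root_measure m ?q) sphere_borel (inv ?T)" ..
    have "root_measure n q = distr (root_measure n p) sphere_borel ?T"
      using q n dp by (intro root_measure_image) auto
    with that[of q] q_real q(3) dq 2 show ?thesis by (simp add: Some)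
  qed
qed


section \<open>Limits of the root measures of derivatives\<close>

lemma degree_higher_pderiv: "degree ((pderiv ^^ K) q) = degree (q :: complex poly) - K"
  by (induction K) (simp_all add: degree_pderiv)

context ext_prob
begin

lemma AE_infinity:
  assumes "measure M {None} = 1"
  shows "AE x in M. x = None"
proof -
  have "AE x in M. x \<in> {None}"
    using assms infinity_sphere_borel by (intro prob_eq_1[THEN iffD1]) auto
  then show ?thesis by simp
qed

lemma cauchy_transform_infinity:
  assumes "measure M {None} = 1"
  shows "cauchy_transform M z = 0"
proof -
  have "cauchy_transform M z = (LINT x|M. 0)"
    unfolding cauchy_transform_eq
  proof (rule integral_cong_AE)
    show "AE x in M. cauchy_kernel z x = 0" using AE_infinity[OF assms] by eventually_elim simp
  qed auto
  then show ?thesis by simp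
qed

lemma eq_return_infinity:
  assumes "measure M {None} = 1"
  shows "M = return sphere_borel None"
proof (rule measure_eqI)
  fix A assume A: "A \<in> sets M"
  have "emeasure M A = emeasure M (if None \<in> A then space M else {})"
    by (rule emeasure_eq_AE)
      (use AE_infinity[OF assms] A sets.top[of sphere_borel] in \<open>auto elim!: eventually_mono\<close>)
  then show "emeasure M A = emeasure (return sphere_borel None) A"
    using A emeasure_space_1 by (auto simp: indicator_def)
qed simp

lemma real_prob_finite_part:
  assumes "measure M {None} < 1"
  shows "real_prob (uniform_measure M (range Some))"
proof -
  let ?N = "uniform_measure M (range Some)"
  have F: "range Some \<in> sets M" using finite_points_sphere_borel by simp
  have pos: "emeasure M (range Some) \<noteq> 0" using assms by (simp add: emeasure_eq_measure prob_finite)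
  have "prob_space ?N" using pos by (intro prob_space_uniform_measure) auto
  moreover have "emeasure ?N (- extended_real_line) = 0"
  proof -
    have ms: "- extended_real_line \<in> sets M" using compl_extended_real_line by simp
    have "emeasure M (range Some \<inter> - extended_real_line) \<le> emeasure M (- extended_real_line)"
      using ms by (intro emeasure_mono) auto
    then show ?thesis using ext_M by (simp add: emeasure_uniform_measure[OF F ms])
  qed
  moreover have "measure ?N {None} = 0"
  proof -
    have "range Some \<inter> {None} = {}" by auto
    then have "emeasure ?N {None} = 0"
      using infinity_sphere_borel F by (simp add: emeasure_uniform_measure)
    then show ?thesis by (simp add: measure_def)
  qed
  ultimately show ?thesis by (simp add: real_prob_def real_prob_axioms_def ext_prob_def ext_prob_axioms_def)
qed

lemma cauchy_transform_finite_part: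
  assumes "measure M {None} < 1"
  shows "cauchy_transform (uniform_measure M (range Some)) z = cauchy_transform M z / of_real (1 - measure M {None})"
proof -
  let ?s = "measure M {None}" and ?F = "range (Some :: complex \<Rightarrow> complex option)"
  have F: "?F \<in> sets M" using finite_points_sphere_borel by simp
  have "uniform_measure M ?F = density M (\<lambda>x. ennreal (indicator ?F x / (1 - ?s)))"
  proof -
    have "indicator ?F x / emeasure M ?F = ennreal (indicator ?F x / (1 - ?s))" for x
      using assms by (simp add: emeasure_eq_measure prob_finite divide_ennreal ennreal_indicator[symmetric])
    then show ?thesis unfolding uniform_measure_def by (simp only:)
  qed
  then have "cauchy_transform (uniform_measure M ?F) z = (LINT x|M. (indicator ?F x / (1 - ?s)) *\<^sub>R cauchy_kernel z x)"
    unfolding cauchy_transform_eq using F assms by (subst integral_density[symmetric]) auto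
  also have "\<dots> = (LINT x|M. cauchy_kernel z x / of_real (1 - ?s))"
  proof (rule Bochner_Integration.integral_cong[OF refl])
    fix x show "(indicator ?F x / (1 - ?s)) *\<^sub>R cauchy_kernel z x = cauchy_kernel z x / of_real (1 - ?s)"
      by (cases x) (auto simp: scaleR_conv_of_real)
  qed
  also have "\<dots> = cauchy_transform M z / of_real (1 - ?s)" by (simp add: cauchy_transform_eq)
  finally show ?thesis .
qed

text \<open>The behaviour along the imaginary axis recovers the mass of the finite part.\<close>

lemma cauchy_transform_vertical_limit:
  "(\<lambda>k. (\<i> * of_nat (Suc k)) * cauchy_transform M (\<i> * of_nat (Suc k))) \<longlonglongrightarrow> of_real (1 - measure M {None})"
proof (rule cauchy_transform_mult_tendsto(1)[where w = "\<lambda>k. \<i> * of_nat (Suc k)" and C = 1])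
  have "filterlim (\<lambda>k. real (Suc k)) at_top sequentially"
    by (rule filterlim_compose[OF filterlim_real_sequentially filterlim_Suc])
  then show "filterlim (\<lambda>k. Im (\<i> * of_nat (Suc k))) at_top sequentially"
    "filterlim (\<lambda>k. Im (\<i> * of_nat (Suc k))) at_top sequentially" by simp_all
qed (auto simp: norm_mult simp del: of_nat_Suc)

end

text \<open>The case \<open>a = \<infinity>\<close> of the main theorem, with a limit \<open>M\<close> that may have an atom at infinity. Roots at infinity
are present as the defect of \<open>degree (q j)\<close> from the formal degree \<open>n j\<close>.\<close>

locale derivative_sequence =
  fixes n m :: "nat \<Rightarrow> nat" and q :: "nat \<Rightarrow> complex poly" and M :: "complex option measure" and t :: real
  assumes rr: "\<And>j. real_rooted (q j)" and dq: "\<And>j. degree (q j) \<le> n j" "\<And>j. degree (q j) > n j - m j"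
    and m: "\<And>j. m j > 0" "\<And>j. m j \<le> n j" and n: "strict_mono n"
    and t: "t \<ge> 1" "(\<lambda>j. real (n j) / real (m j)) \<longlonglongrightarrow> t"
    and M: "weakly_converges (\<lambda>j. root_measure (n j) (q j)) M"
begin

definition K :: "nat \<Rightarrow> nat" where "K j = n j - m j"

definition deriv_root_measure :: "nat \<Rightarrow> complex option measure" where
  "deriv_root_measure j = root_measure (m j) ((pderiv ^^ K j) (q j))"

lemma n_pos: "n j > 0" using m[of j] by linarith

lemma real_rooted_deriv: "real_rooted ((pderiv ^^ K j) (q j))"
  using real_rooted_higher_pderiv[OF rr] dq(2) by (simp add: K_def)

lemma degree_deriv: "degree ((pderiv ^^ K j) (q j)) \<le> m j"
  using dq(1)[of j] m(2)[of j] by (simp add: degree_higher_pderiv K_def)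

lemma ext_prob_deriv_root_measure: "ext_prob (deriv_root_measure j)"
  unfolding deriv_root_measure_def
proof (rule ext_prob_root_measure[OF m(1) degree_deriv])
  show "set_mset (sphere_roots (m j) ((pderiv ^^ K j) (q j))) \<subseteq> extended_real_line"
    using real_rooted_proots[OF real_rooted_deriv[of j]]
    by (auto simp: sphere_roots_def extended_real_line_def simp del: set_count_proots)
qed

sublocale M: ext_prob M
  using weakly_converges_prob[OF M] by blast

lemma n_at_top: "filterlim (\<lambda>j. real (n j)) at_top sequentially"
  by (rule filterlim_compose[OF filterlim_real_sequentially filterlim_subseq[OF n]])

lemma mn_limit: "(\<lambda>j. real (m j) / real (n j)) \<longlonglongrightarrow> 1 / t"
  using tendsto_inverse[OF t(2)] t(1) by (simp add: inverse_eq_divide)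

lemma Kn_limit: "(\<lambda>j. real (K j) / real (n j)) \<longlonglongrightarrow> 1 - 1 / t"
proof -
  have "real (K j) / real (n j) = 1 - real (m j) / real (n j)" for j
    using m(2)[of j] n_pos[of j] by (simp add: K_def of_nat_diff diff_divide_distrib)
  then show ?thesis using tendsto_diff[OF tendsto_const mn_limit] by simp
qed

lemma cauchy_transform_root_limit:
  assumes "Im z > 0"
  shows "(\<lambda>j. log_deriv (q j) z / of_nat (n j)) \<longlonglongrightarrow> cauchy_transform M z"
proof -
  have "cauchy_transform (root_measure (n j) (q j)) z = log_deriv (q j) z / of_nat (n j)" for j
    using n_pos dq(1) real_rooted_nonzero[OF rr] assms by (intro cauchy_transform_root_measure) auto
  then show ?thesis using weakly_converges_imp_cauchy_transform[OF M assms] by simp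
qed

context
  fixes \<sigma> :: "complex option measure"
  assumes \<sigma>: "weakly_converges deriv_root_measure \<sigma>"
begin

interpretation \<sigma>: ext_prob \<sigma>
  using weakly_converges_prob[OF \<sigma>] by blast

lemma cauchy_transform_deriv_limit:
  assumes "Im z > 0"
  shows "(\<lambda>j. log_deriv ((pderiv ^^ K j) (q j)) z / of_nat (n j)) \<longlonglongrightarrow> cauchy_transform \<sigma> z / of_real t"
proof -
  have "cauchy_transform (deriv_root_measure j) z = log_deriv ((pderiv ^^ K j) (q j)) z / of_nat (m j)" for j
    unfolding deriv_root_measure_def using m degree_deriv real_rooted_nonzero[OF real_rooted_deriv] assms
    by (intro cauchy_transform_root_measure) auto
  then have "(\<lambda>j. log_deriv ((pderiv ^^ K j) (q j)) z / of_nat (m j)) \<longlonglongrightarrow> cauchy_transform \<sigma> z"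
    using weakly_converges_imp_cauchy_transform[OF \<sigma> assms] by simp
  from tendsto_mult[OF this tendsto_of_real[OF mn_limit]]
  have "(\<lambda>j. log_deriv ((pderiv ^^ K j) (q j)) z / of_nat (m j) * of_real (real (m j) / real (n j)))
      \<longlonglongrightarrow> cauchy_transform \<sigma> z * of_real (1 / t)" .
  moreover have "log_deriv ((pderiv ^^ K j) (q j)) z / of_nat (m j) * of_real (real (m j) / real (n j)) =
      log_deriv ((pderiv ^^ K j) (q j)) z / of_nat (n j)" for j
    using m(1)[of j] by simp
  ultimately have "(\<lambda>j. log_deriv ((pderiv ^^ K j) (q j)) z / of_nat (n j)) \<longlonglongrightarrow> cauchy_transform \<sigma> z * of_real (1 / t)"
    by (simp only:)
  then show ?thesis by simp
qed

text \<open>The backward characteristic that ends in \<open>z\<close> starts at a point \<open>w\<close> near \<open>w\<^sub>0 = z + (t - 1) / G\<^sub>\<sigma>(z)\<close>, as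
\<open>K / u\<^sub>K(z)\<close> tends to \<open>(1 - 1 / t) / (G\<^sub>\<sigma>(z) / t)\<close>. The Cauchy transforms of the root measures of
\<open>q j\<close> are Lipschitz on \<open>Im w \<ge> Im z\<close> with a common constant, so \<open>w\<close> may be replaced by \<open>w\<^sub>0\<close> in the limit.\<close>

lemma limit_functional_equation:
  assumes z: "Im z > 0" and g0: "cauchy_transform \<sigma> z \<noteq> 0"
  shows "cauchy_transform \<sigma> z / of_real t = cauchy_transform M (z + of_real (t - 1) / cauchy_transform \<sigma> z)"
proof -
  define g y where "g = cauchy_transform \<sigma> z" and "y = Im z"
  define v where "v j = log_deriv ((pderiv ^^ K j) (q j)) z" for j
  define w0 where "w0 = z + of_real (t - 1) / g"
  \<comment> \<open>Half of the limit of \<open>\<bar>v j\<bar> / n j\<close>, so that the final values eventually exceed \<open>\<delta> n j\<close>.\<close>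
  define \<delta> where "\<delta> = norm g / (2 * t)"
  define C where "C = 2 / (y\<^sup>2 * \<delta>) + 1 / y"
  define E where "E j = 2 / (y\<^sup>2 * \<delta>) / real (n j) + (2 * C / \<delta>\<^sup>2 / real (n j) + norm (z + of_nat (K j) / v j - w0)) / (y * y)" for j
  let ?A = "\<lambda>j. cauchy_transform (root_measure (n j) (q j))"
  have t0: "t > 0" using t(1) by simp
  have y0: "y > 0" using z by (simp add: y_def)
  have gpos: "norm g > 0" using g0 by (simp add: g_def)
  then have \<delta>0: "\<delta> > 0" using t0 by (simp add: \<delta>_def)
  have v: "(\<lambda>j. v j / of_nat (n j)) \<longlonglongrightarrow> g / of_real t"
    unfolding v_def g_def by (rule cauchy_transform_deriv_limit[OF z])
  have "Im g \<le> 0"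
    using \<sigma>.Im_cauchy_transform[OF z] z by (simp add: g_def)
  then have "Im (of_real (t - 1) / g) \<ge> 0" using t(1) by (intro Im_of_real_divide_nonneg) auto
  then have w0y: "Im w0 \<ge> y" by (simp add: w0_def y_def)
  have char: "(\<lambda>j. z + of_nat (K j) / v j) \<longlonglongrightarrow> w0"
  proof -
    have "(\<lambda>j. of_real (real (K j) / real (n j)) / (v j / of_nat (n j))) \<longlonglongrightarrow> of_real (1 - 1 / t) / (g / of_real t)"
      using gpos t0 by (intro tendsto_divide tendsto_of_real Kn_limit v) auto
    moreover have "of_real (real (K j) / real (n j)) / (v j / of_nat (n j)) = of_nat (K j) / v j" for j
      using n_pos[of j] by simp
    moreover have "of_real (1 - 1 / t) / (g / of_real t) = of_real (t - 1) / g"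
    proof -
      have "1 - 1 / t = (t - 1) / t" using t0 by (simp add: field_simps)
      then have "complex_of_real (1 - 1 / t) = of_real (t - 1) / of_real t" by (simp only: of_real_divide)
      then show ?thesis using t0 by (simp only:) simp
    qed
    ultimately have "(\<lambda>j. of_nat (K j) / v j) \<longlonglongrightarrow> of_real (t - 1) / g" by (simp only:)
    then show ?thesis unfolding w0_def by (intro tendsto_add tendsto_const)
  qed
  have n_ev: "\<forall>\<^sub>F j in sequentially. real (n j) \<ge> B" for B
    using n_at_top by (simp add: filterlim_at_top)
  have v_ev: "\<forall>\<^sub>F j in sequentially. norm (v j) \<ge> \<delta> * real (n j)"
  proof -
    have "(\<lambda>j. norm (v j / of_nat (n j))) \<longlonglongrightarrow> norm (g / of_real t)" using v by (rule tendsto_norm)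
    moreover have "\<delta> < norm (g / of_real t)" using gpos t0 by (simp add: \<delta>_def norm_divide field_simps)
    ultimately have "\<forall>\<^sub>F j in sequentially. \<delta> < norm (v j / of_nat (n j))" by (rule order_tendstoD)
    then show ?thesis
    proof eventually_elim
      case (elim j)
      then show ?case using n_pos[of j] by (simp add: norm_divide field_simps)
    qed
  qed
  have "\<forall>\<^sub>F j in sequentially. norm (v j / of_nat (n j) - ?A j w0) \<le> E j"
    using v_ev n_ev[of "2 * C / \<delta>"]
  proof eventually_elim
    case (elim j)
    let ?N = "real (n j)"
    define b e where "b = \<delta> * ?N / 2" and "e = 1 / ((Im z)\<^sup>2 * b)"
    have N0: "?N > 0" using n_pos by simp
    have b0: "b > 0" using \<delta>0 N0 by (simp add: b_def)
    have Ne: "?N * e = 2 / (y\<^sup>2 * \<delta>)" using N0 by (simp add: e_def b_def y_def)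
    then have C': "C = ?N * e + 1 / Im z" by (simp add: C_def y_def)
    have Cb: "C \<le> b" using elim(2) \<delta>0 by (simp add: b_def field_simps)
    have KN: "K j \<le> n j" by (simp add: K_def)
    have vb: "norm (v j) \<ge> 2 * b" using elim(1) by (simp add: b_def)
    obtain w where w: "Im w \<ge> Im z" "norm (log_deriv (q j) w - v j) \<le> real (K j) * e"
        "norm (w - (z + of_nat (K j) / v j)) \<le> real (K j) * (C / (2 * b\<^sup>2))"
      using backward_characteristic[OF rr _ KN z b0 v_def vb e_def C' Cb] dq(2)[of j] by (auto simp: K_def)
    have e0: "e \<ge> 0" using b0 by (simp add: e_def)
    have C0: "C \<ge> 0" using y0 \<delta>0 by (simp add: C_def)
    have Imw: "Im w > 0" "Im w \<ge> y" using w(1) z by (auto simp: y_def)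
    have Aw: "?A j w = log_deriv (q j) w / of_nat (n j)"
      using n_pos dq(1) real_rooted_nonzero[OF rr] Imw by (intro cauchy_transform_root_measure) auto
    interpret P: ext_prob "root_measure (n j) (q j)" using weakly_converges_prob[OF M] by blast
    have "norm (v j / of_nat (n j) - ?A j w) = norm (log_deriv (q j) w - v j) / ?N"
      by (simp add: Aw norm_divide norm_minus_commute flip: diff_divide_distrib)
    also have "\<dots> \<le> (?N * e) / ?N"
      using w(2) KN e0 N0 by (intro divide_right_mono order_trans[OF w(2)] mult_right_mono) auto
    finally have 1: "norm (v j / of_nat (n j) - ?A j w) \<le> 2 / (y\<^sup>2 * \<delta>) / ?N" unfolding Ne .
    have "norm (w - (z + of_nat (K j) / v j)) \<le> ?N * (C / (2 * b\<^sup>2))"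
      using KN C0 by (intro order_trans[OF w(3)] mult_right_mono) auto
    also have "\<dots> = 2 * C / \<delta>\<^sup>2 / ?N" using N0 \<delta>0 by (simp add: b_def power2_eq_square field_simps)
    finally have "norm (w - w0) \<le> 2 * C / \<delta>\<^sup>2 / ?N + norm (z + of_nat (K j) / v j - w0)"
      using norm_triangle_ineq[of "w - (z + of_nat (K j) / v j)" "z + of_nat (K j) / v j - w0"] by simp
    then have "norm (w - w0) / (Im w * Im w0) \<le> (2 * C / \<delta>\<^sup>2 / ?N + norm (z + of_nat (K j) / v j - w0)) / (y * y)"
      using Imw w0y y0 order_trans[OF norm_ge_zero[of "w - w0"]] by (intro frac_le mult_mono) auto
    then have 2: "norm (?A j w - ?A j w0) \<le> (2 * C / \<delta>\<^sup>2 / ?N + norm (z + of_nat (K j) / v j - w0)) / (y * y)"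
      using P.cauchy_transform_lipschitz[of w w0] Imw w0y y0 by linarith
    show ?case
      using 1 2 norm_triangle_ineq[of "v j / of_nat (n j) - ?A j w" "?A j w - ?A j w0"] by (simp add: E_def)
  qed
  moreover have "E \<longlonglongrightarrow> 0"
  proof -
    have c: "(\<lambda>j. c / real (n j)) \<longlonglongrightarrow> 0" for c by (rule real_tendsto_divide_at_top[OF tendsto_const n_at_top])
    have d: "(\<lambda>j. norm (z + of_nat (K j) / v j - w0)) \<longlonglongrightarrow> 0"
      using char by (simp add: tendsto_norm_zero_iff LIM_zero_iff)
    have "E
        \<longlonglongrightarrow> 0 + (0 + 0) / (y * y)"
      unfolding E_def by (intro tendsto_add tendsto_divide tendsto_const c d) (use y0 in auto)
    then show ?thesis by simp
  qed
  ultimately have "(\<lambda>j. v j / of_nat (n j) - ?A j w0) \<longlonglongrightarrow> 0" by (rule Lim_null_comparison)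
  moreover have "(\<lambda>j. v j / of_nat (n j) - ?A j w0) \<longlonglongrightarrow> g / of_real t - cauchy_transform M w0"
    using w0y y0 by (intro tendsto_diff v weakly_converges_imp_cauchy_transform[OF M]) simp
  ultimately have "g / of_real t - cauchy_transform M w0 = 0" using LIMSEQ_unique by blast
  then show ?thesis by (simp add: g_def w0_def)
qed

lemma limit_Im_bound:
  assumes z: "Im z > 0"
  shows "Im (cauchy_transform \<sigma> z) / t \<le> Im (cauchy_transform M z) + (1 - 1 / t) / Im z"
proof (rule LIMSEQ_le)
  show "(\<lambda>j. Im (log_deriv ((pderiv ^^ K j) (q j)) z / of_nat (n j))) \<longlonglongrightarrow> Im (cauchy_transform \<sigma> z) / t"
    using tendsto_Im[OF cauchy_transform_deriv_limit[OF z]] by simp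
  show "(\<lambda>j. Im (log_deriv (q j) z / of_nat (n j)) + real (K j) / real (n j) / Im z)
      \<longlonglongrightarrow> Im (cauchy_transform M z) + (1 - 1 / t) / Im z"
    using z by (intro tendsto_add tendsto_divide tendsto_Im cauchy_transform_root_limit Kn_limit tendsto_const) auto
  have "Im (log_deriv ((pderiv ^^ K j) (q j)) z / of_nat (n j)) \<le> Im (log_deriv (q j) z / of_nat (n j)) + real (K j) / real (n j) / Im z" for j
  proof -
    have "Im (log_deriv ((pderiv ^^ K j) (q j)) z) \<le> Im (log_deriv (q j) z) + real (K j) / Im z"
      using Im_log_deriv_higher_pderiv_le[OF rr _ z] dq(2)[of j] by (simp add: K_def)
    then have "Im (log_deriv ((pderiv ^^ K j) (q j)) z) / real (n j) \<le> (Im (log_deriv (q j) z) + real (K j) / Im z) / real (n j)"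
      by (rule divide_right_mono) simp
    then show ?thesis by (simp add: add_divide_distrib mult.commute del: Im_divide)
  qed
  then show "\<exists>N. \<forall>j\<ge>N. Im (log_deriv ((pderiv ^^ K j) (q j)) z / of_nat (n j)) \<le> Im (log_deriv (q j) z / of_nat (n j)) + real (K j) / real (n j) / Im z"
    by blast
qed

text \<open>For \<open>\<sigma>\<close> concentrated at infinity the previous bound reads \<open>- y Im G\<^sub>M(\<i>y) \<le> 1 - 1 / t\<close>, and the left-hand
side tends to \<open>1 - M{\<infinity>}\<close> as \<open>y\<close> grows.\<close>

lemma limit_not_infinity:
  assumes "t * measure M {None} < 1"
  shows "measure \<sigma> {None} < 1"
proof (rule ccontr)
  assume "\<not> ?thesis"
  then have "measure \<sigma> {None} = 1" using \<sigma>.prob_le_1[of "{None}"] by linarith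
  then have G\<sigma>: "cauchy_transform \<sigma> z = 0" for z by (rule \<sigma>.cauchy_transform_infinity)
  let ?z = "\<lambda>k. \<i> * of_nat (Suc k)"
  have lim: "(\<lambda>k. Re (?z k * cauchy_transform M (?z k))) \<longlonglongrightarrow> 1 - measure M {None}"
    using tendsto_Re[OF M.cauchy_transform_vertical_limit] by (simp del: of_nat_Suc)
  have le: "Re (?z k * cauchy_transform M (?z k)) \<le> 1 - 1 / t" for k
  proof -
    have "0 \<le> Im (cauchy_transform M (?z k)) + (1 - 1 / t) / real (Suc k)"
      using limit_Im_bound[of "?z k"] by (simp add: G\<sigma> del: of_nat_Suc)
    then have "0 \<le> real (Suc k) * (Im (cauchy_transform M (?z k)) + (1 - 1 / t) / real (Suc k))" by simp
    then show ?thesis by (simp add: distrib_left del: of_nat_Suc)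
  qed
  have "1 - measure M {None} \<le> 1 - 1 / t" by (rule LIMSEQ_le_const2[OF lim]) (use le in blast)
  then show False using assms t(1) by (simp add: field_simps)
qed

text \<open>For \<open>z \<rightarrow> \<i>\<infinity>\<close> the transform \<open>G\<^sub>\<sigma>(z)\<close> behaves like \<open>c / z\<close>, with the finite mass \<open>c\<close> of
\<open>\<sigma>\<close>, and the argument on the right of the functional equation like \<open>(1 + (t - 1) / c) z\<close>. Comparison of the
leading coefficients gives \<open>c = 1 - t M{\<infinity>}\<close>.\<close>

lemma limit_mass_infinity:
  assumes "measure \<sigma> {None} < 1"
  shows "measure \<sigma> {None} = t * measure M {None}"
proof -
  define c where "c = 1 - measure \<sigma> {None}"
  have c: "c > 0" using assms by (simp add: c_def)
  have t0: "t > 0" using t(1) by simp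
  define z where "z k = \<i> * of_nat (Suc k)" for k
  define G where "G k = cauchy_transform \<sigma> (z k)" for k
  define w where "w k = z k + of_real (t - 1) / G k" for k
  have Imz: "Im (z k) = real (Suc k)" "norm (z k) = real (Suc k)" "Im (z k) > 0" for k
    by (simp_all add: z_def norm_mult del: of_nat_Suc)
  have z0: "z k \<noteq> 0" for k using Imz(3)[of k] by auto
  have ImG: "Im (G k) < 0" for k unfolding G_def using \<sigma>.Im_cauchy_transform_neg[OF Imz(3) assms] .
  then have G0: "G k \<noteq> 0" for k by (metis less_irrefl zero_complex.simps(2))
  have zG: "(\<lambda>k. z k * G k) \<longlonglongrightarrow> of_real c"
    unfolding z_def G_def c_def by (rule \<sigma>.cauchy_transform_vertical_limit)
  have FE: "G k / of_real t = cauchy_transform M (w k)" for k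
    unfolding w_def G_def using limit_functional_equation[OF Imz(3)] G0[unfolded G_def] by blast
  have wz: "(\<lambda>k. w k / z k) \<longlonglongrightarrow> 1 + of_real (t - 1) / of_real c"
  proof -
    have "w k / z k = 1 + of_real (t - 1) / (z k * G k)" for k
      using z0 G0 by (simp add: w_def add_divide_distrib mult.commute)
    then show ?thesis using c by (simp only:) (intro tendsto_add tendsto_divide tendsto_const zG, simp)
  qed
  have Imw: "Im (w k) \<ge> Im (z k)" for k
  proof -
    have "Im (of_real (t - 1) / G k) \<ge> 0" using t(1) ImG[of k] by (intro Im_of_real_divide_nonneg) auto
    then show ?thesis by (simp add: w_def)
  qed
  obtain B where B: "\<And>k. norm (w k / z k) \<le> B"
    using convergent_imp_Bseq[OF convergentI[OF wz]] by (auto simp: Bseq_def)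
  have "norm (w k) \<le> B * Im (w k)" for k
  proof -
    have B0: "B \<ge> 0" using B[of 0] norm_ge_zero order_trans by blast
    have "norm (w k) \<le> B * norm (z k)" using B[of k] z0[of k] by (simp add: norm_divide divide_le_eq)
    also have "\<dots> \<le> B * Im (w k)" using Imw[of k] Imz[of k] B0 by (intro mult_left_mono) auto
    finally show ?thesis .
  qed
  moreover have "filterlim (\<lambda>k. Im (w k)) at_top sequentially"
  proof (rule filterlim_at_top_mono[OF filterlim_real_sequentially])
    show "\<forall>\<^sub>F k in sequentially. real k \<le> Im (w k)" using Imw Imz(1) by (intro always_eventually allI) (smt (verit) of_nat_Suc)
  qed
  moreover have "Im (w k) > 0" for k using Imw[of k] Imz(3)[of k] by linarith
  ultimately have 1: "(\<lambda>k. w k * cauchy_transform M (w k)) \<longlonglongrightarrow> of_real (1 - measure M {None})"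
    by (intro M.cauchy_transform_mult_tendsto(1)[where w = w and C = B])
  have "w k * cauchy_transform M (w k) = (w k / z k) * (z k * G k) / of_real t" for k
    using z0 by (simp flip: FE)
  then have 2: "(\<lambda>k. w k * cauchy_transform M (w k)) \<longlonglongrightarrow> (1 + of_real (t - 1) / of_real c) * of_real c / of_real t"
    using t0 by (simp only:) (intro tendsto_mult tendsto_divide tendsto_const wz zG, simp)
  have "complex_of_real (1 - measure M {None}) = of_real ((1 + (t - 1) / c) * c / t)"
    using LIMSEQ_unique[OF 1 2] by simp
  then have "1 - measure M {None} = (1 + (t - 1) / c) * c / t" by (simp only: of_real_eq_iff)
  also have "(1 + (t - 1) / c) * c = c + t - 1" using c by (simp add: field_simps)
  finally have "t * (1 - measure M {None}) = c + t - 1" using t0 by (simp add: field_simps)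
  then show ?thesis by (simp add: c_def algebra_simps)
qed

text \<open>Normalizing the finite parts of \<open>M\<close> and \<open>\<sigma>\<close> turns the functional equation for \<open>t\<close> into the one for
\<open>t' = (t - t s) / (1 - t s)\<close>, the exponent in the definition of the free flow
for \<open>s = M{\<infinity>}\<close>.\<close>

theorem limit_eq_free_flow: "\<sigma> = free_flow t M"
proof (cases "t * measure M {None} < 1")
  case False
  have "measure \<sigma> {None} = 1"
    using limit_mass_infinity \<sigma>.prob_le_1[of "{None}"] False by linarith
  then show ?thesis using False \<sigma>.eq_return_infinity by (simp add: free_flow_def)
next
  case True
  let ?s = "measure M {None}"
  let ?\<nu> = "uniform_measure M (range Some)" and ?\<rho> = "uniform_measure \<sigma> (range Some)"
  define t' where "t' = (t - t * ?s) / (1 - t * ?s)"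
  have t0: "t > 0" using t(1) by simp
  have s\<sigma>1: "measure \<sigma> {None} < 1" by (rule limit_not_infinity[OF True])
  have s\<sigma>: "measure \<sigma> {None} = t * ?s" by (rule limit_mass_infinity[OF s\<sigma>1])
  have "?s \<le> t * ?s" using t(1) mult_right_mono[of 1 t ?s] by simp
  then have sM1: "?s < 1" using True by linarith
  have t': "t' \<ge> 1" using t(1) True by (simp add: t'_def field_simps)
  have "free_flow_finite t' ?\<nu> = ?\<rho>"
  proof (rule free_flow_finite_eqI[OF M.real_prob_finite_part[OF sM1] \<sigma>.real_prob_finite_part[OF s\<sigma>1] t'])
    fix z assume z: "Im z > 0"
    let ?g = "cauchy_transform \<sigma> z"
    have g0: "?g \<noteq> 0" using \<sigma>.Im_cauchy_transform_neg[OF z s\<sigma>1] by auto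
    have \<rho>: "cauchy_transform ?\<rho> z = ?g / of_real (1 - t * ?s)"
      using \<sigma>.cauchy_transform_finite_part[OF s\<sigma>1] by (simp add: s\<sigma>)
    have d: "1 - t * ?s \<noteq> 0" "1 - ?s \<noteq> 0" using True sM1 by auto
    have t1: "t' - 1 = (t - 1) / (1 - t * ?s)" using d by (simp add: t'_def field_simps)
    have tt: "(1 - t * ?s) * t' = t * (1 - ?s)"     proof -
      have "(1 - t * ?s) * t' = t - t * ?s" using d(1) by (simp add: t'_def)
      then show ?thesis by (simp add: right_diff_distrib)
    qed
    have "of_real (t' - 1) / cauchy_transform ?\<rho> z = of_real (t - 1) / ?g"
      unfolding t1 \<rho> using d(1) by (simp del: of_real_diff of_real_mult)
    then have "cauchy_transform ?\<nu> (z + of_real (t' - 1) / cauchy_transform ?\<rho> z)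
        = cauchy_transform M (z + of_real (t - 1) / ?g) / of_real (1 - ?s)"
      using M.cauchy_transform_finite_part[OF sM1] by simp
    also have "\<dots> = ?g / of_real (t * (1 - ?s))"
      unfolding limit_functional_equation[OF z g0, symmetric] by simp
    also have "\<dots> = cauchy_transform ?\<rho> z / of_real t'"
      unfolding \<rho> tt[symmetric] by simp
    finally show "cauchy_transform ?\<rho> z / of_real t' = cauchy_transform ?\<nu> (z + of_real (t' - 1) / cauchy_transform ?\<rho> z)" ..
  qed
  then have "free_flow t M = mix (t * ?s) (return sphere_borel None) ?\<rho>"
    using True by (simp add: free_flow_def Let_def t'_def)
  also have "\<dots> = \<sigma>"
    using mix_decomposition[OF \<sigma>.prob_space_axioms \<sigma>.sets_M s\<sigma>1] by (simp add: s\<sigma>)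
  finally show ?thesis ..
qed

end

end

text \<open>Every subsequence has a weakly convergent subsequence, which again is a derivative sequence for \<open>M\<close> and \<open>t\<close>; so its limit
is the free flow.\<close>

theorem derivative_sequence_converges:
  assumes "derivative_sequence n m q M t"
  shows "weakly_converges (\<lambda>j. root_measure (m j) ((pderiv ^^ (n j - m j)) (q j))) (free_flow t M)"
proof -
  interpret derivative_sequence n m q M t by fact
  have dm: "deriv_root_measure = (\<lambda>j. root_measure (m j) ((pderiv ^^ (n j - m j)) (q j)))"
    by (simp add: fun_eq_iff deriv_root_measure_def K_def)
  have sub: "\<exists>r'. strict_mono r' \<and> weakly_converges (\<lambda>k. deriv_root_measure (r (r' k))) (free_flow t M)"
    if r: "strict_mono r" for r :: "nat \<Rightarrow> nat"
  proof -
    obtain r' :: "nat \<Rightarrow> nat" and \<sigma> where r': "strict_mono r'" "weakly_converges (\<lambda>k. deriv_root_measure (r (r' k))) \<sigma>"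
      using weak_compactness[of "\<lambda>k. deriv_root_measure (r k)"] ext_prob_deriv_root_measure by blast
    define s where "s = r \<circ> r'"
    have s: "strict_mono s" unfolding s_def using r r'(1) by (rule strict_mono_o)
    interpret S: derivative_sequence "\<lambda>k. n (s k)" "\<lambda>k. m (s k)" "\<lambda>k. q (s k)" M t
    proof
      show "strict_mono (\<lambda>k. n (s k))" using strict_mono_o[OF n s] by (simp add: o_def)
      show "(\<lambda>k. real (n (s k)) / real (m (s k))) \<longlonglongrightarrow> t"
        using LIMSEQ_subseq_LIMSEQ[OF t(2) s] by (simp add: o_def)
      show "weakly_converges (\<lambda>k. root_measure (n (s k)) (q (s k))) M"
        by (rule weakly_converges_subseq[OF M s])
    qed (use rr dq m t in auto)
    have "S.deriv_root_measure = (\<lambda>k. deriv_root_measure (s k))"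
      by (simp add: fun_eq_iff S.deriv_root_measure_def deriv_root_measure_def S.K_def K_def)
    moreover have "(\<lambda>k. deriv_root_measure (s k)) = (\<lambda>k. deriv_root_measure (r (r' k)))" by (simp add: s_def)
    ultimately have "S.deriv_root_measure = (\<lambda>k. deriv_root_measure (r (r' k)))" by (rule trans)
    then have "\<sigma> = free_flow t M" using S.limit_eq_free_flow[of \<sigma>] r'(2) by simp
    then show ?thesis using r' by blast
  qed
  have "ext_prob (free_flow t M)"
    using sub[of "\<lambda>x. x"] weakly_converges_prob(2) by (auto simp: strict_mono_def)
  then have "weakly_converges deriv_root_measure (free_flow t M)"
    using ext_prob_deriv_root_measure sub by (intro weakly_converges_subseq_criterion)
  then show ?thesis by (simp only: dm)
qed

theorem theorem1p1:
  fixes a :: "complex option"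
    and n m :: "nat \<Rightarrow> nat"
    and p :: "nat \<Rightarrow> complex poly"
    and \<mu> :: "complex option measure"
    and t :: real
  assumes "a \<in> extended_real_line"
    and "strict_mono n" and "\<And>j. n j > 0"
    and "\<And>j. p j \<in> polys_with_roots_in (n j) extended_real_line"
    and "\<mu> \<in> prob_measures_on real_line"
    and "weakly_converges (\<lambda>j. root_measure (n j) (p j)) \<mu>"
    and "t \<ge> 1"
    and "\<And>j. m j > 0" and "\<And>j. m j \<le> n j"
    and "(\<lambda>j. real (n j) / real (m j)) \<longlonglongrightarrow> t"
    and "\<And>j. count (sphere_roots (n j) (p j)) a < m j"
  shows "weakly_converges (\<lambda>j. root_measure (m j) (polar_deriv_down a (m j) (n j) (p j)))
           (free_flow_at a t \<mu>)"
proof -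
  let ?T = "to_infinity a"
  have "\<forall>j. \<exists>q. real_rooted q \<and> degree q \<le> n j \<and> degree q > n j - m j \<and>
    root_measure (n j) q = distr (root_measure (n j) (p j)) sphere_borel ?T \<and>
    root_measure (m j) (polar_deriv_down a (m j) (n j) (p j)) =
      distr (root_measure (m j) ((pderiv ^^ (n j - m j)) q)) sphere_borel (inv ?T)"
    using polar_derivative_as_derivative[OF assms(1) assms(4) assms(8) assms(9) assms(11)] by metis
  then obtain q where q: "\<And>j. real_rooted (q j)" "\<And>j. degree (q j) \<le> n j" "\<And>j. degree (q j) > n j - m j"
    "\<And>j. root_measure (n j) (q j) = distr (root_measure (n j) (p j)) sphere_borel ?T"
    "\<And>j. root_measure (m j) (polar_deriv_down a (m j) (n j) (p j)) =
      distr (root_measure (m j) ((pderiv ^^ (n j - m j)) (q j))) sphere_borel (inv ?T)"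
    by metis
  have "weakly_converges (\<lambda>j. root_measure (n j) (q j)) (distr \<mu> sphere_borel ?T)"
    unfolding q(4)
    by (rule weakly_converges_distr[OF assms(6) to_infinity_measurable])
      (intro to_infinity_ext ext_continuous_to_infinity assms(1); assumption)+
  then have "derivative_sequence n m q (distr \<mu> sphere_borel ?T) t"
    using q(1-3) assms(2,7-10) by unfold_locales
  then have "weakly_converges (\<lambda>j. root_measure (m j) ((pderiv ^^ (n j - m j)) (q j))) (free_flow t (distr \<mu> sphere_borel ?T))"
    by (rule derivative_sequence_converges)
  from weakly_converges_distr[OF this inv_to_infinity_measurable[of a]]
  show ?thesis
    unfolding q(5) free_flow_at_def
    using to_infinity_ext(2)[OF assms(1)] ext_continuous_to_infinity(2)[OF assms(1)] by blast
qed

end
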